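(* For each real number $\alpha>0$ and each integer $h\geq 1$, there exists a constant $C>0$ such that for any sequence of graphs $\{G_{n;\alpha}\}_{n\in h\mathbb{N}}$, where $G_{n;\alpha}$ is a balanced bipartite graph on $2n$ vertices with minimum degree $\delta(G_{n;\alpha})\geq\alpha n$, if $p\geq C\,n^{-(2h-1)/h^2}$ then with high probability $G_{n;\alpha}\cup G_{n,n,p}$ contains a perfect $K_{h,h}$-tiling.
   Context: An $H$-tiling of a graph $G$ is a collection of vertex-disjoint copies of $H$ in $G$; it is perfect if it covers all vertices of $G$. A balanced bipartite graph on $2n$ vertices has parts $A,B$ with $|A|=|B|=n$. $G_{n,n,p}$ is the random bipartite graph on the same bipartition $(A,B)$ as $G_{n;\alpha}$ in which each pair $\{a,b\}$, $a\in A$, $b\in B$, is an edge independently with probability $p$; the union is taken on the common vertex set $A\cup B$. "With high probability" means with probability tending to $1$ as $n\to\infty$. *)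

theory Defs
  imports "HOL-Probability.Probability" "Graph_Theory.Graph_Theory"
begin

text \<open>
  Finite simple undirected graphs are the \<open>pair_graph\<close>s of Graph_Theory: finite, loop-free
  and with a symmetric set of arcs, so an edge \<open>{u, v}\<close> is the pair of arcs \<open>(u, v)\<close> and
  \<open>(v, u)\<close>, and the degree of a vertex is its out-degree.
\<close>

definition balanced_bipartite :: "nat \<Rightarrow> 'a set \<Rightarrow> 'a set \<Rightarrow> 'a pair_pre_digraph \<Rightarrow> bool" where
  "balanced_bipartite n A B G \<longleftrightarrow>
     pair_graph G \<and> pverts G = A \<union> B \<and> A \<inter> B = {} \<and> card A = n \<and> card B = n \<and>
     parcs G \<subseteq> A \<times> B \<union> B \<times> A"

text \<open>Only meaningful for graphs with a finite, nonempty vertex set.\<close>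

definition min_degree :: "('a, 'b) pre_digraph \<Rightarrow> nat" where
  "min_degree G = Min (out_degree G ` verts G)"

definition bipartite_graph_of :: "'a set \<Rightarrow> 'a set \<Rightarrow> ('a \<times> 'a) set \<Rightarrow> 'a pair_pre_digraph" where
  "bipartite_graph_of A B E = \<lparr> pverts = A \<union> B, parcs = (E \<inter> A \<times> B) \<union> (E \<inter> A \<times> B)\<inverse> \<rparr>"

text \<open>
  One independent coin per pair in \<open>A \<times> B\<close>; for disjoint \<open>A\<close> and \<open>B\<close> these are exactly the
  unordered pairs between the parts. Intended for finite \<open>A\<close>, \<open>B\<close> and \<open>0 \<le> p \<le> 1\<close>.
\<close>

definition random_bipartite :: "'a set \<Rightarrow> 'a set \<Rightarrow> real \<Rightarrow> 'a pair_pre_digraph pmf" where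
  "random_bipartite A B p =
     map_pmf (\<lambda>f. bipartite_graph_of A B {e. f e})
       (Pi_pmf (A \<times> B) False (\<lambda>_. bernoulli_pmf p))"

text \<open>
  The graph \<open>H\<close> enters through the predicate \<open>is_H\<close> of being isomorphic to \<open>H\<close>, as for
  \<^const>\<open>complete_bipartite_digraph\<close>; a copy of \<open>H\<close> in \<open>G\<close> is a (not necessarily induced)
  subgraph of \<open>G\<close> satisfying \<open>is_H\<close>.
\<close>

definition tiling ::
  "(('a, 'b) pre_digraph \<Rightarrow> bool) \<Rightarrow> ('a, 'b) pre_digraph \<Rightarrow> ('a, 'b) pre_digraph set \<Rightarrow> bool"
where
  "tiling is_H G T \<longleftrightarrow> (\<forall>F\<in>T. subgraph F G \<and> is_H F) \<and> disjoint_family_on verts T"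

definition perfect_tiling ::
  "(('a, 'b) pre_digraph \<Rightarrow> bool) \<Rightarrow> ('a, 'b) pre_digraph \<Rightarrow> ('a, 'b) pre_digraph set \<Rightarrow> bool"
where
  "perfect_tiling is_H G T \<longleftrightarrow> tiling is_H G T \<and> (\<Union>F\<in>T. verts F) = verts G"

text \<open>The filter of \<open>n \<longlongrightarrow> \<infinity>\<close> along the multiples of \<open>h\<close>.\<close>

definition multiples_at_top :: "nat \<Rightarrow> nat filter" where
  "multiples_at_top h = inf at_top (principal {n. h dvd n})"

lemma multiples_at_top_neq_bot:
  assumes "h \<ge> 1"
  shows "multiples_at_top h \<noteq> bot"
proof
  assume "multiples_at_top h = bot"
  then have "\<forall>\<^sub>F n in multiples_at_top h. False" by simp
  then obtain N where N: "\<And>n. n \<ge> N \<Longrightarrow> \<not> h dvd n"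
    by (auto simp: multiples_at_top_def eventually_inf_principal eventually_at_top_linorder)
  have "h * N \<ge> N" using assms by simp
  then show False using N[of "h * N"] by simp
qed

end

theory Submission
  imports Defs "HOL-Combinatorics.Permutations" "HOL-Real_Asymp.Real_Asymp"
begin

text \<open>
  The density \<open>p\<close> makes the expected number of copies of \<open>K\<^bsub>h,h\<^esub>\<close> between two linear-sized sets
  linear, and a positive fraction of them can be made disjoint. A disjoint family changes by at most
  one copy when the edges at one vertex are resampled, so by McDiarmid's method the probability of
  seeing no copy at all is exponentially small. Splitting the random graph into many independent
  rounds makes the exponent beat the \<open>4 ^ n\<close> choices of the two sets, and greedily the random graph
  alone has disjoint tiles covering all but \<open>\<epsilon> n\<close> vertices on each side.

  The law of the random graph is invariant under permutations of \<open>A\<close> and of \<open>B\<close>, so these tiles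
  may be assumed to lie uniformly at random with respect to the deterministic graph. By the minimum
  degree, a group of \<open>2 h + 1\<close> random tiles absorbs any given \<open>h\<close> vertices of \<open>A\<close> and \<open>h\<close>
  vertices of \<open>B\<close> with probability at least \<open>\<alpha> ^ (4 h\<^sup>2)\<close>: the group and these vertices together
  are retiled by \<open>2 h + 2\<close> copies. Hence all choices of \<open>2 h\<close> vertices simultaneously have linearly
  many disjoint absorbing groups, more than are needed for the \<open>\<epsilon> n\<close> uncovered vertices. The tiles
  sampled here are a small linear number, so that passing from uniform injections to independent
  uniform vertices costs less than the exponential concentration gains.
\<close>

section \<open>Concentration for products of finitely supported distributions\<close>

text \<open>The exponent \<open>(2h - 1) / h^2\<close> is the one at which
  \<open>m^(2h) * p^(h^2)\<close> has order \<open>m\<close>. When \<open>p\<close> has exactly this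
  order, a vertex lies in a bounded expected number of copies, so a linear leftover is natural and
  \<open>C\<close> only controls its proportion \<epsilon>. McDiarmid's method is applied to a
  packing number and not to the number of copies, because one vertex may lie in many copies: with
  the edges at one vertex as a block, \<open>m\<close> blocks of influence 1 face an expectation of
  order \<open>m\<close>. The two union bounds differ in size: exponentially many pairs of sets, but
  only \<open>n^(2h)\<close> choices of vertices to be absorbed. For the latter any exponential rate
  is enough, so the constants are fixed from the absorbing side backwards: \<alpha>, the density of
  absorbing groups, the number of sampled groups, \<epsilon>, the number of rounds,
  \<open>C\<close>. The exponent \<open>4h^2\<close> counts the edges that an exchange takes from
  the deterministic graph, four families of \<open>h^2\<close> edges; the edges kept from the old
  tiles come from the random graph.\<close>

lemma expectation_pair_pmf_finite:
  fixes h :: "'a \<times> 'b \<Rightarrow> real"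
  assumes "finite (set_pmf M)" "finite (set_pmf N)"
  shows "measure_pmf.expectation (pair_pmf M N) h
    = measure_pmf.expectation N (\<lambda>y. measure_pmf.expectation M (\<lambda>x. h (x, y)))"
proof -
  have "measure_pmf.expectation (pair_pmf M N) h
      = (\<Sum>z\<in>set_pmf M \<times> set_pmf N. h z * pmf (pair_pmf M N) z)"
    using assms by (intro integral_measure_pmf_real) auto
  also have "\<dots> = (\<Sum>y\<in>set_pmf N. \<Sum>x\<in>set_pmf M. h (x, y) * (pmf M x * pmf N y))"
    by (subst sum.swap, subst sum.cartesian_product) (auto intro!: sum.cong simp: pmf_pair)
  also have "\<dots> = (\<Sum>y\<in>set_pmf N. (\<Sum>x\<in>set_pmf M. h (x, y) * pmf M x) * pmf N y)"
    by (simp add: sum_distrib_right sum_distrib_left mult_ac)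
  also have "\<dots> = (\<Sum>y\<in>set_pmf N. measure_pmf.expectation M (\<lambda>x. h (x, y)) * pmf N y)"
    using assms by (intro sum.cong refl arg_cong2[where f="(*)"])
      (auto intro!: integral_measure_pmf_real[symmetric])
  also have "\<dots> = measure_pmf.expectation N (\<lambda>y. measure_pmf.expectation M (\<lambda>x. h (x, y)))"
    using assms by (intro integral_measure_pmf_real[symmetric]) auto
  finally show ?thesis .
qed

lemma expectation_mono_finite:
  fixes f g :: "'a \<Rightarrow> real"
  assumes "finite (set_pmf M)" "\<And>x. x \<in> set_pmf M \<Longrightarrow> f x \<le> g x"
  shows "measure_pmf.expectation M f \<le> measure_pmf.expectation M g"
  using assms by (intro integral_mono_AE integrable_measure_pmf_finite AE_pmfI) auto

text \<open>Only the oscillation of \<open>f\<close> matters: its values on the support lie in an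
  interval of length 1 that starts at their minimum. The sign is the one for lower tails, so
  Hoeffding's lemma is applied to \<open>- f\<close>.\<close>

lemma hoeffding_lemma_pmf:
  fixes f :: "'a \<Rightarrow> real"
  assumes fin: "finite (set_pmf M)" and l: "l > 0"
    and range: "\<And>x y. x \<in> set_pmf M \<Longrightarrow> y \<in> set_pmf M \<Longrightarrow> f x - f y \<le> 1"
  shows "measure_pmf.expectation M (\<lambda>x. exp (l * (measure_pmf.expectation M f - f x))) \<le> exp (l\<^sup>2 / 8)"
proof -
  define a where "a = Min (f ` set_pmf M)"
  have mem: "f x \<in> {a..a+1}" if "x \<in> set_pmf M" for x
  proof -
    have "a \<in> f ` set_pmf M"
      unfolding a_def by (rule Min_in) (use fin set_pmf_not_empty in auto)
    then show ?thesis
      using range[OF that] fin that by (auto simp: a_def field_simps)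
  qed
  interpret interval_bounded_random_variable "measure_pmf M" "\<lambda>x. - f x" "-a - 1" "- a"
    by unfold_locales (use mem in \<open>auto intro!: AE_pmfI simp: algebra_simps\<close>)
  have "ennreal (measure_pmf.expectation M (\<lambda>x. exp (l * (measure_pmf.expectation M f - f x))))
     = (\<integral>\<^sup>+x. exp (l * (measure_pmf.expectation M f - f x)) \<partial>measure_pmf M)"
    by (intro nn_integral_eq_integral[symmetric] integrable_measure_pmf_finite fin) auto
  also have "\<dots> \<le> ennreal (exp (l\<^sup>2 / 8))"
    using Hoeffdings_lemma_nn_integral[OF l] by (simp add: algebra_simps)
  finally show ?thesis by (simp add: ennreal_le_iff)
qed

lemma finite_set_Pi_pmf:
  assumes "finite I" "\<And>i. i \<in> I \<Longrightarrow> finite (set_pmf (P i))"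
  shows "finite (set_pmf (Pi_pmf I d P))"
  using assms by (auto simp: set_Pi_pmf intro!: finite_PiE_dflt)

text \<open>McDiarmid's martingale argument as an induction on the blocks: averaging over one block
  leaves a function \<open>G\<close> of the other blocks that still changes by at most 1 with each
  of them, and Hoeffding's lemma treats the averaged block. Blocks replace single coordinates
  because a block will be the set of all pairs at one vertex.\<close>

lemma mcdiarmid_exp_Pi_pmf:
  fixes F :: "('e \<Rightarrow> 'v) \<Rightarrow> real"
  assumes "finite I" "\<And>i. i \<in> I \<Longrightarrow> finite (S i)" "disjoint_family_on S I"
    and "\<And>e. finite (set_pmf (P e))" and l: "l > 0"
    and "\<And>i f g. i \<in> I \<Longrightarrow> (\<And>e. e \<notin> S i \<Longrightarrow> f e = g e) \<Longrightarrow> F f - F g \<le> 1"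
  shows "measure_pmf.expectation (Pi_pmf (\<Union>i\<in>I. S i) d P)
           (\<lambda>f. exp (l * (measure_pmf.expectation (Pi_pmf (\<Union>i\<in>I. S i) d P) F - F f)))
         \<le> exp (l\<^sup>2 / 8 * card I)"
  using assms(1-3,6)
proof (induction I arbitrary: F rule: finite_induct)
  case empty
  then show ?case by simp
next
  case (insert i I F)
  define U where "U = (\<Union>i\<in>I. S i)"
  define M where "M = Pi_pmf (S i) d P"
  define N where "N = Pi_pmf U d P"
  define comb where "comb = (\<lambda>(f,g) x. if x \<in> S i then f x else (g x :: 'v))"
  have finU: "finite U" using insert by (auto simp: U_def)
  have finS: "finite (S i)" using insert by auto
  have finM: "finite (set_pmf M)" unfolding M_def by (intro finite_set_Pi_pmf finS assms(4))
  have finN: "finite (set_pmf N)" unfolding N_def by (intro finite_set_Pi_pmf finU assms(4))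
  have disj: "S i \<inter> U = {}"
    using insert.prems(2) insert.hyps unfolding U_def disjoint_family_on_def by fastforce
  have eq: "Pi_pmf (\<Union>i\<in>insert i I. S i) d P = map_pmf comb (pair_pmf M N)"
    using Pi_pmf_union[OF finS finU disj, of d P] by (simp add: U_def M_def N_def comb_def)
  define G where "G = (\<lambda>g. measure_pmf.expectation M (\<lambda>f. F (comb (f, g))))"
  have EF: "measure_pmf.expectation (map_pmf comb (pair_pmf M N)) F = measure_pmf.expectation N G"
    by (simp add: expectation_pair_pmf_finite finM finN G_def)
  have IH: "measure_pmf.expectation N (\<lambda>f. exp (l * (measure_pmf.expectation N G - G f)))
         \<le> exp (l\<^sup>2 / 8 * card I)"
    unfolding N_def U_def
  proof (rule insert.IH)
    show "finite (S j)" if "j \<in> I" for j using insert that by auto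
    show "disjoint_family_on S I" using insert.prems(2) by (auto simp: disjoint_family_on_def)
    fix j f g assume j: "j \<in> I" and fg: "\<And>e. e \<notin> S j \<Longrightarrow> f e = (g e :: 'v)"
    have "G f - G g = measure_pmf.expectation M (\<lambda>x. F (comb (x, f)) - F (comb (x, g)))"
      unfolding G_def by (intro Bochner_Integration.integral_diff[symmetric] integrable_measure_pmf_finite finM)
    also have "\<dots> \<le> measure_pmf.expectation M (\<lambda>x. 1)"
      by (intro expectation_mono_finite finM insert.prems(3)[of j]) (use j fg in \<open>auto simp: comb_def\<close>)
    finally show "G f - G g \<le> 1" by simp
  qed
  have inner: "measure_pmf.expectation M (\<lambda>f. exp (l * (G g - F (comb (f, g))))) \<le> exp (l\<^sup>2 / 8)" for g
    unfolding G_def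
    by (rule hoeffding_lemma_pmf[OF finM l], rule insert.prems(3)[of i]) (auto simp: comb_def)
  have "measure_pmf.expectation (map_pmf comb (pair_pmf M N)) (\<lambda>f. exp (l * (measure_pmf.expectation N G - F f)))
     = measure_pmf.expectation N (\<lambda>g. measure_pmf.expectation M (\<lambda>f. exp (l * (measure_pmf.expectation N G - F (comb (f, g))))))"
    by (simp add: expectation_pair_pmf_finite finM finN)
  \<comment> \<open>The deviation splits into \<open>E G - G g\<close>, constant in
    \<open>f\<close>, and \<open>G g - F\<close>, whose exponential moment is bounded uniformly in
    \<open>g\<close> by \<open>inner\<close>.\<close>
  also have "\<dots> = measure_pmf.expectation N (\<lambda>g. exp (l * (measure_pmf.expectation N G - G g)) *
        measure_pmf.expectation M (\<lambda>f. exp (l * (G g - F (comb (f, g))))))"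
    by (subst integral_mult_right_zero[symmetric], subst mult_exp_exp) (simp add: algebra_simps)
  also have "\<dots> \<le> measure_pmf.expectation N (\<lambda>g. exp (l * (measure_pmf.expectation N G - G g)) * exp (l\<^sup>2 / 8))"
    by (intro expectation_mono_finite finN mult_left_mono inner) auto
  also have "\<dots> = measure_pmf.expectation N (\<lambda>g. exp (l * (measure_pmf.expectation N G - G g))) * exp (l\<^sup>2 / 8)"
    by simp
  also have "\<dots> \<le> exp (l\<^sup>2 / 8 * card I) * exp (l\<^sup>2 / 8)"
    by (intro mult_right_mono IH) auto
  also have "\<dots> = exp (l\<^sup>2 / 8 * card (insert i I))"
    using insert by (simp add: exp_add[symmetric] algebra_simps)
  finally show ?case unfolding eq EF .
qed

lemma mcdiarmid_lower_tail_Pi_pmf: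
  fixes F :: "('e \<Rightarrow> 'v) \<Rightarrow> real" and c :: real
  assumes "finite I" "\<And>i. i \<in> I \<Longrightarrow> finite (S i)" "disjoint_family_on S I"
    and fin: "\<And>e. finite (set_pmf (P e))"
    and "\<And>i f g. i \<in> I \<Longrightarrow> (\<And>e. e \<notin> S i \<Longrightarrow> f e = g e) \<Longrightarrow> F f - F g \<le> 1"
    and c: "c > 0" "measure_pmf.expectation (Pi_pmf (\<Union>i\<in>I. S i) d P) F \<ge> c * card I"
  shows "measure_pmf.prob (Pi_pmf (\<Union>i\<in>I. S i) d P) {f. F f \<le> 0} \<le> exp (- 2 * c\<^sup>2 * card I)"
proof -
  define M where "M = Pi_pmf (\<Union>i\<in>I. S i) d P"
  define E where "E = measure_pmf.expectation M F"
  have finM: "finite (set_pmf M)" unfolding M_def by (intro finite_set_Pi_pmf finite_UN_I assms)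
  have "measure_pmf.prob M {f. F f \<le> 0} = measure_pmf.expectation M (indicator {f. F f \<le> 0})"
    by simp
  \<comment> \<open>Chernoff's bound with \<open>l = 4 * c\<close>, the minimiser of
    \<open>l^2 / 8 - l * c\<close>; the minimum is \<open>- 2 * c^2\<close>.\<close>
  also have "\<dots> \<le> measure_pmf.expectation M (\<lambda>f. exp (- 4 * c * E) * exp (4 * c * (E - F f)))"
    using c by (intro expectation_mono_finite finM)
      (auto simp: indicator_def exp_add[symmetric] algebra_simps mult_le_0_iff)
  also have "\<dots> = exp (- 4 * c * E) * measure_pmf.expectation M (\<lambda>f. exp (4 * c * (E - F f)))"
    by simp
  also have "\<dots> \<le> exp (- 4 * c * E) * exp ((4 * c)\<^sup>2 / 8 * card I)"
    unfolding E_def M_def using c assms by (intro mult_left_mono mcdiarmid_exp_Pi_pmf) auto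
  also have "\<dots> = exp (2 * c\<^sup>2 * card I - 4 * c * E)"
    by (simp add: exp_add[symmetric] power2_eq_square)
  also have "\<dots> \<le> exp (- 2 * c\<^sup>2 * card I)"
  proof -
    have "c * (c * card I) \<le> c * E"
      using c by (intro mult_left_mono) (auto simp: E_def M_def)
    then show ?thesis by (simp add: power2_eq_square)
  qed
  finally show ?thesis by (simp add: M_def)
qed

section \<open>Exposing a random graph in independent rounds\<close>

lemma bernoulli_or:
  assumes "0 \<le> q" "q \<le> 1" "0 \<le> r" "r \<le> 1"
  shows "map_pmf (\<lambda>(x, y). x \<or> y) (pair_pmf (bernoulli_pmf q) (bernoulli_pmf r))
    = bernoulli_pmf (q + r - q * r)"
proof (rule pmf_eqI)
  fix b :: bool
  have le: "q + r - q * r \<le> 1"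
  proof -
    have "0 \<le> (1 - q) * (1 - r)" using assms by simp
    then show ?thesis by (simp add: algebra_simps)
  qed
  have ge: "q + r - q * r \<ge> 0"
  proof -
    have "q * r \<le> q" using assms by (simp add: mult_left_le)
    then show ?thesis using assms by simp
  qed
  have "pmf (map_pmf (\<lambda>(x, y). x \<or> y) (pair_pmf (bernoulli_pmf q) (bernoulli_pmf r))) False
    = measure_pmf.prob (pair_pmf (bernoulli_pmf q) (bernoulli_pmf r)) {(False, False)}"
    by (subst pmf_map) (auto intro!: arg_cong[where f = "measure_pmf.prob _"])
  also have "\<dots> = (1 - q) * (1 - r)"
    using assms by (simp add: measure_pmf_single pmf_pair)
  finally have F: "pmf (map_pmf (\<lambda>(x, y). x \<or> y) (pair_pmf (bernoulli_pmf q) (bernoulli_pmf r))) False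
     = pmf (bernoulli_pmf (q + r - q * r)) False"
    using le ge by (simp add: algebra_simps)
  show "pmf (map_pmf (\<lambda>(x, y). x \<or> y) (pair_pmf (bernoulli_pmf q) (bernoulli_pmf r))) b
     = pmf (bernoulli_pmf (q + r - q * r)) b"
    using F by (cases b) (auto simp: pmf_False_conv_True)
qed

lemma Pi_pmf_pair:
  assumes "finite S"
  shows "map_pmf (\<lambda>(f, g) x. (f x, g x)) (pair_pmf (Pi_pmf S d P) (Pi_pmf S d' Q))
    = Pi_pmf S (d, d') (\<lambda>x. pair_pmf (P x) (Q x))"
proof (rule pmf_eqI)
  fix k :: "'a \<Rightarrow> 'b \<times> 'c"
  have pair: "pmf (pair_pmf (P x) (Q x)) z = pmf (P x) (fst z) * pmf (Q x) (snd z)" for x z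
    by (cases z) (simp add: pmf_pair)
  have "pmf (map_pmf (\<lambda>(f, g) x. (f x, g x)) (pair_pmf (Pi_pmf S d P) (Pi_pmf S d' Q))) k
    = measure_pmf.prob (pair_pmf (Pi_pmf S d P) (Pi_pmf S d' Q)) {(fst \<circ> k, snd \<circ> k)}"
    by (subst pmf_map) (auto intro!: arg_cong[where f = "measure_pmf.prob _"] simp: fun_eq_iff)
  also have "\<dots> = pmf (Pi_pmf S (d, d') (\<lambda>x. pair_pmf (P x) (Q x))) k"
    using assms pair by (auto simp: measure_pmf_single pmf_pair pmf_Pi prod.distrib prod_eq_iff)
  finally show "pmf (map_pmf (\<lambda>(f, g) x. (f x, g x)) (pair_pmf (Pi_pmf S d P) (Pi_pmf S d' Q))) k
    = pmf (Pi_pmf S (d, d') (\<lambda>x. pair_pmf (P x) (Q x))) k" .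
qed

lemma Pi_bernoulli_or:
  assumes "finite S" "0 \<le> q" "q \<le> 1" "0 \<le> r" "r \<le> 1"
  shows "Pi_pmf S False (\<lambda>_. bernoulli_pmf (q + r - q * r))
    = map_pmf (\<lambda>(f, g) x. f x \<or> g x)
        (pair_pmf (Pi_pmf S False (\<lambda>_. bernoulli_pmf q)) (Pi_pmf S False (\<lambda>_. bernoulli_pmf r)))"
  unfolding bernoulli_or[OF assms(2-), symmetric]
  by (subst Pi_pmf_map[where dflt = "(False, False)"])
     (auto simp: assms Pi_pmf_pair[symmetric] pmf.map_comp o_def case_prod_beta')

text \<open>A graph of density \<open>p\<close> is the union of independent graphs of density
  \<open>q\<close> and of some density at least \<open>p - q\<close>. If the union has a decreasing
  property, both parts have it.\<close>

lemma prob_decreasing_mult: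
  assumes "finite S" "0 \<le> q" "q \<le> p" "p \<le> 1" "0 \<le> r" "r \<le> p - q"
    and dec: "\<And>f g. f \<in> D \<Longrightarrow> (\<And>x. g x \<Longrightarrow> f x) \<Longrightarrow> g \<in> D"
  shows "measure_pmf.prob (Pi_pmf S False (\<lambda>_. bernoulli_pmf p)) D
    \<le> measure_pmf.prob (Pi_pmf S False (\<lambda>_. bernoulli_pmf q)) D *
      measure_pmf.prob (Pi_pmf S False (\<lambda>_. bernoulli_pmf r)) D"
proof -
  let ?P = "\<lambda>p. Pi_pmf S False (\<lambda>_. bernoulli_pmf p)"
  have step: "measure_pmf.prob (?P (q + r - q * r)) D
      \<le> measure_pmf.prob (?P q) D * measure_pmf.prob (?P r) D"
    if "0 \<le> q" "q \<le> 1" "0 \<le> r" "r \<le> 1" for q r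
  proof -
    let ?S = "\<lambda>p. set_pmf (?P p)"
    have fin: "finite (?S p)" for p
      using assms(1) by (intro finite_set_Pi_pmf) (auto intro: finite_subset[OF subset_UNIV])
    have "measure_pmf.prob (?P (q + r - q * r)) D
      = measure_pmf.prob (pair_pmf (?P q) (?P r)) ((\<lambda>(f, g) x. f x \<or> g x) -` D)"
      using that by (simp add: Pi_bernoulli_or assms(1))
    \<comment> \<open>Intersecting with the supports makes the two factors countable, as the product
      rule requires.\<close>
    also have "\<dots> \<le> measure_pmf.prob (pair_pmf (?P q) (?P r)) ((D \<inter> ?S q) \<times> (D \<inter> ?S r))"
    proof (rule measure_pmf.finite_measure_mono_AE)
      show "AE x in measure_pmf (pair_pmf (?P q) (?P r)).
        x \<in> (\<lambda>(f, g) x. f x \<or> g x) -` D \<longrightarrow> x \<in> (D \<inter> ?S q) \<times> (D \<inter> ?S r)"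
        by (intro AE_pmfI) (auto intro: dec)
    qed simp
    also have "\<dots> = measure_pmf.prob (?P q) (D \<inter> ?S q) * measure_pmf.prob (?P r) (D \<inter> ?S r)"
      using fin by (intro measure_pmf_prob_product) (auto intro!: countable_finite)
    finally show ?thesis by (simp add: measure_Int_set_pmf)
  qed
  show ?thesis
  proof (cases "q = 1")
    case True
    with assms have "r = 0" "p = 1" by auto
    then show ?thesis using step[of 1 0] True by simp
  next
    case False
    then have q1: "q < 1" using assms by simp
    \<comment> \<open>The exact second density, the solution of \<open>q + r' - q * r' = p\<close>.
      It is at least \<open>p - q\<close>, hence at least \<open>r\<close>.\<close>
    define r' where "r' = (p - q) / (1 - q)"
    have r': "0 \<le> r'" "r' \<le> 1" "r \<le> r'"
    proof -
      show "0 \<le> r'" "r' \<le> 1" using assms q1 by (auto simp: r'_def)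
      have "r * (1 - q) \<le> r" using assms q1 by (simp add: mult_left_le)
      then show "r \<le> r'" using assms q1 by (simp add: r'_def pos_le_divide_eq)
    qed
    have "measure_pmf.prob (?P p) D \<le> measure_pmf.prob (?P q) D * measure_pmf.prob (?P r') D"
    proof -
      have "q + r' - q * r' = q + r' * (1 - q)" by (simp add: algebra_simps)
      also have "\<dots> = p" using q1 by (simp add: r'_def)
      finally show ?thesis using step[of q r'] assms r' q1 by simp
    qed
    \<comment> \<open>Monotonicity in the density is the same splitting with the second factor
      bounded by 1.\<close>
    also have "measure_pmf.prob (?P r') D \<le> measure_pmf.prob (?P r) D"
    proof (cases "r = 1")
      case True
      then show ?thesis using r' by simp
    next
      case False
      then have r1: "r < 1" using r' by simp
      define s where "s = (r' - r) / (1 - r)"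
      have s: "0 \<le> s" "s \<le> 1" using r' r1 by (auto simp: s_def)
      have "r + s - r * s = r + s * (1 - r)" by (simp add: algebra_simps)
      also have "\<dots> = r'" using r1 by (simp add: s_def)
      finally have "measure_pmf.prob (?P r') D \<le> measure_pmf.prob (?P r) D * measure_pmf.prob (?P s) D"
        using step[of r s] s r1 assms by simp
      also have "\<dots> \<le> measure_pmf.prob (?P r) D" by (simp add: mult_left_le)
      finally show ?thesis .
    qed
    finally show ?thesis by (simp add: mult_left_mono)
  qed
qed

text \<open>A constant factor \<open>K\<close> in the density multiplies the exponent of an
  exponentially small failure probability by \<open>K\<close>. This is how the small rate from
  McDiarmid's bound comes to beat a union bound over all pairs of sets.\<close>

lemma prob_decreasing_power:
  assumes "finite S" "0 \<le> q" "real K * q \<le> p" "p \<le> 1"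
    and dec: "\<And>f g. f \<in> D \<Longrightarrow> (\<And>x. g x \<Longrightarrow> f x) \<Longrightarrow> g \<in> D"
  shows "measure_pmf.prob (Pi_pmf S False (\<lambda>_. bernoulli_pmf p)) D
    \<le> measure_pmf.prob (Pi_pmf S False (\<lambda>_. bernoulli_pmf q)) D ^ K"
  using assms(3,4)
proof (induction K arbitrary: p)
  case (Suc K)
  have a: "0 \<le> real K * q" using assms by simp
  have b: "q + real K * q \<le> p" using Suc.prems by (simp add: algebra_simps)
  have nn: "0 \<le> real K * q" "q \<le> p" "real K * q \<le> p - q" using a b by auto
  have "measure_pmf.prob (Pi_pmf S False (\<lambda>_. bernoulli_pmf p)) D
    \<le> measure_pmf.prob (Pi_pmf S False (\<lambda>_. bernoulli_pmf q)) D *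
      measure_pmf.prob (Pi_pmf S False (\<lambda>_. bernoulli_pmf (K * q))) D"
    using Suc.prems nn assms(1,2)
    by (intro prob_decreasing_mult) (auto intro: dec)
  also have "\<dots> \<le> measure_pmf.prob (Pi_pmf S False (\<lambda>_. bernoulli_pmf q)) D *
      measure_pmf.prob (Pi_pmf S False (\<lambda>_. bernoulli_pmf q)) D ^ K"
    using Suc.prems nn assms(1,2) by (intro mult_left_mono Suc.IH) auto
  finally show ?case by simp
qed simp

section \<open>Bicliques in small random bipartite graphs\<close>

lemma prob_all_bernoulli:
  assumes "finite S" "T \<subseteq> S" "0 \<le> p" "p \<le> 1"
  shows "measure_pmf.prob (Pi_pmf S False (\<lambda>_. bernoulli_pmf p)) {f. \<forall>e\<in>T. f e} = p ^ card T"
proof -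
  have "{f. \<forall>e\<in>T. f e} = Pi S (\<lambda>e. if e \<in> T then {True} else UNIV)"
    using assms(2) by (auto simp: Pi_def split: if_splits)
  then have "measure_pmf.prob (Pi_pmf S False (\<lambda>_. bernoulli_pmf p)) {f. \<forall>e\<in>T. f e}
    = (\<Prod>e\<in>S. measure_pmf.prob (bernoulli_pmf p) (if e \<in> T then {True} else UNIV))"
    using assms(1) by (simp only: measure_Pi_pmf_Pi)
  also have "\<dots> = (\<Prod>e\<in>S. if e \<in> T then p else 1)"
    using assms by (intro prod.cong) (auto simp: measure_pmf_single)
  also have "\<dots> = p ^ card T"
    using assms by (simp add: prod.If_cases Int_absorb1)
  finally show ?thesis .
qed

lemma choose_le_power: "n choose k \<le> n ^ k"
  by (rule order_trans[OF _ binomial_fact_pow]) simp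

section \<open>Packings of bicliques and the deletion method\<close>

definition bicliques :: "nat \<Rightarrow> 'a set \<Rightarrow> 'b set \<Rightarrow> ('a \<times> 'b \<Rightarrow> bool) \<Rightarrow> ('a set \<times> 'b set) set" where
  "bicliques h X Y f =
     {(P, Q). P \<subseteq> X \<and> card P = h \<and> Q \<subseteq> Y \<and> card Q = h \<and> (\<forall>e\<in>P \<times> Q. f e)}"

lemma finite_bicliques: "finite X \<Longrightarrow> finite Y \<Longrightarrow> finite (bicliques h X Y f)"
  by (rule finite_subset[of _ "Pow X \<times> Pow Y"]) (auto simp: bicliques_def)

text \<open>Only the first components have to be disjoint: this already makes the packing number change
  by at most one when the edges at one vertex of \<open>X\<close> change.\<close>

definition packing :: "nat \<Rightarrow> 'a set \<Rightarrow> 'b set \<Rightarrow> ('a \<times> 'b \<Rightarrow> bool) \<Rightarrow> ('a set \<times> 'b set) set \<Rightarrow> bool" where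
  "packing h X Y f \<F> \<longleftrightarrow> \<F> \<subseteq> bicliques h X Y f \<and>
     (\<forall>K\<in>\<F>. \<forall>L\<in>\<F>. K \<noteq> L \<longrightarrow> fst K \<inter> fst L = {})"

definition packing_number :: "nat \<Rightarrow> 'a set \<Rightarrow> 'b set \<Rightarrow> ('a \<times> 'b \<Rightarrow> bool) \<Rightarrow> nat" where
  "packing_number h X Y f = Max (card ` Collect (packing h X Y f))"

lemma finite_packings: "finite X \<Longrightarrow> finite Y \<Longrightarrow> finite (Collect (packing h X Y f))"
  by (rule finite_subset[of _ "Pow (bicliques h X Y f)"]) (auto simp: packing_def finite_bicliques)

lemma packing_number_ge:
  "finite X \<Longrightarrow> finite Y \<Longrightarrow> packing h X Y f \<F> \<Longrightarrow> card \<F> \<le> packing_number h X Y f"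
  unfolding packing_number_def by (intro Max_ge finite_imageI finite_packings) auto

lemma packing_number_witness:
  assumes "finite X" "finite Y"
  obtains \<F> where "packing h X Y f \<F>" "card \<F> = packing_number h X Y f"
proof -
  have "packing h X Y f {}" by (simp add: packing_def)
  then have "Max (card ` Collect (packing h X Y f)) \<in> card ` Collect (packing h X Y f)"
    by (intro Max_in finite_imageI finite_packings assms) auto
  then show ?thesis using that by (auto simp: packing_number_def)
qed

text \<open>At most one member of a packing has \<open>a\<close> on its left side. Without it, no
  member contains a pair at \<open>a\<close>, so the rest is still a packing for
  \<open>g\<close>.\<close>

lemma packing_number_lipschitz:
  assumes fin: "finite X" "finite Y" and fg: "\<And>e. e \<notin> {a} \<times> Y \<Longrightarrow> f e = g e"
  shows "packing_number h X Y f \<le> packing_number h X Y g + 1"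
proof -
  obtain \<F> where \<F>: "packing h X Y f \<F>" "card \<F> = packing_number h X Y f"
    using packing_number_witness[OF fin] .
  have fin\<F>: "finite \<F>"
    using \<F>(1) finite_bicliques[OF fin] by (auto simp: packing_def intro: finite_subset)
  define \<G> where "\<G> = {K\<in>\<F>. a \<in> fst K}"
  have "packing h X Y g (\<F> - \<G>)"
    unfolding packing_def
  proof (intro conjI subsetI)
    fix K assume K: "K \<in> \<F> - \<G>"
    then have "K \<in> bicliques h X Y f" "a \<notin> fst K" using \<F>(1) by (auto simp: packing_def \<G>_def)
    moreover have "f e = g e" if "e \<in> fst K \<times> snd K" for e
      using that \<open>a \<notin> fst K\<close> by (intro fg) auto
    ultimately show "K \<in> bicliques h X Y g" by (auto simp: bicliques_def)
  next
    show "\<forall>K\<in>\<F> - \<G>. \<forall>L\<in>\<F> - \<G>. K \<noteq> L \<longrightarrow> fst K \<inter> fst L = {}"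
      using \<F>(1) by (simp add: packing_def)
  qed
  then have "card (\<F> - \<G>) \<le> packing_number h X Y g" by (rule packing_number_ge[OF fin])
  moreover have "card \<G> \<le> 1"
  proof -
    have "K = L" if "K \<in> \<G>" "L \<in> \<G>" for K L
      using \<F>(1) that unfolding packing_def \<G>_def by blast
    then show ?thesis using fin\<F> card_le_Suc0_iff_eq[of \<G>] by (auto simp: \<G>_def)
  qed
  moreover have "card \<F> = card (\<F> - \<G>) + card \<G>"
    using fin\<F> card_mono[OF fin\<F>, of \<G>] by (simp add: \<G>_def card_Diff_subset)
  ultimately show ?thesis using \<F>(2) by simp
qed

definition conflicts :: "nat \<Rightarrow> 'a set \<Rightarrow> 'b set \<Rightarrow> ('a \<times> 'b \<Rightarrow> bool) \<Rightarrow>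
    (('a set \<times> 'b set) \<times> ('a set \<times> 'b set)) set" where
  "conflicts h X Y f = {(K, L). K \<in> bicliques h X Y f \<and> L \<in> bicliques h X Y f \<and>
     K \<noteq> L \<and> fst K \<inter> fst L \<noteq> {}}"

text \<open>Deletion: discard every biclique that occurs as the first entry of a conflict. Conflicts
  are ordered pairs, so both bicliques of a conflicting pair are discarded, and each conflict pays
  for one of them.\<close>

lemma packing_number_lower:
  assumes fin: "finite X" "finite Y"
  shows "card (bicliques h X Y f) \<le> packing_number h X Y f + card (conflicts h X Y f)"
proof -
  let ?B = "bicliques h X Y f" and ?C = "conflicts h X Y f"
  have finC: "finite ?C"
    by (rule finite_subset[of _ "?B \<times> ?B"]) (auto simp: conflicts_def finite_bicliques fin)
  have "packing h X Y f (?B - fst ` ?C)"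
    unfolding packing_def
  proof (intro conjI ballI impI)
    fix K L assume KL: "K \<in> ?B - fst ` ?C" "L \<in> ?B - fst ` ?C" "K \<noteq> L"
    show "fst K \<inter> fst L = {}"
    proof (rule ccontr)
      assume "fst K \<inter> fst L \<noteq> {}"
      then have "(K, L) \<in> ?C" using KL by (simp add: conflicts_def)
      then have "K \<in> fst ` ?C" by force
      then show False using KL by simp
    qed
  qed auto
  then have "card (?B - fst ` ?C) \<le> packing_number h X Y f" by (rule packing_number_ge[OF fin])
  moreover have "card ?B \<le> card (?B - fst ` ?C) + card (fst ` ?C)"
  proof -
    have "card ?B \<le> card ((?B - fst ` ?C) \<union> fst ` ?C)"
      using finC by (intro card_mono) (auto simp: finite_bicliques fin)
    also have "\<dots> \<le> card (?B - fst ` ?C) + card (fst ` ?C)" by (rule card_Un_le)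
    finally show ?thesis .
  qed
  moreover have "card (fst ` ?C) \<le> card ?C" by (rule card_image_le[OF finC])
  ultimately show ?thesis by linarith
qed

text \<open>The left-hand side is affine in \<open>j\<close>, and it is nonpositive at \<open>j = 0\<close> and at \<open>j = h\<close>.\<close>

lemma balancedness:
  assumes "1 \<le> i" "i \<le> h" "j \<le> h"
  shows "1 - real i - real j + (2 * real h - 1) * real i * real j / (real h)\<^sup>2 \<le> 0"
proof -
  have h: "real h > 0" using assms by simp
  have "(real h)\<^sup>2 * (1 - real i - real j) + (2 * real h - 1) * real i * real j
     = (real h - real j) * (real h * (1 - real i)) + real j * ((real h - 1) * (real i - real h))"
    by (simp add: algebra_simps power2_eq_square)
  also have "\<dots> \<le> 0"
    using assms by (intro add_nonpos_nonpos mult_nonneg_nonpos) auto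
  finally show ?thesis using h by (simp add: field_simps)
qed

section \<open>Expected numbers of bicliques and conflicts at the critical density\<close>

context
  fixes h m :: nat and c q :: real
  assumes h: "h \<ge> 1" and m: "m \<ge> 1" and c: "0 < c" "c \<le> 1"
    and q: "q = c * real m powr (- ((2 * real h - 1) / (real h)\<^sup>2))"
begin

lemma density_bounds: "0 < q" "q \<le> 1"
proof -
  show "0 < q" using m c q by simp
  have "real m powr (- ((2 * real h - 1) / (real h)\<^sup>2)) \<le> 1"
    using m h powr_mono[of "- ((2 * real h - 1) / (real h)\<^sup>2)" 0 "real m"] by simp
  then show "q \<le> 1" using c q by (simp add: mult_le_one)
qed

text \<open>At \<open>k = h^2\<close> the exponent of \<open>m\<close> is \<open>1 - 2h\<close>, so
  \<open>m^(2h) * q^(h^2)\<close> equals \<open>c^(h^2) * m\<close>, which is linear in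
  \<open>m\<close>.\<close>

lemma density_power: "q ^ k = c ^ k * real m powr (- ((2 * real h - 1) / (real h)\<^sup>2) * k)"
  using m by (simp add: q power_mult_distrib powr_power mult_ac)

text \<open>The first two factors bound the number of bicliques that meet a given one in a
  prescribed \<open>i\<close> by \<open>j\<close> part, the third is the probability of their new
  edges. The total exponent of \<open>m\<close> is the quantity shown to be nonpositive in
  \<open>balancedness\<close>. Since \<open>(i, j)\<close> is not \<open>(h, h)\<close> there is at
  least one new edge, and it leaves a factor \<open>c\<close>.\<close>

lemma overlap_weight:
  assumes "1 \<le> i" "i \<le> h" "j \<le> h" "(i, j) \<noteq> (h, h)"
  shows "real m ^ (h - i) * real m ^ (h - j) * q ^ (h\<^sup>2 - i * j) \<le> c"
proof -
  have lt: "i * j < h\<^sup>2"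
  proof -
    have "i * j \<le> h * h" using assms by (intro mult_mono) auto
    moreover have "i * j \<noteq> h * h"
    proof
      assume "i * j = h * h"
      moreover have "i * j \<le> i * h" "i * h \<le> h * h" "i * j \<le> h * j" "h * j \<le> h * h" using assms by auto
      ultimately have "i * h = h * h" "h * j = h * h" by auto
      then show False using assms h by auto
    qed
    ultimately show ?thesis by (simp add: power2_eq_square)
  qed
  define e where "e = real (h - i) + real (h - j) + (- ((2 * real h - 1) / (real h)\<^sup>2) * real (h\<^sup>2 - i * j))"
  have "e = 1 - real i - real j + (2 * real h - 1) * real i * real j / (real h)\<^sup>2"
    using assms lt h by (simp add: e_def of_nat_diff field_simps)
  then have "e \<le> 0" using balancedness[OF assms(1-3)] by simp
  have "real m ^ (h - i) * real m ^ (h - j) * q ^ (h\<^sup>2 - i * j) = c ^ (h\<^sup>2 - i * j) * real m powr e"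
    using m by (simp only: density_power e_def powr_add) (simp add: powr_realpow)
  also have "\<dots> \<le> c ^ (h\<^sup>2 - i * j) * 1"
    using m c \<open>e \<le> 0\<close> powr_mono[of e 0 "real m"] by (intro mult_left_mono) auto
  also have "\<dots> \<le> c" using lt c power_decreasing[of 1 "h\<^sup>2 - i * j" c] by simp
  finally show ?thesis .
qed

context
  fixes X :: "'a set" and Y :: "'b set"
  assumes X: "finite X" "card X = m" and Y: "finite Y" "card Y = m"
begin

abbreviation "rnd \<equiv> Pi_pmf (X \<times> Y) False (\<lambda>_. bernoulli_pmf q)"
abbreviation "hsub Z \<equiv> {P. P \<subseteq> Z \<and> card P = h}"

lemma finite_rnd: "finite (set_pmf rnd)"
  using X Y by (intro finite_set_Pi_pmf) (auto intro: finite_subset[OF subset_UNIV])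

lemma finite_hsub: "finite (hsub X)" "finite (hsub Y)"
  using X Y by auto

lemma expectation_card_Collect:
  assumes "finite \<K>"
  shows "measure_pmf.expectation rnd (\<lambda>f. real (card {K\<in>\<K>. \<forall>e\<in>T K. f e}))
    = (\<Sum>K\<in>\<K>. measure_pmf.prob rnd {f. \<forall>e\<in>T K. f e})"
proof -
  have "real (card {K\<in>\<K>. \<forall>e\<in>T K. f e}) = (\<Sum>K\<in>\<K>. indicator {f. \<forall>e\<in>T K. f e} f)" for f
    using assms by (simp add: indicator_def sum.If_cases Int_def)
  then show ?thesis
    by (simp add: Bochner_Integration.integral_sum[OF integrable_measure_pmf_finite[OF finite_rnd]])
qed

lemma expectation_bicliques:
  "measure_pmf.expectation rnd (\<lambda>f. real (card (bicliques h X Y f)))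
    = real (card (hsub X \<times> hsub Y)) * q ^ (h\<^sup>2)"
proof -
  have "bicliques h X Y f = {K\<in>hsub X \<times> hsub Y. \<forall>e\<in>fst K \<times> snd K. f e}" for f
    by (auto simp: bicliques_def)
  then have "measure_pmf.expectation rnd (\<lambda>f. real (card (bicliques h X Y f)))
     = (\<Sum>K\<in>hsub X \<times> hsub Y. measure_pmf.prob rnd {f. \<forall>e\<in>fst K \<times> snd K. f e})"
    using expectation_card_Collect[of "hsub X \<times> hsub Y" "\<lambda>K. fst K \<times> snd K"] finite_hsub by simp
  also have "\<dots> = (\<Sum>K\<in>hsub X \<times> hsub Y. q ^ (h\<^sup>2))"
    using X Y density_bounds
    by (intro sum.cong refl, subst prob_all_bernoulli) (auto simp: card_cartesian_product power2_eq_square)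
  finally show ?thesis by simp
qed

text \<open>Group the bicliques \<open>L\<close> by their trace on \<open>K\<close>. By
  \<open>overlap_weight\<close> each trace contributes at most \<open>c\<close> times the weight of
  \<open>K\<close> itself, and there are at most \<open>2^h * 2^h\<close> traces. The factor
  \<open>c\<close> can then be taken small enough to beat \<open>4^h\<close>.\<close>

lemma conflict_weight:
  assumes K: "K \<in> hsub X \<times> hsub Y"
  shows "(\<Sum>L\<in>{L \<in> hsub X \<times> hsub Y. K \<noteq> L \<and> fst K \<inter> fst L \<noteq> {}}.
      q ^ card (fst K \<times> snd K \<union> fst L \<times> snd L)) \<le> 4 ^ h * c * q ^ (h\<^sup>2)"
proof -
  obtain P Q where PQ: "K = (P, Q)" "P \<subseteq> X" "card P = h" "Q \<subseteq> Y" "card Q = h" using K by auto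
  have finPQ: "finite P" "finite Q" using PQ X Y finite_subset by auto
  define \<L> where "\<L> = {L \<in> hsub X \<times> hsub Y. K \<noteq> L \<and> fst K \<inter> fst L \<noteq> {}}"
  \<comment> \<open>\<open>J\<close> may be empty, since a conflict concerns only the left sides.
    The full trace is excluded because \<open>K\<close> and \<open>L\<close> are distinct and of
    equal size.\<close>
  define IJ where "IJ = {(I, J). I \<subseteq> P \<and> J \<subseteq> Q \<and> I \<noteq> {} \<and> (I, J) \<noteq> (P, Q)}"
  define tr where "tr = (\<lambda>L::'a set \<times> 'b set. (P \<inter> fst L, Q \<inter> snd L))"
  have fin\<L>: "finite \<L>" unfolding \<L>_def using finite_hsub by auto
  have finIJ: "finite IJ"
    by (rule finite_subset[of _ "Pow P \<times> Pow Q"]) (auto simp: IJ_def finPQ)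
  have tr: "tr ` \<L> \<subseteq> IJ"
  proof
    fix z assume "z \<in> tr ` \<L>"
    then obtain P' Q' where L: "(P', Q') \<in> \<L>" "z = (P \<inter> P', Q \<inter> Q')" by (auto simp: tr_def)
    have fin': "finite P'" "finite Q'" using L X Y finite_subset by (auto simp: \<L>_def)
    have "P = P' \<and> Q = Q'" if "P \<subseteq> P'" "Q \<subseteq> Q'"
      using card_subset_eq[OF fin'(1) that(1)] card_subset_eq[OF fin'(2) that(2)] L PQ
      by (simp add: \<L>_def)
    moreover have "\<not> (P = P' \<and> Q = Q')" using L PQ by (auto simp: \<L>_def)
    ultimately have "\<not> (P \<inter> P' = P \<and> Q \<inter> Q' = Q)" by blast
    then show "z \<in> IJ" using L PQ by (simp add: IJ_def \<L>_def)
  qed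
  have fibre: "(\<Sum>L\<in>{L\<in>\<L>. tr L = z}. q ^ card (fst K \<times> snd K \<union> fst L \<times> snd L)) \<le> c * q ^ (h\<^sup>2)"
    if z: "z \<in> IJ" for z
  proof -
    obtain I J where IJ: "z = (I, J)" "I \<subseteq> P" "J \<subseteq> Q" "I \<noteq> {}" "(I, J) \<noteq> (P, Q)"
      using z by (auto simp: IJ_def)
    define i j where "i = card I" "j = card J"
    have finIJ': "finite I" "finite J" using IJ finPQ finite_subset by auto
    have ij: "1 \<le> i" "i \<le> h" "j \<le> h" "(i, j) \<noteq> (h, h)"
      using IJ PQ finPQ finIJ' card_mono[of P I] card_mono[of Q J] card_subset_eq[of P I] card_subset_eq[of Q J]
      by (auto simp: i_j_def card_gt_0_iff Suc_le_eq)
    have ijle: "i * j \<le> h\<^sup>2" using ij by (auto simp: power2_eq_square intro: mult_mono)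
    have weight: "q ^ card (fst K \<times> snd K \<union> fst L \<times> snd L) = q ^ (h\<^sup>2) * q ^ (h\<^sup>2 - i * j)"
      if "L \<in> \<L>" "tr L = z" for L
    proof -
      have "fst L \<subseteq> X" "snd L \<subseteq> Y" "card (fst L) = h" "card (snd L) = h" using that by (auto simp: \<L>_def)
      then have L: "finite (fst L \<times> snd L)" "card (fst L \<times> snd L) = h\<^sup>2"
        using X Y by (auto simp: card_cartesian_product power2_eq_square intro: finite_subset)
      have "(fst K \<times> snd K) \<inter> (fst L \<times> snd L) = I \<times> J"
        using that IJ PQ by (auto simp: tr_def)
      then have "card (fst K \<times> snd K \<union> fst L \<times> snd L) + i * j = h\<^sup>2 + h\<^sup>2"
        using card_Un_Int[of "fst K \<times> snd K" "fst L \<times> snd L"] L PQ finPQ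
        by (simp add: card_cartesian_product power2_eq_square i_j_def)
      then have "card (fst K \<times> snd K \<union> fst L \<times> snd L) = h\<^sup>2 + (h\<^sup>2 - i * j)"
        using ijle by linarith
      then show ?thesis by (simp add: power_add)
    qed
    have cnt: "card {P'\<in>hsub X. P \<inter> P' = I} \<le> m ^ (h - i)"
    proof -
      \<comment> \<open>Once the trace \<open>I\<close> is fixed, \<open>P'\<close> is determined by
        its \<open>h - i\<close> further elements.\<close>
      have "card {P'\<in>hsub X. P \<inter> P' = I} \<le> card {R. R \<subseteq> X \<and> card R = h - i}"
      proof (rule card_inj_on_le[of "\<lambda>P'. P' - I"])
        show "inj_on (\<lambda>P'. P' - I) {P'\<in>hsub X. P \<inter> P' = I}" by (auto intro!: inj_onI)
        show "(\<lambda>P'. P' - I) ` {P'\<in>hsub X. P \<inter> P' = I} \<subseteq> {R. R \<subseteq> X \<and> card R = h - i}"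
          using finIJ' by (auto simp: i_j_def intro!: card_Diff_subset)
      qed (use X in auto)
      also have "\<dots> \<le> m ^ (h - i)" using X by (simp add: n_subsets choose_le_power)
      finally show ?thesis .
    qed
    have cnt': "card {Q'\<in>hsub Y. Q \<inter> Q' = J} \<le> m ^ (h - j)"
    proof -
      have "card {Q'\<in>hsub Y. Q \<inter> Q' = J} \<le> card {R. R \<subseteq> Y \<and> card R = h - j}"
      proof (rule card_inj_on_le[of "\<lambda>P'. P' - J"])
        show "inj_on (\<lambda>P'. P' - J) {Q'\<in>hsub Y. Q \<inter> Q' = J}" by (auto intro!: inj_onI)
        show "(\<lambda>P'. P' - J) ` {Q'\<in>hsub Y. Q \<inter> Q' = J} \<subseteq> {R. R \<subseteq> Y \<and> card R = h - j}"
          using finIJ' by (auto simp: i_j_def intro!: card_Diff_subset)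
      qed (use Y in auto)
      also have "\<dots> \<le> m ^ (h - j)" using Y by (simp add: n_subsets choose_le_power)
      finally show ?thesis .
    qed
    have "card {L\<in>\<L>. tr L = z} \<le> card ({P'\<in>hsub X. P \<inter> P' = I} \<times> {Q'\<in>hsub Y. Q \<inter> Q' = J})"
    proof (rule card_mono)
      show "finite ({P'\<in>hsub X. P \<inter> P' = I} \<times> {Q'\<in>hsub Y. Q \<inter> Q' = J})"
        using X Y by (intro finite_cartesian_product) auto
    qed (use IJ in \<open>auto simp: \<L>_def tr_def\<close>)
    also have "\<dots> \<le> m ^ (h - i) * m ^ (h - j)"
      unfolding card_cartesian_product by (rule mult_mono[OF cnt cnt']) simp_all
    finally have "real (card {L\<in>\<L>. tr L = z}) \<le> real (m ^ (h - i) * m ^ (h - j))"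
      by (rule of_nat_mono)
    then have "real (card {L\<in>\<L>. tr L = z}) \<le> real m ^ (h - i) * real m ^ (h - j)" by simp
    then have "real (card {L\<in>\<L>. tr L = z}) * (q ^ (h\<^sup>2) * q ^ (h\<^sup>2 - i * j))
       \<le> real m ^ (h - i) * real m ^ (h - j) * (q ^ (h\<^sup>2) * q ^ (h\<^sup>2 - i * j))"
      using density_bounds by (intro mult_right_mono) auto
    also have "\<dots> = (real m ^ (h - i) * real m ^ (h - j) * q ^ (h\<^sup>2 - i * j)) * q ^ (h\<^sup>2)" by simp
    also have "\<dots> \<le> c * q ^ (h\<^sup>2)"
      using density_bounds by (intro mult_right_mono overlap_weight ij) auto
    finally show ?thesis by (simp add: weight)
  qed
  have "(\<Sum>L\<in>\<L>. q ^ card (fst K \<times> snd K \<union> fst L \<times> snd L))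
     = (\<Sum>z\<in>IJ. \<Sum>L\<in>{L\<in>\<L>. tr L = z}. q ^ card (fst K \<times> snd K \<union> fst L \<times> snd L))"
    by (rule sum.group[OF fin\<L> finIJ tr, symmetric])
  also have "\<dots> \<le> (\<Sum>z\<in>IJ. c * q ^ (h\<^sup>2))" by (intro sum_mono fibre)
  also have "\<dots> = real (card IJ) * (c * q ^ (h\<^sup>2))" by simp
  also have "\<dots> \<le> 4 ^ h * (c * q ^ (h\<^sup>2))"
  proof (intro mult_right_mono)
    have "card IJ \<le> card (Pow P \<times> Pow Q)" by (intro card_mono) (auto simp: IJ_def finPQ)
    also have "\<dots> = 4 ^ h" using PQ finPQ by (simp add: card_cartesian_product card_Pow power_mult_distrib[symmetric])
    finally have "real (card IJ) \<le> real (4 ^ h)" by (rule of_nat_mono)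
    then show "real (card IJ) \<le> 4 ^ h" by simp
  qed (use c density_bounds in auto)
  finally show ?thesis by (simp add: \<L>_def mult_ac)
qed

lemma expectation_conflicts:
  "measure_pmf.expectation rnd (\<lambda>f. real (card (conflicts h X Y f)))
    \<le> real (card (hsub X \<times> hsub Y)) * (4 ^ h * c * q ^ (h\<^sup>2))"
proof -
  define \<K> where "\<K> = Sigma (hsub X \<times> hsub Y) (\<lambda>K. {L \<in> hsub X \<times> hsub Y. K \<noteq> L \<and> fst K \<inter> fst L \<noteq> {}})"
  define T where "T = (\<lambda>(K, L). fst K \<times> snd K \<union> fst L \<times> (snd L :: 'b set) :: ('a \<times> 'b) set)"
  have fin\<K>: "finite \<K>" unfolding \<K>_def using finite_hsub by auto
  have "conflicts h X Y f = {z\<in>\<K>. \<forall>e\<in>T z. f e}" for f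
    unfolding conflicts_def bicliques_def \<K>_def T_def by fastforce
  then have "measure_pmf.expectation rnd (\<lambda>f. real (card (conflicts h X Y f)))
     = (\<Sum>z\<in>\<K>. measure_pmf.prob rnd {f. \<forall>e\<in>T z. f e})"
    by (simp add: expectation_card_Collect[OF fin\<K>])
  also have "\<dots> = (\<Sum>z\<in>\<K>. q ^ card (T z))"
    using X Y density_bounds
    by (intro sum.cong refl prob_all_bernoulli) (auto simp: \<K>_def T_def)
  also have "\<dots> = (\<Sum>K\<in>hsub X \<times> hsub Y. \<Sum>L\<in>{L \<in> hsub X \<times> hsub Y. K \<noteq> L \<and> fst K \<inter> fst L \<noteq> {}}.
      q ^ card (fst K \<times> snd K \<union> fst L \<times> snd L))"
    unfolding \<K>_def T_def using finite_hsub by (subst sum.Sigma) (auto simp: case_prod_beta)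
  also have "\<dots> \<le> (\<Sum>K\<in>hsub X \<times> hsub Y. 4 ^ h * c * q ^ (h\<^sup>2))"
    by (intro sum_mono conflict_weight)
  finally show ?thesis by simp
qed

text \<open>The bound on \<open>c\<close> makes the expected number of conflicts at most half the
  expected number of bicliques, so deletion keeps half of them. The powers of \<open>h\<close> come
  from estimating \<open>m choose h\<close> below by \<open>(m / h)^h\<close> on both sides.\<close>

lemma expectation_packing_number:
  assumes "2 * 4 ^ h * c \<le> 1" "h \<le> m"
  shows "measure_pmf.expectation rnd (\<lambda>f. real (packing_number h X Y f))
    \<ge> c ^ (h\<^sup>2) / (2 * real h ^ (2 * h)) * real m"
proof -
  let ?N = "real (card (hsub X \<times> hsub Y))"
  have "?N * q ^ (h\<^sup>2) / 2 = ?N * q ^ (h\<^sup>2) - ?N * (1 / 2 * q ^ (h\<^sup>2))" by simp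
  also have "\<dots> \<le> ?N * q ^ (h\<^sup>2) - ?N * (4 ^ h * c * q ^ (h\<^sup>2))"
    using assms density_bounds by (intro diff_left_mono mult_left_mono mult_right_mono) auto
  also have "\<dots> \<le> measure_pmf.expectation rnd (\<lambda>f. real (card (bicliques h X Y f)))
      - measure_pmf.expectation rnd (\<lambda>f. real (card (conflicts h X Y f)))"
    using expectation_conflicts by (simp add: expectation_bicliques)
  also have "\<dots> = measure_pmf.expectation rnd
      (\<lambda>f. real (card (bicliques h X Y f)) - real (card (conflicts h X Y f)))"
    by (intro Bochner_Integration.integral_diff[symmetric] integrable_measure_pmf_finite finite_rnd)
  also have "\<dots> \<le> measure_pmf.expectation rnd (\<lambda>f. real (packing_number h X Y f))"
    using packing_number_lower[OF X(1) Y(1), of h]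
    by (intro expectation_mono_finite finite_rnd) (simp add: diff_le_eq del: of_nat_add flip: of_nat_add)
  finally have 1: "?N * q ^ (h\<^sup>2) / 2 \<le> measure_pmf.expectation rnd (\<lambda>f. real (packing_number h X Y f))" .
  have "(real m / real h) ^ h \<le> real (m choose h)"
    by (rule binomial_ge_n_over_k_pow_k[OF assms(2)])
  then have "(real m / real h) ^ h * (real m / real h) ^ h \<le> real (m choose h) * real (m choose h)"
    by (intro mult_mono) auto
  then have N: "(real m / real h) ^ (2 * h) \<le> ?N"
    using X Y by (simp add: card_cartesian_product n_subsets power_add[symmetric] mult_2)
  have "c ^ (h\<^sup>2) / (2 * real h ^ (2 * h)) * real m
     = (real m / real h) ^ (2 * h) * (c ^ (h\<^sup>2) * real m powr (1 - 2 * real h)) / 2"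
  proof -
    have "real m ^ (2 * h) * real m powr (1 - 2 * real h) = real m"
      using m by (simp add: powr_realpow[symmetric] powr_add[symmetric])
    then show ?thesis using h by (simp add: field_simps)
  qed
  also have "c ^ (h\<^sup>2) * real m powr (1 - 2 * real h) = q ^ (h\<^sup>2)"
    using h by (simp add: density_power)
  also have "(real m / real h) ^ (2 * h) * q ^ (h\<^sup>2) / 2 \<le> ?N * q ^ (h\<^sup>2) / 2"
    using density_bounds N by (intro divide_right_mono mult_right_mono) auto
  finally show ?thesis using 1 by simp
qed

text \<open>Without bicliques the packing number is 0, which lies below its expectation by a
  constant multiple of \<open>m\<close>. The blocks are the sets \<open>{x} \<times> Y\<close>:
  there are only \<open>m\<close> of them, so the lower tail is exponentially small in
  \<open>m\<close>.\<close>

lemma prob_no_biclique: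
  assumes "2 * 4 ^ h * c \<le> 1" "h \<le> m"
  shows "measure_pmf.prob rnd {f. bicliques h X Y f = {}}
    \<le> exp (- 2 * (c ^ (h\<^sup>2) / (2 * real h ^ (2 * h)))\<^sup>2 * real m)"
proof -
  have XY: "X \<times> Y = (\<Union>x\<in>X. {x} \<times> Y)" by auto
  have "measure_pmf.prob rnd {f. bicliques h X Y f = {}}
     \<le> measure_pmf.prob rnd {f. real (packing_number h X Y f) \<le> 0}"
  proof (intro measure_pmf.finite_measure_mono subsetI CollectI)
    fix f assume "f \<in> {f. bicliques h X Y f = {}}"
    then show "real (packing_number h X Y f) \<le> 0"
      using packing_number_witness[OF X(1) Y(1), of h f] by (auto simp: packing_def)
  qed auto
  also have "\<dots> \<le> exp (- 2 * (c ^ (h\<^sup>2) / (2 * real h ^ (2 * h)))\<^sup>2 * real (card X))"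
    unfolding XY
  proof (rule mcdiarmid_lower_tail_Pi_pmf)
    show "real (packing_number h X Y f) - real (packing_number h X Y g) \<le> 1"
      if "x \<in> X" "\<And>e. e \<notin> {x} \<times> Y \<Longrightarrow> f e = g e" for x f g
      using packing_number_lipschitz[OF X(1) Y(1), where a = x and f = f and g = g and h = h] that(2)
      by fastforce
    show "c ^ (h\<^sup>2) / (2 * real h ^ (2 * h)) * real (card X) \<le>
       measure_pmf.expectation (Pi_pmf (\<Union>x\<in>X. {x} \<times> Y) False (\<lambda>_. bernoulli_pmf q)) (\<lambda>f. real (packing_number h X Y f))"
      using expectation_packing_number[OF assms] unfolding XY[symmetric] X .
  qed (use X Y c h in \<open>auto simp: disjoint_family_on_def intro: finite_subset[OF subset_UNIV]\<close>)
  finally show ?thesis using X by simp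
qed

end

end

section \<open>Almost perfect tilings of the random graph\<close>

text \<open>Before each new tile at least \<open>m\<close> vertices remain uncovered on either side,
  and any \<open>m\<close> of them on both sides contain a biclique. The index set \<open>R\<close>
  is arbitrary so that tiles can later be indexed by group and number within the group.\<close>

lemma greedy_biclique_rows:
  fixes A :: "'a set" and B :: "'b set"
  assumes fin: "finite A" "finite B" and card: "card A = n" "card B = n"
    and ex: "\<And>X Y. X \<subseteq> A \<Longrightarrow> Y \<subseteq> B \<Longrightarrow> card X = m \<Longrightarrow> card Y = m \<Longrightarrow> bicliques h X Y f \<noteq> {}"
    and R: "finite R" "h * card R + m \<le> n"
  shows "\<exists>u v. inj_on u (R \<times> {..<h}) \<and> u ` (R \<times> {..<h}) \<subseteq> A \<and>
      inj_on v (R \<times> {..<h}) \<and> v ` (R \<times> {..<h}) \<subseteq> B \<and>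
      (\<forall>r\<in>R. \<forall>i<h. \<forall>j<h. f (u (r, i), v (r, j)))"
  using R
proof (induction R rule: finite_induct)
  case empty
  show ?case by simp
next
  case (insert r R)
  have *: "(insert r R) \<times> {..<h} = ({r} \<times> {..<h}) \<union> (R \<times> {..<h})" by auto
  obtain u v where u: "inj_on u (R \<times> {..<h})" "u ` (R \<times> {..<h}) \<subseteq> A"
    and v: "inj_on v (R \<times> {..<h})" "v ` (R \<times> {..<h}) \<subseteq> B"
    and uv: "\<forall>r\<in>R. \<forall>i<h. \<forall>j<h. f (u (r, i), v (r, j))"
    using insert by auto
  have "m \<le> card (A - u ` (R \<times> {..<h}))"
    using u insert.prems insert.hyps fin card
    by (simp add: card_Diff_subset card_image card_cartesian_product mult.commute)
  then obtain X where X: "X \<subseteq> A - u ` (R \<times> {..<h})" "card X = m"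
    by (meson obtain_subset_with_card_n)
  have "m \<le> card (B - v ` (R \<times> {..<h}))"
    using v insert.prems insert.hyps fin card
    by (simp add: card_Diff_subset card_image card_cartesian_product mult.commute)
  then obtain Y where Y: "Y \<subseteq> B - v ` (R \<times> {..<h})" "card Y = m"
    by (meson obtain_subset_with_card_n)
  obtain P Q where PQ: "P \<subseteq> X" "card P = h" "Q \<subseteq> Y" "card Q = h" "\<forall>e\<in>P \<times> Q. f e"
  proof -
    have "X \<subseteq> A" "Y \<subseteq> B" using X(1) Y(1) by auto
    then have "bicliques h X Y f \<noteq> {}" using X(2) Y(2) by (intro ex)
    then show ?thesis using that unfolding bicliques_def by blast
  qed
  have finPQ: "finite P" "finite Q" using PQ X Y fin by (meson Diff_subset finite_subset)+
  obtain p where p: "bij_betw p {..<h} P"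
    using finPQ(1) PQ(2) ex_bij_betw_nat_finite[of P] by (auto simp: atLeast0LessThan)
  obtain q where q: "bij_betw q {..<h} Q"
    using finPQ(2) PQ(4) ex_bij_betw_nat_finite[of Q] by (auto simp: atLeast0LessThan)
  define u' where "u' = (\<lambda>(s, i). if s = r then p i else u (s, i))"
  define v' where "v' = (\<lambda>(s, i). if s = r then q i else v (s, i))"
  have old: "u' ` (R \<times> {..<h}) = u ` (R \<times> {..<h})" "v' ` (R \<times> {..<h}) = v ` (R \<times> {..<h})"
    using insert.hyps(2) by (auto simp: u'_def v'_def image_def)
  have new: "u' ` ({r} \<times> {..<h}) = P" "v' ` ({r} \<times> {..<h}) = Q"
    using p q by (auto simp: u'_def v'_def bij_betw_def image_def)
  have inj_old: "inj_on u' (R \<times> {..<h})" "inj_on v' (R \<times> {..<h})"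
    using u v insert.hyps(2) by (auto simp: u'_def v'_def inj_on_def)
  have inj_new: "inj_on u' ({r} \<times> {..<h})" "inj_on v' ({r} \<times> {..<h})"
    using p q by (auto simp: u'_def v'_def inj_on_def bij_betw_def)
  have disj: "u' ` ({r} \<times> {..<h}) \<inter> u' ` (R \<times> {..<h}) = {}"
    "v' ` ({r} \<times> {..<h}) \<inter> v' ` (R \<times> {..<h}) = {}"
    unfolding old new using PQ X Y by auto
  show ?case
  proof (intro exI[of _ u'] exI[of _ v'] conjI)
    show "inj_on u' (insert r R \<times> {..<h})" unfolding * inj_on_Un using inj_old inj_new disj by blast
    show "inj_on v' (insert r R \<times> {..<h})" unfolding * inj_on_Un using inj_old inj_new disj by blast
    show "u' ` (insert r R \<times> {..<h}) \<subseteq> A" "v' ` (insert r R \<times> {..<h}) \<subseteq> B"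
      unfolding * image_Un old new using u v PQ X Y by auto
    show "\<forall>s\<in>insert r R. \<forall>i<h. \<forall>j<h. f (u' (s, i), v' (s, j))"
      using uv PQ(5) bij_betw_apply[OF p] bij_betw_apply[OF q] insert.hyps(2)
      by (auto simp: u'_def v'_def)
  qed
qed

text \<open>A union bound over at most \<open>4^n\<close> pairs of sets. For one pair the event is
  decreasing and depends only on the coordinates in \<open>X \<times> Y\<close>, so the marginal
  there can be split into \<open>K\<close> rounds.\<close>

lemma prob_some_pair_no_biclique:
  fixes A :: "'a set" and B :: "'b set" and c p :: real
  assumes fin: "finite A" "finite B" and card: "card A = n" "card B = n"
    and hm: "1 \<le> h" "h \<le> m" and c: "0 < c" "2 * 4 ^ h * c \<le> 1"
    and p: "real K * (c * real m powr (- ((2 * real h - 1) / (real h)\<^sup>2))) \<le> p" "p \<le> 1"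
  shows "measure_pmf.prob (Pi_pmf (A \<times> B) False (\<lambda>_. bernoulli_pmf p))
      {f. \<exists>X Y. X \<subseteq> A \<and> Y \<subseteq> B \<and> card X = m \<and> card Y = m \<and> bicliques h X Y f = {}}
    \<le> 4 ^ n * exp (- 2 * (c ^ (h\<^sup>2) / (2 * real h ^ (2 * h)))\<^sup>2 * real m) ^ K"
proof -
  let ?\<mu> = "Pi_pmf (A \<times> B) False (\<lambda>_. bernoulli_pmf p)"
  let ?e = "exp (- 2 * (c ^ (h\<^sup>2) / (2 * real h ^ (2 * h)))\<^sup>2 * real m)"
  define q where "q = c * real m powr (- ((2 * real h - 1) / (real h)\<^sup>2))"
  define Prs where "Prs = {X. X \<subseteq> A \<and> card X = m} \<times> {Y. Y \<subseteq> B \<and> card Y = m}"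
  have finP: "finite Prs" using fin by (auto simp: Prs_def)
  have "2 * c \<le> 2 * 4 ^ h * c" using c by simp
  then have c1: "c \<le> 1" using c by linarith
  have single: "measure_pmf.prob ?\<mu> {f. bicliques h (fst Z) (snd Z) f = {}} \<le> ?e ^ K" if Z: "Z \<in> Prs" for Z
  proof -
    obtain X Y where XY: "Z = (X, Y)" "X \<subseteq> A" "card X = m" "Y \<subseteq> B" "card Y = m"
      using Z by (auto simp: Prs_def)
    have finXY: "finite X" "finite Y" using XY fin finite_subset by auto
    have restr: "bicliques h X Y (\<lambda>e. if e \<in> X \<times> Y then f e else False) = bicliques h X Y f" for f
      by (auto simp: bicliques_def)
    have sub: "Pi_pmf (X \<times> Y) False (\<lambda>_. bernoulli_pmf p)
       = map_pmf (\<lambda>f e. if e \<in> X \<times> Y then f e else False) ?\<mu>"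
      using XY fin by (intro Pi_pmf_subset) auto
    have "measure_pmf.prob ?\<mu> {f. bicliques h X Y f = {}}
       = measure_pmf.prob (Pi_pmf (X \<times> Y) False (\<lambda>_. bernoulli_pmf p)) {f. bicliques h X Y f = {}}"
      unfolding sub by (simp only: measure_map_pmf vimage_Collect_eq restr)
    also have "\<dots> \<le> measure_pmf.prob (Pi_pmf (X \<times> Y) False (\<lambda>_. bernoulli_pmf q)) {f. bicliques h X Y f = {}} ^ K"
    proof (rule prob_decreasing_power)
      show "g \<in> {f. bicliques h X Y f = {}}"
        if "f \<in> {f. bicliques h X Y f = {}}" "\<And>e. g e \<Longrightarrow> f e" for f g :: "'a \<times> 'b \<Rightarrow> bool"
        using that by (auto simp: bicliques_def) blast
    qed (use finXY c p in \<open>auto simp: q_def\<close>)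
    also have "\<dots> \<le> ?e ^ K"
      using prob_no_biclique[OF _ _ c(1) c1 q_def finXY(1) XY(3) finXY(2) XY(5) c(2)] hm
      by (intro power_mono) auto
    finally show ?thesis by (simp add: XY)
  qed
  have "{f. \<exists>X Y. X \<subseteq> A \<and> Y \<subseteq> B \<and> card X = m \<and> card Y = m \<and> bicliques h X Y f = {}}
     = (\<Union>Z\<in>Prs. {f. bicliques h (fst Z) (snd Z) f = {}})"
    unfolding Prs_def by (intro set_eqI iffI) (simp; blast)+
  then have "measure_pmf.prob ?\<mu> {f. \<exists>X Y. X \<subseteq> A \<and> Y \<subseteq> B \<and> card X = m \<and> card Y = m \<and> bicliques h X Y f = {}}
     \<le> (\<Sum>Z\<in>Prs. measure_pmf.prob ?\<mu> {f. bicliques h (fst Z) (snd Z) f = {}})"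
    using measure_pmf.finite_measure_subadditive_finite[OF finP] by simp
  also have "\<dots> \<le> (\<Sum>Z\<in>Prs. ?e ^ K)" by (intro sum_mono single)
  also have "\<dots> = real (card Prs) * ?e ^ K" by simp
  also have "\<dots> \<le> 4 ^ n * ?e ^ K"
  proof (rule mult_right_mono)
    have "card Prs \<le> card (Pow A \<times> Pow B)"
      using fin by (intro card_mono) (auto simp: Prs_def)
    also have "\<dots> = 4 ^ n" using card fin by (simp add: card_cartesian_product card_Pow power_mult_distrib[symmetric])
    finally have "real (card Prs) \<le> real (4 ^ n)" by (rule of_nat_mono)
    then show "real (card Prs) \<le> 4 ^ n" by simp
  qed simp
  finally show ?thesis .
qed

section \<open>Absorption\<close>

text \<open>Fewer than \<open>L\<close> elements are taken before each choice, so one is always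
  left. It serves to give each chunk of leftover vertices an absorbing group of its own.\<close>

lemma greedy_transversal:
  assumes "\<And>l. l < L \<Longrightarrow> finite (S l)" "\<And>l. l < L \<Longrightarrow> L \<le> card (S l)"
  obtains g :: "nat \<Rightarrow> 'k" where "inj_on g {..<L}" "\<And>l. l < L \<Longrightarrow> g l \<in> S l"
proof -
  have "\<exists>g. inj_on g {..<k} \<and> (\<forall>l<k. g l \<in> S l)" if "k \<le> L" for k
    using that
  proof (induction k)
    case (Suc k)
    then obtain g where g: "inj_on g {..<k}" "\<forall>l<k. g l \<in> S l" by auto
    have "card (g ` {..<k}) \<le> k" using card_image_le[of "{..<k}" g] by simp
    then have "card (g ` {..<k}) < card (S k)" using assms(2)[of k] Suc.prems by simp
    then obtain x where "x \<in> S k" "x \<notin> g ` {..<k}"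
      by (metis card_mono finite_imageI finite_lessThan not_less subsetI)
    then show ?case using g
      by (intro exI[of _ "g(k := x)"]) (auto simp: inj_on_def lessThan_Suc less_Suc_eq)
  qed simp
  then show ?thesis using that by blast
qed

text \<open>A group consists of \<open>2 * h + 1\<close> tiles, numbered from \<open>0\<close>, and \<open>(i, j)\<close> is the \<open>j\<close>-th vertex of
  tile \<open>i\<close> on the respective side. The tiles \<open>1, \<dots>, h\<close> take in \<open>a 0, \<dots>, a (h - 1)\<close> in exchange
  for their \<open>0\<close>-th vertices, and these replace the left side of tile \<open>0\<close>. The tiles
  \<open>h + 1, \<dots>, 2 * h\<close> take in \<open>b 0, \<dots>, b (h - 1)\<close> in the same way, and their \<open>0\<close>-th vertices form
  a new tile with the old left side of tile \<open>0\<close>.\<close>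

definition absorbs :: "nat \<Rightarrow> ('a \<times> 'b) set \<Rightarrow> (nat \<Rightarrow> 'a) \<Rightarrow> (nat \<Rightarrow> 'b) \<Rightarrow>
    (nat \<times> nat \<Rightarrow> 'a) \<Rightarrow> (nat \<times> nat \<Rightarrow> 'b) \<Rightarrow> bool" where
  "absorbs h E a b x y \<longleftrightarrow> (\<forall>i<h. \<forall>j<h.
     (a i, y (Suc i, j)) \<in> E \<and> (x (Suc (h + i), j), b i) \<in> E \<and>
     (x (Suc i, 0), y (0, j)) \<in> E \<and> (x (0, i), y (Suc (h + j), 0)) \<in> E)"

text \<open>Groups are the indices below \<open>N\<close>; the index \<open>(N + l, 0)\<close> holds
  the \<open>l\<close>-th chunk of \<open>h\<close> leftover vertices on each side, which is not yet
  a tile. The exchange is written as a permutation of the slots on each side, composed with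
  \<open>u\<close> and \<open>v\<close>: the index set stays the same, and covering every vertex
  exactly once is automatic.\<close>

lemma absorb:
  fixes h N L :: nat and u :: "(nat \<times> nat) \<times> nat \<Rightarrow> 'a" and v :: "(nat \<times> nat) \<times> nat \<Rightarrow> 'b"
  defines "R \<equiv> {..<N} \<times> {..2 * h} \<union> {N..<N + L} \<times> {0}"
  assumes u: "bij_betw u (R \<times> {..<h}) A" and v: "bij_betw v (R \<times> {..<h}) B"
    and tiles: "\<And>k r i j. k < N \<Longrightarrow> r \<le> 2 * h \<Longrightarrow> i < h \<Longrightarrow> j < h \<Longrightarrow> (u ((k, r), i), v ((k, r), j)) \<in> E"
    and g: "inj_on g {..<L}" "\<And>l. l < L \<Longrightarrow> g l < N"
    and abs: "\<And>l. l < L \<Longrightarrow> absorbs h E (\<lambda>i. u ((N + l, 0), i)) (\<lambda>i. v ((N + l, 0), i))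
        (\<lambda>(r, i). u ((g l, r), i)) (\<lambda>(r, i). v ((g l, r), i))"
  shows "\<exists>u' v'. bij_betw u' (R \<times> {..<h}) A \<and> bij_betw v' (R \<times> {..<h}) B \<and>
    (\<forall>\<rho>\<in>R. \<forall>i<h. \<forall>j<h. (u' (\<rho>, i), v' (\<rho>, j)) \<in> E)"
proof -
  \<comment> \<open>The index of the chunk that group \<open>k\<close> absorbs, meaningful for used
    groups.\<close>
  define c where "c = (\<lambda>k. N + inv_into {..<L} g k)"
  have c: "c (g l) = N + l" if "l < L" for l
    using g(1) that by (simp add: c_def inv_into_f_f)
  define used where "used = g ` {..<L}"
  \<comment> \<open>\<open>\<pi>\<close> sends a slot of the new tiling to the old slot whose left
    vertex it receives, and \<open>\<tau>\<close> does the same on the right. The chunk index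
    receives the new tile: the left side of tile 0 with the 0-th right vertices of the tiles beyond
    \<open>h\<close>.\<close>
  define \<pi> where "\<pi> = (\<lambda>((k, r), i).
    if N \<le> k then ((g (k - N), 0), i)
    else if k \<in> used \<and> r = 0 then ((k, Suc i), 0)
    else if k \<in> used \<and> r \<le> h \<and> i = 0 then ((c k, 0), r - 1)
    else ((k, r), i :: nat))"
  define \<tau> where "\<tau> = (\<lambda>((k, r), i).
    if N \<le> k then ((g (k - N), Suc (h + i)), 0)
    else if k \<in> used \<and> h < r \<and> i = 0 then ((c k, 0), r - Suc h)
    else ((k, r), i :: nat))"
  have finR: "finite (R \<times> {..<h})" by (auto simp: R_def)
  have img\<pi>: "\<pi> ` (R \<times> {..<h}) \<subseteq> R \<times> {..<h}"
    using g(2) c by (auto simp: R_def \<pi>_def used_def split: if_splits)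
  have img\<tau>: "\<tau> ` (R \<times> {..<h}) \<subseteq> R \<times> {..<h}"
    using g(2) c by (auto simp: R_def \<tau>_def used_def split: if_splits)
  \<comment> \<open>A surjection of a finite set onto itself is injective, so a preimage for every
    slot suffices.\<close>
  have "R \<times> {..<h} \<subseteq> \<pi> ` (R \<times> {..<h})"
  proof (rule subsetI)
    fix z assume "z \<in> R \<times> {..<h}"
    then obtain k r i where z: "z = ((k, r), i)" "(k, r) \<in> R" "i < h" by auto
    consider (chunk) l where "l < L" "k = N + l" "r = 0"
      | (centre) l where "l < L" "k = g l" "k < N" "r = 0"
      | (spoke) l where "l < L" "k = g l" "k < N" "0 < r" "r \<le> h" "i = 0"
      | (rest) "k < N" "r \<le> 2 * h" "k \<in> used \<longrightarrow> 0 < r \<and> (r \<le> h \<longrightarrow> 0 < i)"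
      using z(2,3) g(2) by (fastforce simp: R_def used_def le_iff_add)
    then show "z \<in> \<pi> ` (R \<times> {..<h})"
    proof cases
      case chunk
      then show ?thesis using z g(2)[of l] c[of l]
        by (intro image_eqI[of _ _ "((g l, Suc i), 0)"]) (auto simp: \<pi>_def R_def used_def)
    next
      case centre
      then show ?thesis using z
        by (intro image_eqI[of _ _ "((N + l, 0), i)"]) (auto simp: \<pi>_def R_def)
    next
      case spoke
      then show ?thesis using z
        by (intro image_eqI[of _ _ "((g l, 0), r - 1)"]) (auto simp: \<pi>_def R_def used_def)
    next
      case rest
      then show ?thesis using z
        by (intro image_eqI[of _ _ z]) (auto simp: \<pi>_def)
    qed
  qed
  then have \<pi>: "bij_betw \<pi> (R \<times> {..<h}) (R \<times> {..<h})"
    using img\<pi> finite_surj_inj[OF finR] by (auto simp: bij_betw_def)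
  have "R \<times> {..<h} \<subseteq> \<tau> ` (R \<times> {..<h})"
  proof (rule subsetI)
    fix z assume "z \<in> R \<times> {..<h}"
    then obtain k r i where z: "z = ((k, r), i)" "(k, r) \<in> R" "i < h" by auto
    consider (chunk) l where "l < L" "k = N + l" "r = 0"
      | (spoke) l where "l < L" "k = g l" "k < N" "h < r" "r \<le> 2 * h" "i = 0"
      | (rest) "k < N" "r \<le> 2 * h" "k \<in> used \<longrightarrow> h < r \<longrightarrow> 0 < i"
      using z(2,3) g(2) by (fastforce simp: R_def used_def le_iff_add)
    then show "z \<in> \<tau> ` (R \<times> {..<h})"
    proof cases
      case chunk
      then show ?thesis using z g(2)[of l] c[of l]
        by (intro image_eqI[of _ _ "((g l, Suc (h + i)), 0)"]) (auto simp: \<tau>_def R_def used_def)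
    next
      case spoke
      then show ?thesis using z
        by (intro image_eqI[of _ _ "((N + l, 0), r - Suc h)"]) (auto simp: \<tau>_def R_def)
    next
      case rest
      then show ?thesis using z
        by (intro image_eqI[of _ _ z]) (auto simp: \<tau>_def)
    qed
  qed
  then have \<tau>: "bij_betw \<tau> (R \<times> {..<h}) (R \<times> {..<h})"
    using img\<tau> finite_surj_inj[OF finR] by (auto simp: bij_betw_def)
  show ?thesis
  proof (intro exI[of _ "u \<circ> \<pi>"] exI[of _ "v \<circ> \<tau>"] conjI ballI allI impI)
    show "bij_betw (u \<circ> \<pi>) (R \<times> {..<h}) A" by (rule bij_betw_trans[OF \<pi> u])
    show "bij_betw (v \<circ> \<tau>) (R \<times> {..<h}) B" by (rule bij_betw_trans[OF \<tau> v])
    fix \<rho> i j assume \<rho>: "\<rho> \<in> R" and ij: "i < h" "j < h"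
    obtain k r where kr: "\<rho> = (k, r)" by (cases \<rho>)
    \<comment> \<open>The new tile and tile 0 need only the last two conditions of
      \<open>absorbs\<close>. The other tiles of a used group changed at position 0 on one side
      only; there one of the first two conditions applies, elsewhere the old tile edges
      remain.\<close>
    consider (chunk) l where "l < L" "k = N + l" "r = 0"
      | (centre) l where "l < L" "k = g l" "k < N" "r = 0"
      | (spoke) l s where "l < L" "k = g l" "k < N" "r = Suc s" "s < h"
      | (spoke') l s where "l < L" "k = g l" "k < N" "r = Suc (h + s)" "s < h"
      | (rest) "k < N" "r \<le> 2 * h" "k \<notin> used"
    proof -
      have "r = 0 \<or> (\<exists>s<h. r = Suc s) \<or> (\<exists>s<h. r = Suc (h + s))" if "r \<le> 2 * h"
        using that by presburger
      then show ?thesis using \<rho> kr g(2) that by (fastforce simp: R_def used_def le_iff_add)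
    qed
    then show "((u \<circ> \<pi>) (\<rho>, i), (v \<circ> \<tau>) (\<rho>, j)) \<in> E"
    proof cases
      case chunk
      then show ?thesis using abs[of l] ij kr by (simp add: absorbs_def \<pi>_def \<tau>_def)
    next
      case centre
      then show ?thesis using abs[of l] ij kr by (simp add: absorbs_def \<pi>_def \<tau>_def used_def)
    next
      case spoke
      then show ?thesis using abs[of l] tiles[of k r i j] ij kr c[of l]
        by (simp add: absorbs_def \<pi>_def \<tau>_def used_def)
    next
      case spoke'
      then show ?thesis using abs[of l] tiles[of k r i j] ij kr c[of l]
        by (simp add: absorbs_def \<pi>_def \<tau>_def used_def)
    next
      case rest
      then show ?thesis using tiles[of k r i j] ij kr by (simp add: \<pi>_def \<tau>_def)
    qed
  qed
qed

section \<open>Random permutations\<close>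

lemma card_permutes_prescribed:
  assumes A: "finite A" "card A = n" and S: "finite S" and u: "inj_on u S" "u ` S \<subseteq> A"
  shows "card {\<sigma>. \<sigma> permutes A \<and> (\<forall>s\<in>S. \<sigma> (u s) = f s)} * (n - card S) ^ card S \<le> fact n"
  using S u
proof (induction S rule: finite_induct)
  case empty
  then show ?case using A by (simp add: card_permutations)
next
  case (insert s S)
  define P where "P = (\<lambda>S. {\<sigma>. \<sigma> permutes A \<and> (\<forall>s\<in>S. \<sigma> (u s) = f s)})"
  have finP: "finite (P S)" for S
    by (rule finite_subset[OF _ finite_permutations[OF A(1)]]) (auto simp: P_def)
  have us: "u s \<in> A" "u s \<notin> u ` S" using insert by auto
  have "card (P (insert s S)) * (n - card S) \<le> card (P S)"
  proof -
    let ?X = "A - f ` S"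
    \<comment> \<open>The new permutation takes the value \<open>a\<close> at \<open>u s\<close>, so
      \<open>a\<close> and then \<open>\<sigma>\<close> can be recovered.\<close>
    let ?\<phi> = "\<lambda>(\<sigma>, a). Transposition.transpose a (f s) \<circ> \<sigma>"
    have sub: "?\<phi> ` (P (insert s S) \<times> ?X) \<subseteq> P S"
    proof (rule image_subsetI, clarify)
      fix \<sigma> a assume \<sigma>: "\<sigma> \<in> P (insert s S)" and a: "a \<in> A" "a \<notin> f ` S"
      have perm: "\<sigma> permutes A" and fs: "\<sigma> (u s) = f s" using \<sigma> by (auto simp: P_def)
      have "f s \<in> A" using permutes_in_image[OF perm] us fs by metis
      moreover have "f t \<noteq> f s" if "t \<in> S" for t
      proof
        assume "f t = f s"
        then have "\<sigma> (u t) = \<sigma> (u s)" using \<sigma> that by (auto simp: P_def)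
        then have "u t = u s" using permutes_inj[OF perm] by (auto dest: injD)
        then show False using us(2) that by (metis imageI)
      qed
      ultimately show "Transposition.transpose a (f s) \<circ> \<sigma> \<in> P S"
        using \<sigma> a perm permutes_swap_id[of a A "f s"]
        by (auto simp: P_def intro!: permutes_compose transpose_apply_other)
    qed
    have inj: "inj_on ?\<phi> (P (insert s S) \<times> ?X)"
    proof (rule inj_onI, clarify)
      fix \<sigma> a \<sigma>' a'
      assume \<sigma>: "\<sigma> \<in> P (insert s S)" "\<sigma>' \<in> P (insert s S)"
        and eq: "Transposition.transpose a (f s) \<circ> \<sigma> = Transposition.transpose a' (f s) \<circ> \<sigma>'"
      have "Transposition.transpose a (f s) (\<sigma> (u s)) = Transposition.transpose a' (f s) (\<sigma>' (u s))"
        using eq by (simp add: fun_eq_iff)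
      then have a: "a = a'" using \<sigma> by (simp add: P_def)
      have "Transposition.transpose a (f s) \<circ> (Transposition.transpose a (f s) \<circ> \<sigma>) = Transposition.transpose a (f s) \<circ> (Transposition.transpose a (f s) \<circ> \<sigma>')"
        using eq a by simp
      then show "\<sigma> = \<sigma>' \<and> a = a'" using a by (simp add: comp_assoc[symmetric])
    qed
    have "card (P (insert s S)) * card ?X \<le> card (P S)"
      using card_inj_on_le[OF inj sub finP] by (simp add: card_cartesian_product)
    moreover have "n - card S \<le> card ?X"
      using A insert.hyps card_image_le[of S f] diff_card_le_card_Diff[of "f ` S" A] by simp
    ultimately show ?thesis by (meson le_trans mult_le_mono2)
  qed
  have "card (P (insert s S)) * (n - card (insert s S)) ^ card (insert s S)
     \<le> card (P (insert s S)) * (n - card S) ^ Suc (card S)"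
    unfolding card_insert_disjoint[OF insert.hyps] by (intro mult_left_mono power_mono) auto
  also have "\<dots> = card (P (insert s S)) * (n - card S) * (n - card S) ^ card S" by simp
  also have "\<dots> \<le> card (P S) * (n - card S) ^ card S"
    using \<open>card (P (insert s S)) * (n - card S) \<le> card (P S)\<close> by (intro mult_right_mono) auto
  also have "\<dots> \<le> fact n"
    unfolding P_def by (rule insert.IH) (use insert.prems in auto)
  finally show ?case by (simp add: P_def)
qed

text \<open>A change of measure: an event for the random injections
  \<open>\<sigma> \<circ> u\<close> and \<open>\<tau> \<circ> v\<close> is at most
  \<open>(n / (n - s))^(2s)\<close> times as likely as for independent uniform functions on
  \<open>S\<close>, where \<open>s = card S\<close>. It is obtained by summing the point bounds over
  all pairs of functions in the event.\<close>

lemma card_permutes_pair_le: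
  assumes A: "finite A" "card A = n" and B: "finite B" "card B = n"
    and S: "finite S" and u: "inj_on u S" "u ` S \<subseteq> A" and v: "inj_on v S" "v ` S \<subseteq> B"
  shows "card {(\<sigma>, \<tau>). \<sigma> permutes A \<and> \<tau> permutes B \<and> D (restrict (\<sigma> \<circ> u) S) (restrict (\<tau> \<circ> v) S)}
      * (n - card S) ^ (2 * card S)
    \<le> (fact n)\<^sup>2 * card {(f, g). f \<in> S \<rightarrow>\<^sub>E A \<and> g \<in> S \<rightarrow>\<^sub>E B \<and> D f g}"
proof -
  define \<D> where "\<D> = {(f, g). f \<in> S \<rightarrow>\<^sub>E A \<and> g \<in> S \<rightarrow>\<^sub>E B \<and> D f g}"
  define U where "U = (\<lambda>f. {\<sigma>. \<sigma> permutes A \<and> (\<forall>s\<in>S. \<sigma> (u s) = f s)})"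
  define V where "V = (\<lambda>g. {\<tau>. \<tau> permutes B \<and> (\<forall>s\<in>S. \<tau> (v s) = g s)})"
  have fin: "finite (U f)" "finite (V g)" for f g
    using finite_subset[OF _ finite_permutations[OF A(1)], of "U f"]
      finite_subset[OF _ finite_permutations[OF B(1)], of "V g"]
    by (auto simp: U_def V_def)
  have fin\<D>: "finite \<D>"
    by (rule finite_subset[of _ "(S \<rightarrow>\<^sub>E A) \<times> (S \<rightarrow>\<^sub>E B)"]) (auto simp: \<D>_def A B S intro!: finite_PiE)
  have "card {(\<sigma>, \<tau>). \<sigma> permutes A \<and> \<tau> permutes B \<and> D (restrict (\<sigma> \<circ> u) S) (restrict (\<tau> \<circ> v) S)}
     \<le> card (\<Union>(f, g)\<in>\<D>. U f \<times> V g)"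
  proof (intro card_mono finite_UN_I fin\<D> subsetI)
    fix z assume "z \<in> {(\<sigma>, \<tau>). \<sigma> permutes A \<and> \<tau> permutes B \<and> D (restrict (\<sigma> \<circ> u) S) (restrict (\<tau> \<circ> v) S)}"
    then obtain \<sigma> \<tau> where z: "z = (\<sigma>, \<tau>)" "\<sigma> permutes A" "\<tau> permutes B" "D (restrict (\<sigma> \<circ> u) S) (restrict (\<tau> \<circ> v) S)"
      by auto
    have "\<sigma> (u s) \<in> A" "\<tau> (v s) \<in> B" if "s \<in> S" for s
      using that u v permutes_in_image[OF z(2)] permutes_in_image[OF z(3)] by auto
    then have "(restrict (\<sigma> \<circ> u) S, restrict (\<tau> \<circ> v) S) \<in> \<D>" using z by (auto simp: \<D>_def)
    moreover have "z \<in> U (restrict (\<sigma> \<circ> u) S) \<times> V (restrict (\<tau> \<circ> v) S)" using z by (auto simp: U_def V_def)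
    ultimately show "z \<in> (\<Union>(f, g)\<in>\<D>. U f \<times> V g)" by force
  qed (auto simp: fin)
  also have "\<dots> \<le> (\<Sum>(f, g)\<in>\<D>. card (U f) * card (V g))"
    using card_UN_le[OF fin\<D>, of "\<lambda>(f, g). U f \<times> V g"] by (simp add: case_prod_beta card_cartesian_product)
  finally have "card {(\<sigma>, \<tau>). \<sigma> permutes A \<and> \<tau> permutes B \<and> D (restrict (\<sigma> \<circ> u) S) (restrict (\<tau> \<circ> v) S)}
      * (n - card S) ^ (2 * card S)
    \<le> (\<Sum>(f, g)\<in>\<D>. card (U f) * card (V g)) * (n - card S) ^ (2 * card S)"
    by (rule mult_right_mono) simp
  also have "\<dots> = (\<Sum>(f, g)\<in>\<D>. (card (U f) * (n - card S) ^ card S) * (card (V g) * (n - card S) ^ card S))"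
    unfolding mult_2 power_add by (simp add: sum_distrib_right sum_distrib_left case_prod_beta mult_ac)
  also have "\<dots> \<le> (\<Sum>(f, g)\<in>\<D>. fact n * fact n)"
    unfolding case_prod_beta U_def V_def
    by (intro sum_mono mult_mono card_permutes_prescribed A B S u v) auto
  also have "\<dots> = (fact n)\<^sup>2 * card \<D>" by (simp add: power2_eq_square case_prod_beta)
  finally show ?thesis by (simp add: \<D>_def)
qed

text \<open>Chernoff's bound with weight 1/2 for each success. The weights of one coordinate add up
  to at most \<open>1 - c / 2\<close> of \<open>card \<Omega>\<close>, and a sequence with at most
  \<open>t\<close> successes has weight at least \<open>2^(-t)\<close>.\<close>

lemma card_few_successes:
  assumes I: "finite I" and \<Omega>: "finite \<Omega>" "Good \<subseteq> \<Omega>" and c: "real (card Good) \<ge> c * real (card \<Omega>)"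
  shows "real (card {F \<in> I \<rightarrow>\<^sub>E \<Omega>. card {k\<in>I. F k \<in> Good} \<le> t})
    \<le> real (card \<Omega>) ^ card I * (1 - c / 2) ^ card I * 2 ^ t"
proof -
  define w :: "'b \<Rightarrow> real" where "w = (\<lambda>\<omega>. if \<omega> \<in> Good then 1 / 2 else 1)"
  have finPi: "finite (I \<rightarrow>\<^sub>E \<Omega>)" using I \<Omega> by (intro finite_PiE) auto
  have prodw: "(\<Prod>k\<in>I. w (F k)) = (1 / 2) ^ card {k\<in>I. F k \<in> Good}" for F
    using I by (simp add: w_def prod.If_cases Int_def)
  have "real (card {F \<in> I \<rightarrow>\<^sub>E \<Omega>. card {k\<in>I. F k \<in> Good} \<le> t}) * (1 / 2) ^ t
     = (\<Sum>F\<in>{F \<in> I \<rightarrow>\<^sub>E \<Omega>. card {k\<in>I. F k \<in> Good} \<le> t}. (1 / 2) ^ t)"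
    by simp
  also have "\<dots> \<le> (\<Sum>F\<in>{F \<in> I \<rightarrow>\<^sub>E \<Omega>. card {k\<in>I. F k \<in> Good} \<le> t}. \<Prod>k\<in>I. w (F k))"
    unfolding prodw by (intro sum_mono power_decreasing) auto
  also have "\<dots> \<le> (\<Sum>F\<in>I \<rightarrow>\<^sub>E \<Omega>. \<Prod>k\<in>I. w (F k))"
    using finPi by (intro sum_mono2) (auto intro!: prod_nonneg simp: w_def)
  also have "\<dots> = (\<Sum>\<omega>\<in>\<Omega>. w \<omega>) ^ card I"
    using prod_sum_PiE[of I "\<lambda>_. \<Omega>" "\<lambda>_. w"] I \<Omega> by simp
  also have "\<dots> \<le> (real (card \<Omega>) * (1 - c / 2)) ^ card I"
  proof (rule power_mono)
    have "(\<Sum>\<omega>\<in>\<Omega>. w \<omega>) = (\<Sum>\<omega>\<in>\<Omega>. 1) - (\<Sum>\<omega>\<in>\<Omega>. if \<omega> \<in> Good then 1 / 2 else 0)"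
      unfolding sum_subtractf[symmetric] by (intro sum.cong) (auto simp: w_def)
    also have "\<dots> = real (card \<Omega>) - real (card Good) / 2"
      using \<Omega> by (simp add: sum.If_cases Int_absorb1)
    also have "\<dots> \<le> real (card \<Omega>) * (1 - c / 2)" using c by (simp add: algebra_simps)
    finally show "(\<Sum>\<omega>\<in>\<Omega>. w \<omega>) \<le> real (card \<Omega>) * (1 - c / 2)" .
  qed (auto intro!: sum_nonneg simp: w_def)
  finally have "real (card {F \<in> I \<rightarrow>\<^sub>E \<Omega>. card {k\<in>I. F k \<in> Good} \<le> t}) * (1 / 2) ^ t * 2 ^ t
     \<le> (real (card \<Omega>) * (1 - c / 2)) ^ card I * 2 ^ t"
    by (rule mult_right_mono) simp
  then show ?thesis by (simp add: power_mult_distrib power_one_over)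
qed

text \<open>Currying: a pair of functions on \<open>I \<times> T\<close> is a sequence indexed by
  \<open>I\<close> of pairs of functions on \<open>T\<close>, so the blocks are independent
  trials.\<close>

lemma card_few_good_blocks:
  fixes t :: nat
  assumes I: "finite I" and T: "finite T" and A: "finite A" "card A = n" and B: "finite B" "card B = n"
    and c: "real (card {(x, y). x \<in> T \<rightarrow>\<^sub>E A \<and> y \<in> T \<rightarrow>\<^sub>E B \<and> good x y}) \<ge> c * real n ^ (2 * card T)"
  shows "real (card {(f, g). f \<in> I \<times> T \<rightarrow>\<^sub>E A \<and> g \<in> I \<times> T \<rightarrow>\<^sub>E B \<and>
      card {k\<in>I. good (\<lambda>s\<in>T. f (k, s)) (\<lambda>s\<in>T. g (k, s))} \<le> t})
    \<le> real n ^ (2 * (card I * card T)) * (1 - c / 2) ^ card I * 2 ^ t"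
proof -
  define \<Omega> where "\<Omega> = (T \<rightarrow>\<^sub>E A) \<times> (T \<rightarrow>\<^sub>E B)"
  define Good where "Good = {(x, y). x \<in> T \<rightarrow>\<^sub>E A \<and> y \<in> T \<rightarrow>\<^sub>E B \<and> good x y}"
  define \<D> where "\<D> = {(f, g). f \<in> I \<times> T \<rightarrow>\<^sub>E A \<and> g \<in> I \<times> T \<rightarrow>\<^sub>E B \<and>
      card {k\<in>I. good (\<lambda>s\<in>T. f (k, s)) (\<lambda>s\<in>T. g (k, s))} \<le> t}"
  have fin\<Omega>: "finite \<Omega>" using T A B by (auto simp: \<Omega>_def intro!: finite_PiE)
  have card\<Omega>: "card \<Omega> = n ^ (2 * card T)"
    using T A B by (simp add: \<Omega>_def card_cartesian_product card_PiE mult_2 power_add)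
  define \<phi> where "\<phi> = (\<lambda>(f, g). \<lambda>k\<in>I. (\<lambda>s\<in>T. f (k, s) :: 'c, \<lambda>s\<in>T. g (k, s) :: 'd))"
  have "card \<D> \<le> card {F \<in> I \<rightarrow>\<^sub>E \<Omega>. card {k\<in>I. F k \<in> Good} \<le> t}"
  proof (rule card_inj_on_le)
    show "inj_on \<phi> \<D>"
    proof (rule inj_onI, clarify)
      fix f g f' g' assume D: "(f, g) \<in> \<D>" "(f', g') \<in> \<D>" and eq: "\<phi> (f, g) = \<phi> (f', g')"
      have "f (k, s) = f' (k, s) \<and> g (k, s) = g' (k, s)" if "k \<in> I" "s \<in> T" for k s
      proof -
        have "\<phi> (f, g) k = \<phi> (f', g') k" using eq by simp
        then show ?thesis using that by (simp add: \<phi>_def fun_eq_iff) metis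
      qed
      note ext = this
      have "f \<in> I \<times> T \<rightarrow>\<^sub>E A" "f' \<in> I \<times> T \<rightarrow>\<^sub>E A" "g \<in> I \<times> T \<rightarrow>\<^sub>E B" "g' \<in> I \<times> T \<rightarrow>\<^sub>E B"
        using D by (simp_all add: \<D>_def)
      then show "f = f' \<and> g = g'"
        using ext PiE_ext[of f "I \<times> T" "\<lambda>_. A" f'] PiE_ext[of g "I \<times> T" "\<lambda>_. B" g'] by fastforce
    qed
    show "\<phi> ` \<D> \<subseteq> {F \<in> I \<rightarrow>\<^sub>E \<Omega>. card {k\<in>I. F k \<in> Good} \<le> t}"
    proof (rule image_subsetI, clarify)
      fix f g assume D: "(f, g) \<in> \<D>"
      have "\<phi> (f, g) \<in> I \<rightarrow>\<^sub>E \<Omega>" using D by (auto simp: \<phi>_def \<Omega>_def \<D>_def)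
      moreover have "{k\<in>I. \<phi> (f, g) k \<in> Good} = {k\<in>I. good (\<lambda>s\<in>T. f (k, s)) (\<lambda>s\<in>T. g (k, s))}"
        using D by (auto simp: \<phi>_def Good_def \<D>_def)
      ultimately show "\<phi> (f, g) \<in> I \<rightarrow>\<^sub>E \<Omega> \<and> card {k\<in>I. \<phi> (f, g) k \<in> Good} \<le> t"
        using D by (simp add: \<D>_def)
    qed
    show "finite {F \<in> I \<rightarrow>\<^sub>E \<Omega>. card {k\<in>I. F k \<in> Good} \<le> t}"
      using I fin\<Omega> by (auto intro!: finite_PiE)
  qed
  then have "real (card \<D>) \<le> real (card {F \<in> I \<rightarrow>\<^sub>E \<Omega>. card {k\<in>I. F k \<in> Good} \<le> t})" by (rule of_nat_mono)
  also have "\<dots> \<le> real (card \<Omega>) ^ card I * (1 - c / 2) ^ card I * 2 ^ t"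
    using c by (intro card_few_successes I fin\<Omega>) (auto simp: Good_def \<Omega>_def card\<Omega>[unfolded \<Omega>_def])
  also have "real (card \<Omega>) ^ card I = real n ^ (2 * (card I * card T))"
    by (simp add: card\<Omega> power_mult[symmetric] mult_ac)
  finally show ?thesis by (simp add: \<D>_def)
qed

section \<open>Counting absorbers\<close>

lemma convex_on_power_nonneg: "convex_on {0::real..} (\<lambda>x. x ^ k)"
  by (cases "even k") (auto intro: convex_power_odd convex_on_subset[OF convex_power_even])

lemma power_mean_le:
  fixes z :: "'i \<Rightarrow> real"
  assumes "finite J" "J \<noteq> {}" "\<And>j. j \<in> J \<Longrightarrow> 0 \<le> z j"
  shows "real (card J) * ((\<Sum>j\<in>J. z j) / card J) ^ k \<le> (\<Sum>j\<in>J. z j ^ k)"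
proof -
  have pos: "card J > 0" using assms by (simp add: card_gt_0_iff)
  have "(\<Sum>j\<in>J. (1 / card J) *\<^sub>R z j) ^ k \<le> (\<Sum>j\<in>J. (1 / card J) * z j ^ k)"
    by (rule convex_on_sum[OF assms(1,2) convex_on_power_nonneg]) (use assms pos in auto)
  then have "((\<Sum>j\<in>J. z j) / card J) ^ k \<le> (\<Sum>j\<in>J. z j ^ k) / card J"
    by (simp add: sum_divide_distrib)
  then show ?thesis using pos by (simp add: field_simps)
qed

text \<open>Sidorenko's inequality for complete bipartite graphs. Count the pairs of a vertex
  \<open>a\<close> and a map \<open>g\<close> into its neighbourhood; this bounds the average size
  of the common neighbourhoods \<open>c g\<close>, and Jensen's inequality for the power
  \<open>card I\<close> counts the maps \<open>f\<close>. The maps need not be injective.\<close>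

lemma card_complete_pairs_ge:
  assumes fin: "finite I" "finite J" "finite A" "finite B" and n: "card A = n" "card B = n" "n > 0"
    and d: "0 \<le> d" "\<And>a. a \<in> A \<Longrightarrow> d * real n \<le> real (card {b\<in>B. (a, b) \<in> E})"
  shows "d ^ (card I * card J) * real n ^ (card I + card J)
    \<le> real (card {(f, g). f \<in> I \<rightarrow>\<^sub>E A \<and> g \<in> J \<rightarrow>\<^sub>E B \<and> (\<forall>i\<in>I. \<forall>j\<in>J. (f i, g j) \<in> E)})"
proof -
  let ?G = "J \<rightarrow>\<^sub>E B"
  define c where "c = (\<lambda>g. {a\<in>A. \<forall>j\<in>J. (a, g j) \<in> E})"
  have finG: "finite ?G" using fin by (auto intro!: finite_PiE)
  have cardG: "card ?G = n ^ card J" using fin n by (simp add: card_PiE)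
  have neG: "?G \<noteq> {}" using n by (auto simp: PiE_eq_empty_iff)
  have finc: "finite (c g)" for g using fin by (simp add: c_def)
  have "d ^ card J * real n * real (card ?G) = (\<Sum>a\<in>A. (d * real n) ^ card J)"
    by (simp add: n cardG power_mult_distrib)
  also have "\<dots> \<le> (\<Sum>a\<in>A. real (card {b\<in>B. (a, b) \<in> E}) ^ card J)"
    using d by (intro sum_mono power_mono) auto
  also have "\<dots> = (\<Sum>a\<in>A. real (card {g\<in>?G. a \<in> c g}))"
  proof (intro sum.cong refl)
    fix a assume "a \<in> A"
    then have "{g\<in>?G. a \<in> c g} = J \<rightarrow>\<^sub>E {b\<in>B. (a, b) \<in> E}"
      unfolding set_eq_iff by (simp add: c_def PiE_iff) blast
    then show "real (card {b\<in>B. (a, b) \<in> E}) ^ card J = real (card {g\<in>?G. a \<in> c g})"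
      using fin by (simp add: card_PiE)
  qed
  also have "\<dots> = (\<Sum>a\<in>A. \<Sum>g\<in>?G. if a \<in> c g then 1 else 0)"
    using finG by (simp add: sum.If_cases Int_def)
  also have "\<dots> = (\<Sum>g\<in>?G. \<Sum>a\<in>A. if a \<in> c g then 1 else 0)" by (rule sum.swap)
  also have "\<dots> = (\<Sum>g\<in>?G. real (card (c g)))"
    using fin by (intro sum.cong refl) (simp add: sum.If_cases c_def Int_def)
  finally have avg: "d ^ card J * real n \<le> (\<Sum>g\<in>?G. real (card (c g))) / real (card ?G)"
    using n cardG by (simp add: pos_le_divide_eq)
  have "d ^ (card I * card J) * real n ^ (card I + card J)
     = real (card ?G) * (d ^ card J * real n) ^ card I"
    by (simp add: cardG power_mult_distrib power_add power_mult[symmetric] mult_ac)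
  also have "\<dots> \<le> real (card ?G) * ((\<Sum>g\<in>?G. real (card (c g))) / real (card ?G)) ^ card I"
    using avg d by (intro mult_left_mono power_mono) auto
  also have "\<dots> \<le> (\<Sum>g\<in>?G. real (card (c g)) ^ card I)"
    by (rule power_mean_le[OF finG neG]) simp
  also have "\<dots> = (\<Sum>g\<in>?G. real (card (I \<rightarrow>\<^sub>E c g)))"
    using fin by (simp add: card_PiE)
  also have "\<dots> = real (card (SIGMA g:?G. I \<rightarrow>\<^sub>E c g))"
    using finG fin finc by (subst card_SigmaI) (auto intro!: finite_PiE)
  also have "card (SIGMA g:?G. I \<rightarrow>\<^sub>E c g)
     = card (prod.swap ` (SIGMA g:?G. I \<rightarrow>\<^sub>E c g))"
    by (simp add: card_image)
  also have "prod.swap ` (SIGMA g:?G. I \<rightarrow>\<^sub>E c g)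
     = {(f, g). f \<in> I \<rightarrow>\<^sub>E A \<and> g \<in> J \<rightarrow>\<^sub>E B \<and> (\<forall>i\<in>I. \<forall>j\<in>J. (f i, g j) \<in> E)}"
    by (force simp: c_def PiE_iff image_iff)
  finally show ?thesis .
qed

lemma card_PiE_ge:
  fixes d :: real
  assumes "finite I" "0 \<le> d" "\<And>i. i \<in> I \<Longrightarrow> d \<le> real (card (S i))"
  shows "d ^ card I \<le> real (card (PiE I S))"
proof -
  have "d ^ card I = (\<Prod>i\<in>I. d)" by simp
  also have "\<dots> \<le> (\<Prod>i\<in>I. real (card (S i)))" using assms by (intro prod_mono) auto
  finally show ?thesis using assms by (simp add: card_PiE)
qed

text \<open>The four conditions of \<open>absorbs\<close> involve disjoint sets of slots, so the
  counts multiply. Edges to the fixed vertices \<open>a\<close> and \<open>b\<close> restrict one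
  slot each, and the minimum degree gives a factor \<open>d\<close> per slot. The other two
  conditions ask for complete bipartite patterns between free slots. Each of the four yields
  \<open>d^(h^2)\<close>. Tile edges do not enter, since they come from the random graph.\<close>

lemma card_absorbs_ge:
  fixes E :: "('a \<times> 'b) set" and h :: nat
  defines "T \<equiv> {..2 * h} \<times> {..<h}"
  assumes fin: "finite A" "finite B" and n: "card A = n" "card B = n" "n > 0" and h: "h \<ge> 1"
    and d: "0 \<le> d" "\<And>a. a \<in> A \<Longrightarrow> d * real n \<le> real (card {b\<in>B. (a, b) \<in> E})"
      "\<And>b. b \<in> B \<Longrightarrow> d * real n \<le> real (card {a\<in>A. (a, b) \<in> E})"
    and ab: "\<And>i. i < h \<Longrightarrow> a i \<in> A" "\<And>i. i < h \<Longrightarrow> b i \<in> B"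
  shows "d ^ (4 * h\<^sup>2) * real n ^ (2 * card T)
    \<le> real (card {(x, y). x \<in> T \<rightarrow>\<^sub>E A \<and> y \<in> T \<rightarrow>\<^sub>E B \<and> absorbs h E a b x y})"
proof -
  define T0 T1 T2 where T012: "T0 = {0::nat} \<times> {..<h}" "T1 = {1..h} \<times> {..<h}" "T2 = {Suc h..2 * h} \<times> {..<h}"
  define TX TY where TXY: "TX = {1..h} \<times> {0::nat}" "TY = {Suc h..2 * h} \<times> {0::nat}"
  \<comment> \<open>The unconstrained slots: on the left, the tiles \<open>1, ..., h\<close> matter
    only at position 0, and on the right, the tiles \<open>h + 1, ..., 2 * h\<close> only at
    position 0.\<close>
  define WX WY where WXY: "WX = {1..h} \<times> {1..<h}" "WY = {Suc h..2 * h} \<times> {1..<h}"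
  have Tun: "T = T0 \<union> T1 \<union> T2" "T1 = TX \<union> WX" "T2 = TY \<union> WY"
    using h by (auto simp: T012 T_def TXY WXY)
  have disj: "T0 \<inter> T1 = {}" "T0 \<inter> T2 = {}" "T1 \<inter> T2 = {}" "TX \<inter> WX = {}" "TY \<inter> WY = {}"
    by (auto simp: T012 TXY WXY)
  have finT: "finite T0" "finite T1" "finite T2" "finite TX" "finite TY" "finite WX" "finite WY" "finite T"
    by (auto simp: T012 TXY WXY T_def)
  have cards: "card T0 = h" "card T1 = h * h" "card T2 = h * h" "card TX = h" "card TY = h"
    "card WX = h * (h - 1)" "card WY = h * (h - 1)" "card T = (2 * h + 1) * h"
    by (auto simp: T012 TXY WXY T_def card_cartesian_product)
  define QQ where "QQ = (\<Pi>\<^sub>E (r, j)\<in>T1. {y\<in>B. (a (r - 1), y) \<in> E})"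
  define PP where "PP = (\<Pi>\<^sub>E (r, j)\<in>T2. {x\<in>A. (x, b (r - Suc h)) \<in> E})"
  define XQ where "XQ = {(f, g). f \<in> TX \<rightarrow>\<^sub>E A \<and> g \<in> T0 \<rightarrow>\<^sub>E B \<and> (\<forall>i\<in>TX. \<forall>j\<in>T0. (f i, g j) \<in> E)}"
  define PY where "PY = {(f, g). f \<in> T0 \<rightarrow>\<^sub>E A \<and> g \<in> TY \<rightarrow>\<^sub>E B \<and> (\<forall>i\<in>T0. \<forall>j\<in>TY. (f i, g j) \<in> E)}"
  define V where "V = (WX \<rightarrow>\<^sub>E A) \<times> (WY \<rightarrow>\<^sub>E B)"
  have QQ: "(d * real n) ^ (h * h) \<le> real (card QQ)"
    unfolding QQ_def cards(2)[symmetric] using d(1) ab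
    by (intro card_PiE_ge finT) (auto simp: T012 intro!: d(2))
  have PP: "(d * real n) ^ (h * h) \<le> real (card PP)"
    unfolding PP_def cards(3)[symmetric] using d(1) ab
    by (intro card_PiE_ge finT) (auto simp: T012 intro!: d(3))
  have XQ: "d ^ (h * h) * real n ^ (h + h) \<le> real (card XQ)"
    using card_complete_pairs_ge[OF finT(4,1) fin n d(1,2)] by (simp add: XQ_def cards)
  have PY: "d ^ (h * h) * real n ^ (h + h) \<le> real (card PY)"
    using card_complete_pairs_ge[OF finT(1,5) fin n d(1,2)] by (simp add: PY_def cards)
  have V: "real n ^ (2 * (h * (h - 1))) = real (card V)"
    using finT n by (simp add: V_def card_cartesian_product card_PiE cards mult_2 power_add)
  \<comment> \<open>Gluing the independent choices: the left side uses the slots \<open>T0\<close>,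
    \<open>T2\<close>, \<open>TX\<close>, \<open>WX\<close>, the right side \<open>T0\<close>,
    \<open>T1\<close>, \<open>TY\<close>, \<open>WY\<close>. Both are partitions of
    \<open>T\<close>, hence the injectivity.\<close>
  define \<Phi> :: "(nat \<times> nat \<Rightarrow> 'b) \<times> (nat \<times> nat \<Rightarrow> 'a) \<times> ((nat \<times> nat \<Rightarrow> 'a) \<times> (nat \<times> nat \<Rightarrow> 'b)) \<times>
      ((nat \<times> nat \<Rightarrow> 'a) \<times> (nat \<times> nat \<Rightarrow> 'b)) \<times> ((nat \<times> nat \<Rightarrow> 'a) \<times> (nat \<times> nat \<Rightarrow> 'b)) \<Rightarrow> _"
    where "\<Phi> = (\<lambda>(q, p, (x, q0), (p0, y), (wx, wy)).
      (\<lambda>t\<in>T. if t \<in> T0 then p0 t else if t \<in> T2 then p t else if t \<in> TX then x t else wx t,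
       \<lambda>t\<in>T. if t \<in> T0 then q0 t else if t \<in> T1 then q t else if t \<in> TY then y t else wy t))"
  let ?G = "{(x, y). x \<in> T \<rightarrow>\<^sub>E A \<and> y \<in> T \<rightarrow>\<^sub>E B \<and> absorbs h E a b x y}"
  have "card (QQ \<times> PP \<times> XQ \<times> PY \<times> V) \<le> card ?G"
  proof (rule card_inj_on_le[of \<Phi>])
    show "inj_on \<Phi> (QQ \<times> PP \<times> XQ \<times> PY \<times> V)"
    proof (rule inj_onI)
      fix z z' assume z: "z \<in> QQ \<times> PP \<times> XQ \<times> PY \<times> V" "z' \<in> QQ \<times> PP \<times> XQ \<times> PY \<times> V" "\<Phi> z = \<Phi> z'"
      obtain q p x q0 p0 y wx wy where z1: "z = (q, p, (x, q0), (p0, y), (wx, wy))"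
        by (metis surj_pair)
      obtain q' p' x' q0' p0' y' wx' wy' where z2: "z' = (q', p', (x', q0'), (p0', y'), (wx', wy'))"
        by (metis surj_pair)
      have mem: "q \<in> QQ" "p \<in> PP" "(x, q0) \<in> XQ" "(p0, y) \<in> PY" "(wx, wy) \<in> V"
        "q' \<in> QQ" "p' \<in> PP" "(x', q0') \<in> XQ" "(p0', y') \<in> PY" "(wx', wy') \<in> V"
        and eq: "\<Phi> (q, p, (x, q0), (p0, y), (wx, wy)) = \<Phi> (q', p', (x', q0'), (p0', y'), (wx', wy'))"
        using z by (simp_all add: z1 z2)
      let ?x = "\<lambda>t. if t \<in> T0 then p0 t else if t \<in> T2 then p t else if t \<in> TX then x t else wx t"
      let ?x' = "\<lambda>t. if t \<in> T0 then p0' t else if t \<in> T2 then p' t else if t \<in> TX then x' t else wx' t"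
      let ?y = "\<lambda>t. if t \<in> T0 then q0 t else if t \<in> T1 then q t else if t \<in> TY then y t else wy t"
      let ?y' = "\<lambda>t. if t \<in> T0 then q0' t else if t \<in> T1 then q' t else if t \<in> TY then y' t else wy' t"
      have xe: "?x t = ?x' t" and ye: "?y t = ?y' t" if "t \<in> T" for t
        using arg_cong[OF eq, of "\<lambda>z. fst z t"] arg_cong[OF eq, of "\<lambda>z. snd z t"] that
        by (simp_all only: \<Phi>_def prod.case fst_conv snd_conv restrict_apply if_True)
      have sub: "t \<in> T0 \<Longrightarrow> t \<in> T \<and> t \<notin> T1 \<and> t \<notin> T2" "t \<in> T1 \<Longrightarrow> t \<in> T \<and> t \<notin> T0 \<and> t \<notin> T2"
        "t \<in> T2 \<Longrightarrow> t \<in> T \<and> t \<notin> T0 \<and> t \<notin> T1" "t \<in> TX \<Longrightarrow> t \<in> T1 \<and> t \<notin> WX" "t \<in> WX \<Longrightarrow> t \<in> T1 \<and> t \<notin> TX"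
        "t \<in> TY \<Longrightarrow> t \<in> T2 \<and> t \<notin> WY" "t \<in> WY \<Longrightarrow> t \<in> T2 \<and> t \<notin> TY" for t
        using Tun disj by auto
      have ext: "q \<in> extensional T1" "q' \<in> extensional T1" "p \<in> extensional T2" "p' \<in> extensional T2"
        "x \<in> extensional TX" "x' \<in> extensional TX" "q0 \<in> extensional T0" "q0' \<in> extensional T0"
        "p0 \<in> extensional T0" "p0' \<in> extensional T0" "y \<in> extensional TY" "y' \<in> extensional TY"
        "wx \<in> extensional WX" "wx' \<in> extensional WX" "wy \<in> extensional WY" "wy' \<in> extensional WY"
        using mem by (simp_all add: QQ_def PP_def XQ_def PY_def V_def PiE_iff)
      have "p0 = p0'"
      proof (rule extensionalityI[OF ext(9,10)])
        show "p0 t = p0' t" if "t \<in> T0" for t using xe[of t] that sub(1)[of t] by simp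
      qed
      moreover have "q0 = q0'"
      proof (rule extensionalityI[OF ext(7,8)])
        show "q0 t = q0' t" if "t \<in> T0" for t using ye[of t] that sub(1)[of t] by simp
      qed
      moreover have "p = p'"
      proof (rule extensionalityI[OF ext(3,4)])
        show "p t = p' t" if "t \<in> T2" for t using xe[of t] that sub(3)[of t] by simp
      qed
      moreover have "q = q'"
      proof (rule extensionalityI[OF ext(1,2)])
        show "q t = q' t" if "t \<in> T1" for t using ye[of t] that sub(2)[of t] by simp
      qed
      moreover have "x = x'"
      proof (rule extensionalityI[OF ext(5,6)])
        show "x t = x' t" if "t \<in> TX" for t using xe[of t] that sub(4)[of t] sub(2)[of t] by simp
      qed
      moreover have "y = y'"
      proof (rule extensionalityI[OF ext(11,12)])
        show "y t = y' t" if "t \<in> TY" for t using ye[of t] that sub(6)[of t] sub(3)[of t] by simp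
      qed
      moreover have "wx = wx'"
      proof (rule extensionalityI[OF ext(13,14)])
        show "wx t = wx' t" if "t \<in> WX" for t using xe[of t] that sub(5)[of t] sub(2)[of t] by simp
      qed
      moreover have "wy = wy'"
      proof (rule extensionalityI[OF ext(15,16)])
        show "wy t = wy' t" if "t \<in> WY" for t using ye[of t] that sub(7)[of t] sub(3)[of t] by simp
      qed
      ultimately show "z = z'" by (simp add: z1 z2)
    qed
    show "\<Phi> ` (QQ \<times> PP \<times> XQ \<times> PY \<times> V) \<subseteq> ?G"
    proof (rule image_subsetI)
      fix z assume z: "z \<in> QQ \<times> PP \<times> XQ \<times> PY \<times> V"
      obtain q p x q0 p0 y wx wy where z1: "z = (q, p, (x, q0), (p0, y), (wx, wy))"
        by (metis surj_pair)
      have mem: "q \<in> QQ" "p \<in> PP" "(x, q0) \<in> XQ" "(p0, y) \<in> PY" "(wx, wy) \<in> V"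
        using z by (simp_all add: z1)
      define X where "X = fst (\<Phi> (q, p, (x, q0), (p0, y), (wx, wy)))"
      define Y where "Y = snd (\<Phi> (q, p, (x, q0), (p0, y), (wx, wy)))"
      have q: "q (r, j) \<in> B" "(a (r - 1), q (r, j)) \<in> E" if "(r, j) \<in> T1" for r j
        using PiE_mem[OF mem(1)[unfolded QQ_def] that] by auto
      have p: "p (r, j) \<in> A" "(p (r, j), b (r - Suc h)) \<in> E" if "(r, j) \<in> T2" for r j
        using PiE_mem[OF mem(2)[unfolded PP_def] that] by auto
      have rest: "x \<in> TX \<rightarrow>\<^sub>E A" "q0 \<in> T0 \<rightarrow>\<^sub>E B" "\<And>i j. i \<in> TX \<Longrightarrow> j \<in> T0 \<Longrightarrow> (x i, q0 j) \<in> E"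
        "p0 \<in> T0 \<rightarrow>\<^sub>E A" "y \<in> TY \<rightarrow>\<^sub>E B" "\<And>i j. i \<in> T0 \<Longrightarrow> j \<in> TY \<Longrightarrow> (p0 i, y j) \<in> E"
        "wx \<in> WX \<rightarrow>\<^sub>E A" "wy \<in> WY \<rightarrow>\<^sub>E B"
        using mem by (simp_all add: XQ_def PY_def V_def)
      have "X t \<in> A" if "t \<in> T" for t
        using that Tun p(1)[of "fst t" "snd t"] PiE_mem[OF rest(1), of t] PiE_mem[OF rest(4), of t]
          PiE_mem[OF rest(7), of t]
        by (auto simp: X_def \<Phi>_def)
      moreover have "Y t \<in> B" if "t \<in> T" for t
        using that Tun q(1)[of "fst t" "snd t"] PiE_mem[OF rest(2), of t] PiE_mem[OF rest(5), of t]
          PiE_mem[OF rest(8), of t]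
        by (auto simp: Y_def \<Phi>_def)
      ultimately have "X \<in> T \<rightarrow>\<^sub>E A" "Y \<in> T \<rightarrow>\<^sub>E B"
        by (auto simp: PiE_iff X_def Y_def \<Phi>_def)
      moreover have "absorbs h E a b X Y"
        unfolding absorbs_def
      proof (intro allI impI conjI)
        fix i j assume ij: "i < h" "j < h"
        have slots: "(Suc i, j) \<in> T1" "(Suc (h + i), j) \<in> T2" "(Suc i, 0) \<in> TX" "(0, j) \<in> T0" "(0, i) \<in> T0"
          "(Suc (h + j), 0) \<in> TY" using ij by (auto simp: T012 TXY)
        then have notin: "(Suc i, j) \<notin> T0" "(Suc (h + i), j) \<notin> T0" "(Suc i, 0) \<notin> T0" "(Suc i, 0) \<notin> T2"
          "(Suc (h + j), 0) \<notin> T0" "(Suc (h + j), 0) \<notin> T1"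
          using Tun disj by auto
        have inT: "(Suc i, j) \<in> T" "(Suc (h + i), j) \<in> T" "(Suc i, 0) \<in> T" "(0, j) \<in> T" "(0, i) \<in> T"
          "(Suc (h + j), 0) \<in> T" using slots Tun by auto
        show "(a i, Y (Suc i, j)) \<in> E" using q(2)[OF slots(1)] slots notin inT by (simp add: Y_def \<Phi>_def)
        show "(X (Suc (h + i), j), b i) \<in> E" using p(2)[OF slots(2)] slots notin inT by (simp add: X_def \<Phi>_def)
        show "(X (Suc i, 0), Y (0, j)) \<in> E" using rest(3)[OF slots(3,4)] slots notin inT by (simp add: X_def Y_def \<Phi>_def)
        show "(X (0, i), Y (Suc (h + j), 0)) \<in> E" using rest(6)[OF slots(5,6)] slots notin inT by (simp add: X_def Y_def \<Phi>_def)
      qed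
      ultimately show "\<Phi> z \<in> ?G"
        by (simp add: X_def Y_def z1 case_prod_beta)
    qed
    show "finite ?G"
      by (rule finite_subset[of _ "(T \<rightarrow>\<^sub>E A) \<times> (T \<rightarrow>\<^sub>E B)"]) (auto intro!: finite_PiE simp: fin finT)
  qed
  then have "real (card QQ) * (real (card PP) * (real (card XQ) * (real (card PY) * real (card V)))) \<le> real (card ?G)"
    by (simp only: card_cartesian_product flip: of_nat_mult)
  moreover have "(d * real n) ^ (h * h) * ((d * real n) ^ (h * h) * ((d ^ (h * h) * real n ^ (h + h)) *
      ((d ^ (h * h) * real n ^ (h + h)) * real n ^ (2 * (h * (h - 1))))))
    \<le> real (card QQ) * (real (card PP) * (real (card XQ) * (real (card PY) * real (card V))))"
    using d(1) by (intro mult_mono QQ PP XQ PY eq_refl[OF V]) auto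
  moreover have "(d * real n) ^ (h * h) * ((d * real n) ^ (h * h) * ((d ^ (h * h) * real n ^ (h + h)) *
      ((d ^ (h * h) * real n ^ (h + h)) * real n ^ (2 * (h * (h - 1)))))) = d ^ (4 * h\<^sup>2) * real n ^ (2 * card T)"
  proof -
    have e: "4 * h\<^sup>2 = h * h + h * h + h * h + h * h" by (simp add: power2_eq_square)
    have "h * (h - 1) + h = h * h" using h by (cases h) auto
    then have e': "2 * card T = h * h + h * h + (h + h) + (h + h) + 2 * (h * (h - 1))"
      by (simp add: cards algebra_simps)
    show ?thesis unfolding e e' power_add power_mult_distrib by (simp add: mult_ac)
  qed
  ultimately show ?thesis by linarith
qed

section \<open>Tilings from a random placement of the tiles\<close>

text \<open>A tiling is an enumeration of each side by pairs of a tile and a position in it. Tile indices are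
  pairs because tiles are grouped for absorption.\<close>

definition biclique_tiled :: "nat \<Rightarrow> ('a \<times> 'b) set \<Rightarrow> 'a set \<Rightarrow> 'b set \<Rightarrow> bool" where
  "biclique_tiled h E A B \<longleftrightarrow> (\<exists>(R :: (nat \<times> nat) set) u v.
     bij_betw u (R \<times> {..<h}) A \<and> bij_betw v (R \<times> {..<h}) B \<and>
     (\<forall>\<rho>\<in>R. \<forall>i<h. \<forall>j<h. (u (\<rho>, i), v (\<rho>, j)) \<in> E))"

lemma extend_to_bij_betw:
  assumes "finite A" "inj_on u S" "u ` S \<subseteq> A" "finite S'" "S \<inter> S' = {}" "card S + card S' = card A" "finite S"
  obtains u' where "bij_betw u' (S \<union> S') A" "\<And>s. s \<in> S \<Longrightarrow> u' s = u s"
proof -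
  have "card (A - u ` S) = card S'"
    using assms by (simp add: card_Diff_subset card_image)
  then obtain w where w: "bij_betw w S' (A - u ` S)"
    using assms finite_same_card_bij[of S' "A - u ` S"] by auto
  define u' where "u' = (\<lambda>s. if s \<in> S then u s else w s)"
  have "bij_betw u' S (u ` S)"
    using assms(2) by (auto simp: u'_def bij_betw_def inj_on_def)
  moreover have "bij_betw u' S' (A - u ` S)"
    using w assms(5) by (subst bij_betw_cong[of _ _ w]) (auto simp: u'_def)
  ultimately have "bij_betw u' (S \<union> S') (u ` S \<union> (A - u ` S))"
    by (rule bij_betw_combine) auto
  moreover have "u ` S \<union> (A - u ` S) = A" using assms(3) by auto
  ultimately show ?thesis using that[of u'] by (simp add: u'_def)
qed

text \<open>The leftover vertices may be cut into chunks arbitrarily, because the absorbers are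
  supplied for every choice of \<open>a\<close> and \<open>b\<close>. The cardinality assumption is
  where divisibility of \<open>n\<close> by \<open>h\<close> enters: what the groups leave uncovered
  is exactly \<open>L\<close> chunks on each side.\<close>

lemma biclique_tiled_if_absorbers:
  fixes u :: "(nat \<times> nat) \<times> nat \<Rightarrow> 'a" and v :: "(nat \<times> nat) \<times> nat \<Rightarrow> 'b"
  assumes fin: "finite A" "finite B" and card: "card A = h * ((2 * h + 1) * N + L)" "card B = h * ((2 * h + 1) * N + L)"
    and u: "inj_on u (({..<N} \<times> {..2 * h}) \<times> {..<h})" "u ` (({..<N} \<times> {..2 * h}) \<times> {..<h}) \<subseteq> A"
    and v: "inj_on v (({..<N} \<times> {..2 * h}) \<times> {..<h})" "v ` (({..<N} \<times> {..2 * h}) \<times> {..<h}) \<subseteq> B"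
    and tiles: "\<And>k r i j. k < N \<Longrightarrow> r \<le> 2 * h \<Longrightarrow> i < h \<Longrightarrow> j < h \<Longrightarrow> (u ((k, r), i), v ((k, r), j)) \<in> E"
    and abs: "\<And>a b. a \<in> {..<h} \<rightarrow>\<^sub>E A \<Longrightarrow> b \<in> {..<h} \<rightarrow>\<^sub>E B \<Longrightarrow>
      L \<le> card {k\<in>{..<N}. absorbs h E a b (\<lambda>(r, i). u ((k, r), i)) (\<lambda>(r, i). v ((k, r), i))}"
  shows "biclique_tiled h E A B"
proof -
  let ?S = "({..<N} \<times> {..2 * h}) \<times> {..<h}" and ?S' = "({N..<N + L} \<times> {0::nat}) \<times> {..<h}"
  have disj: "?S \<inter> ?S' = {}" by auto
  have cS: "card ?S + card ?S' = h * ((2 * h + 1) * N + L)"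
    by (simp add: card_cartesian_product algebra_simps)
  obtain u' where u': "bij_betw u' (?S \<union> ?S') A" "\<And>s. s \<in> ?S \<Longrightarrow> u' s = u s"
    using extend_to_bij_betw[OF fin(1) u _ disj] cS card by auto
  obtain v' where v': "bij_betw v' (?S \<union> ?S') B" "\<And>s. s \<in> ?S \<Longrightarrow> v' s = v s"
    using extend_to_bij_betw[OF fin(2) v _ disj] cS card by auto
  have R: "?S \<union> ?S' = ({..<N} \<times> {..2 * h} \<union> {N..<N + L} \<times> {0}) \<times> {..<h}" by auto
  define a where "a = (\<lambda>l. \<lambda>i\<in>{..<h}. u' ((N + l, 0), i))"
  define b where "b = (\<lambda>l. \<lambda>i\<in>{..<h}. v' ((N + l, 0), i))"
  define S where "S = (\<lambda>l. {k\<in>{..<N}. absorbs h E (a l) (b l) (\<lambda>(r, i). u ((k, r), i)) (\<lambda>(r, i). v ((k, r), i))})"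
  have mem: "a l \<in> {..<h} \<rightarrow>\<^sub>E A" "b l \<in> {..<h} \<rightarrow>\<^sub>E B" if "l < L" for l
    using that bij_betw_apply[OF u'(1)] bij_betw_apply[OF v'(1)] by (auto simp: a_def b_def)
  have "L \<le> card (S l)" if "l < L" for l using abs[OF mem[OF that]] by (simp add: S_def)
  then obtain g where g: "inj_on g {..<L}" "\<And>l. l < L \<Longrightarrow> g l \<in> S l"
    using greedy_transversal[of L S] by (auto simp: S_def)
  have "\<exists>u'' v''. bij_betw u'' (({..<N} \<times> {..2 * h} \<union> {N..<N + L} \<times> {0}) \<times> {..<h}) A \<and>
    bij_betw v'' (({..<N} \<times> {..2 * h} \<union> {N..<N + L} \<times> {0}) \<times> {..<h}) B \<and>
    (\<forall>\<rho>\<in>{..<N} \<times> {..2 * h} \<union> {N..<N + L} \<times> {0}. \<forall>i<h. \<forall>j<h. (u'' (\<rho>, i), v'' (\<rho>, j)) \<in> E)"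
  proof (rule absorb[where g = g])
    show "bij_betw u' (({..<N} \<times> {..2 * h} \<union> {N..<N + L} \<times> {0}) \<times> {..<h}) A"
      "bij_betw v' (({..<N} \<times> {..2 * h} \<union> {N..<N + L} \<times> {0}) \<times> {..<h}) B"
      using u' v' by (simp_all add: R)
    show "(u' ((k, r), i), v' ((k, r), j)) \<in> E" if "k < N" "r \<le> 2 * h" "i < h" "j < h" for k r i j
      using tiles[OF that] that by (simp add: u' v')
    show "inj_on g {..<L}" by fact
    show "g l < N" if "l < L" for l using g(2)[OF that] by (simp add: S_def)
    show "absorbs h E (\<lambda>i. u' ((N + l, 0), i)) (\<lambda>i. v' ((N + l, 0), i))
        (\<lambda>(r, i). u' ((g l, r), i)) (\<lambda>(r, i). v' ((g l, r), i))" if "l < L" for l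
      using g(2)[OF that] by (simp add: S_def absorbs_def a_def b_def u' v')
  qed
  then show ?thesis unfolding biclique_tiled_def by blast
qed

lemma absorbs_mono: "absorbs h E a b x y \<Longrightarrow> E \<subseteq> E' \<Longrightarrow> absorbs h E' a b x y"
  unfolding absorbs_def by blast

lemma absorbs_cong:
  assumes "\<And>s. s \<in> {..2 * h} \<times> {..<h} \<Longrightarrow> x s = x' s" "\<And>s. s \<in> {..2 * h} \<times> {..<h} \<Longrightarrow> y s = y' s"
  shows "absorbs h E a b x y = absorbs h E a b x' y'"
  using assms by (auto simp: absorbs_def)

text \<open>If no tiling exists, some choice of \<open>h\<close> vertices on each side has too few
  absorbing groups; there are \<open>n^(2h)\<close> choices. For a fixed choice, pass to independent
  uniform vertices and use that the groups are then independent trials with success probability at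
  least \<open>d^(4h^2)\<close>.\<close>

lemma card_untiled_permutations:
  fixes u :: "(nat \<times> nat) \<times> nat \<Rightarrow> 'a" and v :: "(nat \<times> nat) \<times> nat \<Rightarrow> 'b"
  assumes fin: "finite A" "finite B" and card: "card A = n" "card B = n" and n: "n = h * ((2 * h + 1) * N + L)" "n > 0"
    and h: "h \<ge> 1" and N: "N0 \<le> N" and t: "L \<le> Suc t"
    and d: "0 \<le> d" "\<And>a. a \<in> A \<Longrightarrow> d * real n \<le> real (card {b\<in>B. (a, b) \<in> E})"
      "\<And>b. b \<in> B \<Longrightarrow> d * real n \<le> real (card {a\<in>A. (a, b) \<in> E})"
    and u: "inj_on u (({..<N} \<times> {..2 * h}) \<times> {..<h})" "u ` (({..<N} \<times> {..2 * h}) \<times> {..<h}) \<subseteq> A"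
    and v: "inj_on v (({..<N} \<times> {..2 * h}) \<times> {..<h})" "v ` (({..<N} \<times> {..2 * h}) \<times> {..<h}) \<subseteq> B"
    and tiles: "\<And>k r i j. k < N \<Longrightarrow> r \<le> 2 * h \<Longrightarrow> i < h \<Longrightarrow> j < h \<Longrightarrow> (u ((k, r), i), v ((k, r), j)) \<in> F"
    and s: "s = N0 * ((2 * h + 1) * h)"
  shows "real (card {(\<sigma>, \<tau>). \<sigma> permutes A \<and> \<tau> permutes B \<and>
      \<not> biclique_tiled h (E \<union> map_prod \<sigma> \<tau> ` F) A B}) * real (n - s) ^ (2 * s)
    \<le> (fact n)\<^sup>2 * (real n ^ (2 * h) * (real n ^ (2 * s) * (1 - d ^ (4 * h\<^sup>2) / 2) ^ N0 * 2 ^ t))"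
proof -
  define T :: "(nat \<times> nat) set" where "T = {..2 * h} \<times> {..<h}"
  define S where "S = {..<N0} \<times> T"
  define u1 where "u1 = (\<lambda>(k, (r, i)). u ((k, r), i))"
  define v1 where "v1 = (\<lambda>(k, (r, i)). v ((k, r), i))"
  \<comment> \<open>Absorption is tested in the deterministic edges \<open>E\<close> alone and only
    among the first \<open>N0\<close> groups, so the event depends on the permutations only through
    the images of the slots in \<open>S\<close>.\<close>
  define D where "D = (\<lambda>a b f g. card {k\<in>{..<N0}. absorbs h E a b (\<lambda>s\<in>T. f (k, s)) (\<lambda>s\<in>T. g (k, s))} \<le> t)"
  define Bad where "Bad = (\<lambda>(a, b). {(\<sigma>, \<tau>). \<sigma> permutes A \<and> \<tau> permutes B \<and>
     D a b (restrict (\<sigma> \<circ> u1) S) (restrict (\<tau> \<circ> v1) S)})"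
  define Idx where "Idx = ({..<h} \<rightarrow>\<^sub>E A) \<times> ({..<h} \<rightarrow>\<^sub>E B)"
  have finT: "finite T" "finite S" by (auto simp: T_def S_def)
  have cT: "card T = (2 * h + 1) * h" by (simp add: T_def card_cartesian_product)
  have cS: "card S = s" by (simp add: S_def card_cartesian_product cT s)
  have finIdx: "finite Idx" using fin by (auto simp: Idx_def intro!: finite_PiE)
  have cIdx: "card Idx = n ^ (2 * h)"
    using fin card by (simp add: Idx_def card_cartesian_product card_PiE mult_2 power_add)
  have subS: "(\<lambda>(k, (r, i)). ((k, r), i)) ` S \<subseteq> ({..<N} \<times> {..2 * h}) \<times> {..<h}"
    using N by (auto simp: S_def T_def)
  have u1: "inj_on u1 S" "u1 ` S \<subseteq> A"
  proof -
    have "u1 = u \<circ> (\<lambda>(k, (r, i)). ((k, r), i))" by (auto simp: u1_def)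
    moreover have "inj_on (\<lambda>(k, (r, i)). ((k, r), i)) S" by (auto simp: inj_on_def)
    ultimately show "inj_on u1 S" using comp_inj_on inj_on_subset[OF u(1) subS] by metis
    show "u1 ` S \<subseteq> A" using u(2) subS by (fastforce simp: u1_def)
  qed
  have v1: "inj_on v1 S" "v1 ` S \<subseteq> B"
  proof -
    have "v1 = v \<circ> (\<lambda>(k, (r, i)). ((k, r), i))" by (auto simp: v1_def)
    moreover have "inj_on (\<lambda>(k, (r, i)). ((k, r), i)) S" by (auto simp: inj_on_def)
    ultimately show "inj_on v1 S" using comp_inj_on inj_on_subset[OF v(1) subS] by metis
    show "v1 ` S \<subseteq> B" using v(2) subS by (fastforce simp: v1_def)
  qed
  have cover: "{(\<sigma>, \<tau>). \<sigma> permutes A \<and> \<tau> permutes B \<and> \<not> biclique_tiled h (E \<union> map_prod \<sigma> \<tau> ` F) A B}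
     \<subseteq> (\<Union>z\<in>Idx. Bad z)"
  proof (rule subsetI, clarify)
    fix \<sigma> \<tau> assume \<sigma>: "\<sigma> permutes A" and \<tau>: "\<tau> permutes B"
      and nt: "\<not> biclique_tiled h (E \<union> map_prod \<sigma> \<tau> ` F) A B"
    let ?E = "E \<union> map_prod \<sigma> \<tau> ` F"
    show "(\<sigma>, \<tau>) \<in> (\<Union>z\<in>Idx. Bad z)"
    proof (rule ccontr)
      assume not: "(\<sigma>, \<tau>) \<notin> (\<Union>z\<in>Idx. Bad z)"
      have "biclique_tiled h ?E A B"
      proof (rule biclique_tiled_if_absorbers[where u = "\<sigma> \<circ> u" and v = "\<tau> \<circ> v" and N = N and L = L])
        show "inj_on (\<sigma> \<circ> u) (({..<N} \<times> {..2 * h}) \<times> {..<h})" "inj_on (\<tau> \<circ> v) (({..<N} \<times> {..2 * h}) \<times> {..<h})"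
          using u(1) v(1) permutes_inj_on[OF \<sigma>] permutes_inj_on[OF \<tau>] by (auto intro: comp_inj_on)
        show "(\<sigma> \<circ> u) ` (({..<N} \<times> {..2 * h}) \<times> {..<h}) \<subseteq> A" "(\<tau> \<circ> v) ` (({..<N} \<times> {..2 * h}) \<times> {..<h}) \<subseteq> B"
          using u(2) v(2) permutes_in_image[OF \<sigma>] permutes_in_image[OF \<tau>] by (auto simp: image_subset_iff)
        show "((\<sigma> \<circ> u) ((k, r), i), (\<tau> \<circ> v) ((k, r), j)) \<in> ?E" if "k < N" "r \<le> 2 * h" "i < h" "j < h" for k r i j
          using tiles[OF that] by force
        fix a b assume ab: "a \<in> {..<h} \<rightarrow>\<^sub>E A" "b \<in> {..<h} \<rightarrow>\<^sub>E B"
        then have "\<not> D a b (restrict (\<sigma> \<circ> u1) S) (restrict (\<tau> \<circ> v1) S)"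
          using not \<sigma> \<tau> by (auto simp: Bad_def Idx_def)
        \<comment> \<open>Failure of "at most \<open>t\<close>" gives \<open>t + 1\<close> absorbing
          groups, which is why \<open>L \<le> Suc t\<close> is enough.\<close>
        then have "Suc t \<le> card {k\<in>{..<N0}. absorbs h E a b (\<lambda>s\<in>T. restrict (\<sigma> \<circ> u1) S (k, s)) (\<lambda>s\<in>T. restrict (\<tau> \<circ> v1) S (k, s))}"
          by (simp add: D_def)
        also have "\<dots> \<le> card {k\<in>{..<N}. absorbs h ?E a b (\<lambda>(r, i). (\<sigma> \<circ> u) ((k, r), i)) (\<lambda>(r, i). (\<tau> \<circ> v) ((k, r), i))}"
        proof (rule card_mono)
          show "{k\<in>{..<N0}. absorbs h E a b (\<lambda>s\<in>T. restrict (\<sigma> \<circ> u1) S (k, s)) (\<lambda>s\<in>T. restrict (\<tau> \<circ> v1) S (k, s))}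
            \<subseteq> {k\<in>{..<N}. absorbs h ?E a b (\<lambda>(r, i). (\<sigma> \<circ> u) ((k, r), i)) (\<lambda>(r, i). (\<tau> \<circ> v) ((k, r), i))}"
          proof (rule subsetI)
            fix k assume k: "k \<in> {k\<in>{..<N0}. absorbs h E a b (\<lambda>s\<in>T. restrict (\<sigma> \<circ> u1) S (k, s)) (\<lambda>s\<in>T. restrict (\<tau> \<circ> v1) S (k, s))}"
            have "absorbs h E a b (\<lambda>s\<in>T. restrict (\<sigma> \<circ> u1) S (k, s)) (\<lambda>s\<in>T. restrict (\<tau> \<circ> v1) S (k, s))
               = absorbs h E a b (\<lambda>(r, i). (\<sigma> \<circ> u) ((k, r), i)) (\<lambda>(r, i). (\<tau> \<circ> v) ((k, r), i))"
              by (rule absorbs_cong) (use k in \<open>auto simp: S_def T_def u1_def v1_def\<close>)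
            then show "k \<in> {k\<in>{..<N}. absorbs h ?E a b (\<lambda>(r, i). (\<sigma> \<circ> u) ((k, r), i)) (\<lambda>(r, i). (\<tau> \<circ> v) ((k, r), i))}"
              using k N by (auto intro: absorbs_mono)
          qed
        qed simp
        finally show "L \<le> card {k\<in>{..<N}. absorbs h ?E a b (\<lambda>(r, i). (\<sigma> \<circ> u) ((k, r), i)) (\<lambda>(r, i). (\<tau> \<circ> v) ((k, r), i))}"
          using t by simp
      qed (use fin card n in auto)
      then show False using nt by simp
    qed
  qed
  have each: "real (card (Bad z)) * real (n - s) ^ (2 * s)
     \<le> (fact n)\<^sup>2 * (real n ^ (2 * s) * (1 - d ^ (4 * h\<^sup>2) / 2) ^ N0 * 2 ^ t)" if "z \<in> Idx" for z
  proof -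
    obtain a b where z: "z = (a, b)" "a \<in> {..<h} \<rightarrow>\<^sub>E A" "b \<in> {..<h} \<rightarrow>\<^sub>E B" using \<open>z \<in> Idx\<close> by (auto simp: Idx_def)
    let ?X = "{(f, g). f \<in> S \<rightarrow>\<^sub>E A \<and> g \<in> S \<rightarrow>\<^sub>E B \<and> D a b f g}"
    have "card (Bad z) * (n - s) ^ (2 * s) \<le> (fact n)\<^sup>2 * card ?X"
      using card_permutes_pair_le[OF fin(1) card(1) fin(2) card(2) finT(2) u1 v1, of "D a b"]
      by (simp add: Bad_def z cS)
    then have "real (card (Bad z) * (n - s) ^ (2 * s)) \<le> real ((fact n)\<^sup>2 * card ?X)" by (rule of_nat_mono)
    then have "real (card (Bad z)) * real (n - s) ^ (2 * s) \<le> (fact n)\<^sup>2 * real (card ?X)" by simp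
    also have "\<dots> \<le> (fact n)\<^sup>2 * (real n ^ (2 * (card {..<N0} * card T)) * (1 - d ^ (4 * h\<^sup>2) / 2) ^ card {..<N0} * 2 ^ t)"
    proof (rule mult_left_mono)
      have "d ^ (4 * h\<^sup>2) * real n ^ (2 * card T)
        \<le> real (card {(x, y). x \<in> T \<rightarrow>\<^sub>E A \<and> y \<in> T \<rightarrow>\<^sub>E B \<and> absorbs h E a b x y})"
        unfolding T_def by (rule card_absorbs_ge[OF fin card n(2) h d]) (use z in auto)
      then show "real (card ?X) \<le> real n ^ (2 * (card {..<N0} * card T)) * (1 - d ^ (4 * h\<^sup>2) / 2) ^ card {..<N0} * 2 ^ t"
        unfolding S_def D_def by (intro card_few_good_blocks finT fin card) auto
    qed simp
    finally show ?thesis by (simp add: cT s)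
  qed
  have finBad: "finite (Bad z)" for z
    by (rule finite_subset[of _ "{\<sigma>. \<sigma> permutes A} \<times> {\<tau>. \<tau> permutes B}"])
      (auto simp: Bad_def finite_permutations fin split: prod.splits)
  have "card {(\<sigma>, \<tau>). \<sigma> permutes A \<and> \<tau> permutes B \<and> \<not> biclique_tiled h (E \<union> map_prod \<sigma> \<tau> ` F) A B}
     \<le> card (\<Union>z\<in>Idx. Bad z)" by (intro card_mono cover finite_UN_I finIdx finBad)
  also have "\<dots> \<le> (\<Sum>z\<in>Idx. card (Bad z))" by (rule card_UN_le[OF finIdx])
  finally have "real (card {(\<sigma>, \<tau>). \<sigma> permutes A \<and> \<tau> permutes B \<and> \<not> biclique_tiled h (E \<union> map_prod \<sigma> \<tau> ` F) A B})
     \<le> (\<Sum>z\<in>Idx. real (card (Bad z)))" by (simp flip: of_nat_sum)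
  then have "real (card {(\<sigma>, \<tau>). \<sigma> permutes A \<and> \<tau> permutes B \<and> \<not> biclique_tiled h (E \<union> map_prod \<sigma> \<tau> ` F) A B})
      * real (n - s) ^ (2 * s) \<le> (\<Sum>z\<in>Idx. real (card (Bad z))) * real (n - s) ^ (2 * s)"
    by (rule mult_right_mono) simp
  also have "\<dots> = (\<Sum>z\<in>Idx. real (card (Bad z)) * real (n - s) ^ (2 * s))" by (rule sum_distrib_right)
  also have "\<dots> \<le> (\<Sum>z\<in>Idx. (fact n)\<^sup>2 * (real n ^ (2 * s) * (1 - d ^ (4 * h\<^sup>2) / 2) ^ N0 * 2 ^ t))"
    by (intro sum_mono each)
  also have "\<dots> = (fact n)\<^sup>2 * (real n ^ (2 * h) * (real n ^ (2 * s) * (1 - d ^ (4 * h\<^sup>2) / 2) ^ N0 * 2 ^ t))"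
    by (simp add: cIdx)
  finally show ?thesis .
qed

text \<open>The law is invariant under relabelling either side, so the probability of
  \<open>Bad\<close> equals its average over all relabellings. Exchanging the two averages leaves,
  for each fixed graph \<open>f\<close> outside the exceptional set \<open>NN\<close>, a counting
  problem about permutations, in which \<open>f\<close> and any structure found in it are
  deterministic.\<close>

lemma prob_symmetrization:
  fixes A :: "'a set" and B :: "'b set" and Bad NN :: "('a \<times> 'b \<Rightarrow> bool) set"
  assumes fin: "finite A" "finite B" and card: "card A = n" "card B = n"
    and bad: "\<And>f. f \<notin> NN \<Longrightarrow> real (card {(\<sigma>, \<tau>). \<sigma> permutes A \<and> \<tau> permutes B \<and>
        (\<lambda>(x, y). f (inv \<sigma> x, inv \<tau> y)) \<in> Bad}) \<le> \<delta> * (fact n)\<^sup>2"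
    and \<delta>: "0 \<le> \<delta>"
  shows "measure_pmf.prob (Pi_pmf (A \<times> B) False (\<lambda>_. bernoulli_pmf p)) Bad
    \<le> measure_pmf.prob (Pi_pmf (A \<times> B) False (\<lambda>_. bernoulli_pmf p)) NN + \<delta>"
proof -
  define \<mu> where "\<mu> = Pi_pmf (A \<times> B) False (\<lambda>_. bernoulli_pmf p)"
  define Prm where "Prm = {\<sigma>. \<sigma> permutes A} \<times> {\<tau>. \<tau> permutes B}"
  define rel :: "('a \<Rightarrow> 'a) \<times> ('b \<Rightarrow> 'b) \<Rightarrow> ('a \<times> 'b \<Rightarrow> bool) \<Rightarrow> 'a \<times> 'b \<Rightarrow> bool"
    where "rel = (\<lambda>(\<sigma>, \<tau>) f (x, y). f (inv \<sigma> x, inv \<tau> y))"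
  have finPrm: "finite Prm" using fin by (simp add: Prm_def finite_permutations)
  have cardPrm: "real (card Prm) = (fact n)\<^sup>2"
    using fin card by (simp add: Prm_def card_cartesian_product card_permutations power2_eq_square)
  have fin\<mu>: "finite (set_pmf \<mu>)"
    unfolding \<mu>_def using fin by (intro finite_set_Pi_pmf) (auto intro: finite_subset[OF subset_UNIV])
  have inv: "measure_pmf.prob \<mu> {f. rel z f \<in> Bad} = measure_pmf.prob \<mu> Bad" if "z \<in> Prm" for z
  proof -
    obtain \<sigma> \<tau> where z: "z = (\<sigma>, \<tau>)" "\<sigma> permutes A" "\<tau> permutes B" using \<open>z \<in> Prm\<close> by (auto simp: Prm_def)
    have inv: "inv \<sigma> permutes A" "inv \<tau> permutes B" using z permutes_inv by auto
    have "bij_betw (map_prod (inv \<sigma>) (inv \<tau>)) (A \<times> B) (A \<times> B)"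
      using permutes_imp_bij[OF inv(1)] permutes_imp_bij[OF inv(2)] by (rule bij_betw_map_prod)
    then have "\<mu> = map_pmf (\<lambda>g. g \<circ> map_prod (inv \<sigma>) (inv \<tau>)) \<mu>"
      unfolding \<mu>_def using fin permutes_in_image[OF inv(1)] permutes_in_image[OF inv(2)]
      by (intro Pi_pmf_bij_betw) auto
    moreover have "g \<circ> map_prod (inv \<sigma>) (inv \<tau>) = rel z g" for g by (auto simp: rel_def z)
    ultimately have "\<mu> = map_pmf (rel z) \<mu>" by simp
    then have "measure_pmf.prob \<mu> Bad = measure_pmf.prob (map_pmf (rel z) \<mu>) Bad" by simp
    then show ?thesis by (simp add: vimage_def)
  qed
  have "(fact n)\<^sup>2 * measure_pmf.prob \<mu> Bad = (\<Sum>z\<in>Prm. measure_pmf.prob \<mu> {f. rel z f \<in> Bad})"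
    by (simp add: inv cardPrm)
  also have "\<dots> = (\<Sum>z\<in>Prm. measure_pmf.expectation \<mu> (indicator {f. rel z f \<in> Bad}))" by simp
  also have "\<dots> = measure_pmf.expectation \<mu> (\<lambda>f. \<Sum>z\<in>Prm. indicator {f. rel z f \<in> Bad} f)"
    by (intro Bochner_Integration.integral_sum[symmetric] integrable_measure_pmf_finite fin\<mu>)
  also have "\<dots> \<le> measure_pmf.expectation \<mu> (\<lambda>f. (fact n)\<^sup>2 * (indicator NN f + \<delta>))"
  proof (rule expectation_mono_finite[OF fin\<mu>])
    fix f
    have "(\<Sum>z\<in>Prm. indicator {f. rel z f \<in> Bad} f) = real (card {z\<in>Prm. rel z f \<in> Bad})"
      using finPrm by (simp add: indicator_def sum.If_cases Int_def)
    also have "\<dots> \<le> (fact n)\<^sup>2 * (indicator NN f + \<delta>)"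
    proof (cases "f \<in> NN")
      case True
      have "real (card {z\<in>Prm. rel z f \<in> Bad}) \<le> real (card Prm)"
        by (intro of_nat_mono card_mono finPrm) auto
      also have "\<dots> \<le> (fact n)\<^sup>2 * (1 + \<delta>)" using \<delta> by (simp add: cardPrm)
      finally show ?thesis using True by simp
    next
      case False
      have "{z\<in>Prm. rel z f \<in> Bad} = {(\<sigma>, \<tau>). \<sigma> permutes A \<and> \<tau> permutes B \<and> (\<lambda>(x, y). f (inv \<sigma> x, inv \<tau> y)) \<in> Bad}"
        by (auto simp: Prm_def rel_def)
      then show ?thesis using bad[OF False] False by (simp add: mult.commute)
    qed
    finally show "(\<Sum>z\<in>Prm. indicator {f. rel z f \<in> Bad} f) \<le> (fact n)\<^sup>2 * (indicator NN f + \<delta>)" .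
  qed
  also have "\<dots> = (fact n)\<^sup>2 * (measure_pmf.prob \<mu> NN + \<delta>)"
    by (simp add: Bochner_Integration.integral_add integrable_measure_pmf_finite[OF fin\<mu>])
  finally show ?thesis by (simp add: \<mu>_def)
qed

text \<open>The exceptional graphs are those with two \<open>m\<close>-sets that span no biclique;
  every other graph has greedy tiles, whose position is then randomised. The two summands are the
  errors of these two stages.\<close>

lemma prob_untiled_le:
  fixes A :: "'a set" and B :: "'b set" and c d p :: real
  assumes fin: "finite A" "finite B" and card: "card A = n" "card B = n" and n: "n = h * ((2 * h + 1) * N + L)" "n > 0"
    and h: "h \<ge> 1" and N: "N0 \<le> N" and t: "L \<le> Suc t"
    and d: "0 \<le> d" "d \<le> 1" "\<And>a. a \<in> A \<Longrightarrow> d * real n \<le> real (card {b\<in>B. (a, b) \<in> E})"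
      "\<And>b. b \<in> B \<Longrightarrow> d * real n \<le> real (card {a\<in>A. (a, b) \<in> E})"
    and s: "s = N0 * ((2 * h + 1) * h)" "s < n"
    and m: "h \<le> m" "h * ((2 * h + 1) * N) + m \<le> n"
    and c: "0 < c" "2 * 4 ^ h * c \<le> 1"
    and p: "real K * (c * real m powr (- ((2 * real h - 1) / (real h)\<^sup>2))) \<le> p" "p \<le> 1"
  shows "measure_pmf.prob (Pi_pmf (A \<times> B) False (\<lambda>_. bernoulli_pmf p))
      {f. \<not> biclique_tiled h (E \<union> {e. f e}) A B}
    \<le> 4 ^ n * exp (- 2 * (c ^ (h\<^sup>2) / (2 * real h ^ (2 * h)))\<^sup>2 * real m) ^ K
      + real n ^ (2 * h) * ((real n / real (n - s)) ^ (2 * s) * (1 - d ^ (4 * h\<^sup>2) / 2) ^ N0 * 2 ^ t)"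
proof -
  let ?NN = "{f. \<exists>X Y. X \<subseteq> A \<and> Y \<subseteq> B \<and> card X = m \<and> card Y = m \<and> bicliques h X Y f = {}}"
  let ?Bad = "{f. \<not> biclique_tiled h (E \<union> {e. f e}) A B}"
  let ?\<delta> = "real n ^ (2 * h) * ((real n / real (n - s)) ^ (2 * s) * (1 - d ^ (4 * h\<^sup>2) / 2) ^ N0 * 2 ^ t)"
  have d1: "d ^ (4 * h\<^sup>2) \<le> 1" using d by (simp add: power_le_one)
  have "measure_pmf.prob (Pi_pmf (A \<times> B) False (\<lambda>_. bernoulli_pmf p)) ?Bad
    \<le> measure_pmf.prob (Pi_pmf (A \<times> B) False (\<lambda>_. bernoulli_pmf p)) ?NN + ?\<delta>"
  proof (rule prob_symmetrization[OF fin card])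
    fix f assume f: "f \<notin> ?NN"
    have "\<exists>u v. inj_on u (({..<N} \<times> {..2 * h}) \<times> {..<h}) \<and> u ` (({..<N} \<times> {..2 * h}) \<times> {..<h}) \<subseteq> A \<and>
      inj_on v (({..<N} \<times> {..2 * h}) \<times> {..<h}) \<and> v ` (({..<N} \<times> {..2 * h}) \<times> {..<h}) \<subseteq> B \<and>
      (\<forall>r\<in>{..<N} \<times> {..2 * h}. \<forall>i<h. \<forall>j<h. f (u (r, i), v (r, j)))"
      by (rule greedy_biclique_rows[OF fin card]) (use f m(2) in \<open>auto simp: card_cartesian_product mult_ac\<close>)
    then obtain u v where u: "inj_on u (({..<N} \<times> {..2 * h}) \<times> {..<h})" "u ` (({..<N} \<times> {..2 * h}) \<times> {..<h}) \<subseteq> A"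
      and v: "inj_on v (({..<N} \<times> {..2 * h}) \<times> {..<h})" "v ` (({..<N} \<times> {..2 * h}) \<times> {..<h}) \<subseteq> B"
      and uv: "\<forall>r\<in>{..<N} \<times> {..2 * h}. \<forall>i<h. \<forall>j<h. f (u (r, i), v (r, j))" by auto
    \<comment> \<open>Composing the indicator with the inverse permutations moves the edge set
      forward.\<close>
    have eq: "{e. (\<lambda>(x, y). f (inv \<sigma> x, inv \<tau> y)) e} = map_prod \<sigma> \<tau> ` {e. f e}"
      if "\<sigma> permutes A" "\<tau> permutes B" for \<sigma> \<tau>
    proof (intro set_eqI iffI)
      fix e assume "e \<in> {e. (\<lambda>(x, y). f (inv \<sigma> x, inv \<tau> y)) e}"
      then show "e \<in> map_prod \<sigma> \<tau> ` {e. f e}"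
        using permutes_inverses(1)[OF that(1)] permutes_inverses(1)[OF that(2)]
        by (intro image_eqI[of _ _ "map_prod (inv \<sigma>) (inv \<tau>) e"]) (auto split: prod.splits)
    qed (use permutes_inverses(2)[OF that(1)] permutes_inverses(2)[OF that(2)] in auto)
    have "{(\<sigma>, \<tau>). \<sigma> permutes A \<and> \<tau> permutes B \<and> (\<lambda>(x, y). f (inv \<sigma> x, inv \<tau> y)) \<in> ?Bad}
      = {(\<sigma>, \<tau>). \<sigma> permutes A \<and> \<tau> permutes B \<and> \<not> biclique_tiled h (E \<union> map_prod \<sigma> \<tau> ` {e. f e}) A B}"
      using eq by auto
    then have "real (card {(\<sigma>, \<tau>). \<sigma> permutes A \<and> \<tau> permutes B \<and> (\<lambda>(x, y). f (inv \<sigma> x, inv \<tau> y)) \<in> ?Bad})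
        * real (n - s) ^ (2 * s)
      \<le> (fact n)\<^sup>2 * (real n ^ (2 * h) * (real n ^ (2 * s) * (1 - d ^ (4 * h\<^sup>2) / 2) ^ N0 * 2 ^ t))"
      using card_untiled_permutations[OF fin card n h N t d(1,3,4) u v _ s(1), where F = "{e. f e}"] uv
      by simp
    then have "real (card {(\<sigma>, \<tau>). \<sigma> permutes A \<and> \<tau> permutes B \<and> (\<lambda>(x, y). f (inv \<sigma> x, inv \<tau> y)) \<in> ?Bad})
      \<le> (fact n)\<^sup>2 * (real n ^ (2 * h) * (real n ^ (2 * s) * (1 - d ^ (4 * h\<^sup>2) / 2) ^ N0 * 2 ^ t)) / real (n - s) ^ (2 * s)"
      by (rule mult_imp_le_div_pos[rotated]) (use s(2) in simp)
    also have "\<dots> = ?\<delta> * (fact n)\<^sup>2" by (simp add: power_divide mult_ac)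
    finally show "real (card {(\<sigma>, \<tau>). \<sigma> permutes A \<and> \<tau> permutes B \<and> (\<lambda>(x, y). f (inv \<sigma> x, inv \<tau> y)) \<in> ?Bad})
      \<le> ?\<delta> * (fact n)\<^sup>2" .
  qed (use d1 in auto)
  also have "measure_pmf.prob (Pi_pmf (A \<times> B) False (\<lambda>_. bernoulli_pmf p)) ?NN
    \<le> 4 ^ n * exp (- 2 * (c ^ (h\<^sup>2) / (2 * real h ^ (2 * h)))\<^sup>2 * real m) ^ K"
    by (rule prob_some_pair_no_biclique[OF fin card h m(1) c p])
  finally show ?thesis by simp
qed

section \<open>Choice of the constants\<close>

lemma four_power_le_exp: "(4::real) ^ n \<le> exp (2 * real n)"
proof -
  have "(2::real) * 2 \<le> exp 1 * exp 1" using exp_ge_add_one_self[of 1] by (intro mult_mono) auto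
  then have "(4::real) \<le> exp 2" by (simp add: exp_add[symmetric])
  then have "(4::real) ^ n \<le> exp 2 ^ n" by (intro power_mono) auto
  then show ?thesis by (simp add: exp_of_nat_mult[symmetric] mult.commute)
qed

lemma two_power_le_exp: "(2::real) ^ n \<le> exp (real n)"
proof -
  have "(2::real) ^ n \<le> exp 1 ^ n" using exp_ge_add_one_self[of 1] by (intro power_mono) auto
  then show ?thesis by (simp add: exp_of_nat_mult[symmetric])
qed

text \<open>The price of independence is quadratic in the number \<open>s\<close> of sampled slots,
  while the gain from many trials is linear. A small linear sample therefore wins.\<close>

lemma falling_ratio_le_exp:
  assumes "2 * s \<le> n" "n > 0"
  shows "(real n / real (n - s)) ^ (2 * s) \<le> exp (4 * (real s)\<^sup>2 / real n)"
proof -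
  have ns: "real (n - s) = real n - real s" "real n / 2 \<le> real n - real s" "0 < real n - real s"
    using assms by auto
  have "real n / real (n - s) = 1 + real s / real (n - s)" using ns by (simp add: field_simps)
  also have "\<dots> \<le> exp (real s / real (n - s))" by (rule exp_ge_add_one_self)
  also have "\<dots> \<le> exp (real s / (real n / 2))"
    unfolding exp_le_cancel_iff ns(1) using ns assms by (intro frac_le) auto
  finally have "(real n / real (n - s)) ^ (2 * s) \<le> exp (2 * real s / real n) ^ (2 * s)"
    by (intro power_mono) (auto simp: mult.commute)
  also have "\<dots> = exp (4 * (real s)\<^sup>2 / real n)"
    by (simp add: exp_of_nat_mult[symmetric] power2_eq_square)
  finally show ?thesis .
qed

lemma prob_untiled_asymptotic:
  fixes d :: real and h :: nat
  assumes d: "0 < d" "d \<le> 1" and h: "h \<ge> 1"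
  obtains C \<kappa> n0 where "0 < C" "0 < \<kappa>"
    "\<forall>n\<ge>n0. \<forall>(A :: 'a set) (B :: 'b set) E p. h dvd n \<longrightarrow>
      finite A \<longrightarrow> finite B \<longrightarrow> card A = n \<longrightarrow> card B = n \<longrightarrow>
      (\<forall>a\<in>A. d * real n \<le> real (card {b\<in>B. (a, b) \<in> E})) \<longrightarrow>
      (\<forall>b\<in>B. d * real n \<le> real (card {a\<in>A. (a, b) \<in> E})) \<longrightarrow>
      C * real n powr (- ((2 * real h - 1) / (real h)\<^sup>2)) \<le> p \<longrightarrow> p \<le> 1 \<longrightarrow>
      measure_pmf.prob (Pi_pmf (A \<times> B) False (\<lambda>_. bernoulli_pmf p))
        {f. \<not> biclique_tiled h (E \<union> {e. f e}) A B}
      \<le> exp (- real n) + 2 * real n ^ (2 * h) * exp (- \<kappa> * real n)"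
proof -
  define \<gamma> where "\<gamma> = (2 * real h - 1) / (real h)\<^sup>2"
  define w where "w = (2 * h + 1) * h"
  define c where "c = d ^ (4 * h\<^sup>2)"
  \<comment> \<open>The sample has about \<open>\<eta> * n\<close> groups of \<open>w\<close> slots
    per side. This value makes the price \<open>4 * (\<eta> * w)^2 * n\<close> equal to
    \<open>c * \<eta> * n / 8\<close>, a quarter of the gain
    \<open>c * \<eta> * n / 2\<close>.\<close>
  define \<eta> where "\<eta> = c / (32 * (real w)\<^sup>2)"
  \<comment> \<open>With this value the bound \<open>2 * \<epsilon> * n\<close> on the number of
    chunks equals \<open>c * \<eta> * n / 8\<close>, the number of successes to be exceeded.\<close>
  define \<epsilon> where "\<epsilon> = c * \<eta> / 16"
  \<comment> \<open>The balance of the exponents: \<open>c * \<eta> / 2\<close> gained,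
    \<open>c * \<eta> / 8\<close> lost to independence and \<open>c * \<eta> / 8\<close> to the
    factor \<open>2^t\<close>.\<close>
  define \<kappa> where "\<kappa> = c * \<eta> / 4"
  define c' :: real where "c' = 1 / (2 * 4 ^ h)"
  define D where "D = c' ^ (h\<^sup>2) / (2 * real h ^ (2 * h))"
  \<comment> \<open>Enough rounds for the exponent to reach \<open>3 * n\<close>, against
    \<open>4^n \<le> exp (2 * n)\<close> from the union bound.\<close>
  define K where "K = nat \<lceil>3 / (2 * D\<^sup>2 * \<epsilon>)\<rceil>"
  \<comment> \<open>\<open>K\<close> rounds of density \<open>c' * m^(-\<gamma>)\<close> with
    \<open>m \<ge> \<epsilon> * n\<close>; adding 1 to \<open>K\<close> makes positivity
    immediate.\<close>
  define C where "C = (real K + 1) * c' * \<epsilon> powr (- \<gamma>)"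
  \<comment> \<open>Beyond \<open>n0\<close>, \<open>\<epsilon> * n\<close> exceeds
    \<open>h + w + 2\<close>. Hence \<open>h \<le> m\<close>, and the rounding in \<open>m\<close>
    and \<open>N\<close> costs at most another \<open>\<epsilon> * n\<close>.\<close>
  define n0 where "n0 = nat \<lceil>(real h + real w + 2) / \<epsilon>\<rceil>"
  have \<gamma>: "0 \<le> \<gamma>" using h by (simp add: \<gamma>_def)
  have w1: "real w \<ge> 1"
  proof -
    have "1 * 1 \<le> w" unfolding w_def using h by (intro mult_le_mono) auto
    then show ?thesis by simp
  qed
  have c: "0 < c" "c \<le> 1" using d by (auto simp: c_def power_le_one)
  have \<eta>0: "0 < \<eta>" using c w1 by (simp add: \<eta>_def)
  have \<eta>w2: "\<eta> * (real w)\<^sup>2 = c / 32" using w1 by (simp add: \<eta>_def)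
  have \<eta>w: "\<eta> * real w \<le> 1 / 32"
  proof -
    have "\<eta> * real w * 1 \<le> \<eta> * real w * real w" using w1 \<eta>0 by (intro mult_left_mono) auto
    also have "\<dots> = c / 32" using \<eta>w2 by (simp add: power2_eq_square mult_ac)
    finally show ?thesis using c by simp
  qed
  have \<eta>1: "\<eta> \<le> 1 / 32"
  proof -
    have "\<eta> * 1 \<le> \<eta> * real w" using w1 \<eta>0 by (intro mult_left_mono) auto
    then show ?thesis using \<eta>w by simp
  qed
  have \<epsilon>0: "0 < \<epsilon>" using c \<eta>0 by (simp add: \<epsilon>_def)
  have \<epsilon>1: "\<epsilon> \<le> 1 / 512"
  proof -
    have "c * \<eta> \<le> 1 * (1 / 32)" using c \<eta>0 \<eta>1 by (intro mult_mono) auto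
    then show ?thesis unfolding \<epsilon>_def by linarith
  qed
  have c': "0 < c'" "2 * 4 ^ h * c' \<le> 1" by (auto simp: c'_def)
  have D: "0 < D" using c' h by (simp add: D_def)
  have K: "3 \<le> 2 * D\<^sup>2 * \<epsilon> * real K"
  proof -
    have "3 / (2 * D\<^sup>2 * \<epsilon>) \<le> real K" unfolding K_def by linarith
    then show ?thesis using D \<epsilon>0 by (simp add: pos_divide_le_eq mult_ac)
  qed
  have C: "0 < C" using c' \<epsilon>0 by (simp add: C_def)
  have \<kappa>: "0 < \<kappa>" using c \<eta>0 by (simp add: \<kappa>_def)
  show thesis
  proof (rule that[OF C \<kappa>], intro allI impI)
    fix n and A :: "'a set" and B :: "'b set" and E p
    assume n: "n0 \<le> n" "h dvd n" and fin: "finite A" "finite B" and card: "card A = n" "card B = n"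
      and deg: "\<forall>a\<in>A. d * real n \<le> real (card {b\<in>B. (a, b) \<in> E})"
        "\<forall>b\<in>B. d * real n \<le> real (card {a\<in>A. (a, b) \<in> E})"
      and p: "C * real n powr (- ((2 * real h - 1) / (real h)\<^sup>2)) \<le> p" "p \<le> 1"
    define N0 where "N0 = nat \<lfloor>\<eta> * real n\<rfloor>"
    define t where "t = nat \<lfloor>c * \<eta> * real n / 8\<rfloor>"
    define m where "m = nat \<lceil>\<epsilon> * real n\<rceil>"
    define N where "N = (n - m) div w"
    \<comment> \<open>The number of chunks. They hold fewer than \<open>m + w\<close> vertices per
      side: \<open>m\<close> for which the greedy choice stops, and the remainder of the division by
      the group size.\<close>
    define L where "L = n div h - (2 * h + 1) * N"
    define s where "s = N0 * w"
    have big: "real h + real w + 2 \<le> \<epsilon> * real n"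
    proof -
      have "(real h + real w + 2) / \<epsilon> \<le> real n" using n(1) unfolding n0_def by linarith
      then show ?thesis using \<epsilon>0 by (simp add: pos_divide_le_eq mult.commute)
    qed
    have n_pos: "0 < n" using big \<epsilon>0 by (cases n) auto
    have \<epsilon>n: "\<epsilon> * real n \<le> real n / 512" using mult_right_mono[OF \<epsilon>1, of "real n"] by simp
    have m1: "\<epsilon> * real n \<le> real m" "real m \<le> \<epsilon> * real n + 1"
      using big unfolding m_def by linarith+
    have m: "h \<le> m" "m \<le> n" "real m + real w \<le> 2 * (\<epsilon> * real n)"
      using big m1 \<epsilon>n by linarith+
    have wpos: "0 < w" using w1 by simp
    have wN: "w * N \<le> n - m" "n - m < w * N + w"
      unfolding N_def using wpos
      by (simp, metis dividend_less_times_div mult.commute add.commute)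
    have wN': "h * ((2 * h + 1) * N) = w * N" by (simp add: w_def algebra_simps)
    have nL: "n = h * ((2 * h + 1) * N + L)"
    proof -
      have "h * ((2 * h + 1) * N) \<le> h * (n div h)" using wN m n(2) unfolding wN' by simp
      then have "(2 * h + 1) * N \<le> n div h" using h by simp
      then show ?thesis using n(2) by (simp add: L_def)
    qed
    have mN: "h * ((2 * h + 1) * N) + m \<le> n" unfolding wN' using wN(1) m(2) by linarith
    have hL: "real h * real L = real n - real w * real N"
    proof -
      have "n = w * N + h * L" using nL wN' by (metis distrib_left)
      then have "real n = real (w * N + h * L)" by simp
      then show ?thesis by simp
    qed
    have wNr: "real n - real m < real w * real N + real w"
    proof -
      have "real (n - m) < real (w * N + w)" using wN(2) by (simp only: of_nat_less_iff)
      then show ?thesis using m(2) by simp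
    qed
    have L: "real L \<le> 2 * (\<epsilon> * real n)"
    proof -
      have "1 * real L \<le> real h * real L" using h by (intro mult_right_mono) auto
      then show ?thesis using hL wNr m(3) by linarith
    qed
    have t: "L \<le> Suc t"
    proof -
      have "2 * (\<epsilon> * real n) = c * \<eta> * real n / 8" by (simp add: \<epsilon>_def)
      then have "real L \<le> real (Suc t)" using L unfolding t_def by linarith
      then show ?thesis by simp
    qed
    have N0r: "real N0 \<le> \<eta> * real n" "\<eta> * real n - 1 \<le> real N0"
    proof -
      have "0 \<le> \<eta> * real n" using \<eta>0 by simp
      then show "real N0 \<le> \<eta> * real n" "\<eta> * real n - 1 \<le> real N0" unfolding N0_def by linarith+
    qed
    have sr: "real s \<le> \<eta> * real w * real n"
      using mult_right_mono[OF N0r(1), of "real w"] by (simp add: s_def mult_ac)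
    have s32: "real s \<le> real n / 32"
      using sr mult_right_mono[OF \<eta>w, of "real n"] by simp
    have N: "N0 \<le> N"
    proof -
      have "real w * real N0 \<le> real n / 32" using s32 by (simp add: s_def mult.commute)
      also have "\<dots> \<le> real n - 2 * (\<epsilon> * real n)" using \<epsilon>n by simp
      also have "\<dots> \<le> real w * real N" using wNr m(3) by linarith
      finally show ?thesis using wpos by simp
    qed
    have p': "real K * (c' * real m powr (- ((2 * real h - 1) / (real h)\<^sup>2))) \<le> p"
    proof -
      have "real m powr (- \<gamma>) \<le> (\<epsilon> * real n) powr (- \<gamma>)"
        using m1 \<gamma> \<epsilon>0 n_pos by (intro powr_mono2') auto
      also have "\<dots> = \<epsilon> powr (- \<gamma>) * real n powr (- \<gamma>)" using \<epsilon>0 by (simp add: powr_mult)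
      finally have "real K * (c' * real m powr (- \<gamma>)) \<le> (real K + 1) * (c' * (\<epsilon> powr (- \<gamma>) * real n powr (- \<gamma>)))"
        using c' by (intro mult_mono mult_left_mono) auto
      also have "\<dots> \<le> p" using p(1) by (simp add: C_def \<gamma>_def mult_ac)
      finally show ?thesis by (simp add: \<gamma>_def)
    qed
    have sn: "s < n" using s32 n_pos by simp
    have near: "4 ^ n * exp (- 2 * D\<^sup>2 * real m) ^ K \<le> exp (- real n)"
    proof -
      have "3 * real n \<le> 2 * D\<^sup>2 * \<epsilon> * real K * real n" using K by (intro mult_right_mono) auto
      also have "\<dots> = 2 * D\<^sup>2 * real K * (\<epsilon> * real n)" by simp
      also have "\<dots> \<le> 2 * D\<^sup>2 * real K * real m" using m1 D by (intro mult_left_mono) auto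
      finally have "exp (- (2 * D\<^sup>2 * real K * real m)) \<le> exp (- 3 * real n)" by simp
      moreover have "exp (- 2 * D\<^sup>2 * real m) ^ K = exp (- (2 * D\<^sup>2 * real K * real m))"
        by (simp add: exp_of_nat_mult[symmetric] mult_ac)
      ultimately have "4 ^ n * exp (- 2 * D\<^sup>2 * real m) ^ K \<le> exp (2 * real n) * exp (- 3 * real n)"
        using four_power_le_exp[of n] by (intro mult_mono) auto
      then show ?thesis by (simp add: exp_add[symmetric])
    qed
    have far: "(real n / real (n - s)) ^ (2 * s) * (1 - c / 2) ^ N0 * 2 ^ t \<le> 2 * exp (- \<kappa> * real n)"
    proof -
      have 1: "(real n / real (n - s)) ^ (2 * s) \<le> exp (c * \<eta> * real n / 8)"
      proof -
        have "(real n / real (n - s)) ^ (2 * s) \<le> exp (4 * (real s)\<^sup>2 / real n)"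
          using s32 n_pos by (intro falling_ratio_le_exp) auto
        also have "4 * (real s)\<^sup>2 / real n \<le> 4 * (\<eta> * real w * real n)\<^sup>2 / real n"
          using sr n_pos by (intro divide_right_mono mult_left_mono power_mono) auto
        also have "\<dots> = 4 * \<eta> * (\<eta> * (real w)\<^sup>2) * real n"
          using n_pos by (simp add: power2_eq_square)
        also have "\<dots> = c * \<eta> * real n / 8" unfolding \<eta>w2 by simp
        finally show ?thesis by simp
      qed
      \<comment> \<open>The extra \<open>c / 2\<close> pays for rounding \<open>\<eta> * n\<close>
        down to \<open>N0\<close>.\<close>
      have 2: "(1 - c / 2) ^ N0 \<le> exp (c / 2 - c * \<eta> * real n / 2)"
      proof -
        have "1 - c / 2 \<le> exp (- (c / 2))" using exp_ge_add_one_self[of "- (c / 2)"] by simp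
        then have "(1 - c / 2) ^ N0 \<le> exp (- (c / 2)) ^ N0" using c by (intro power_mono) auto
        also have "\<dots> = exp (- (c / 2) * real N0)" by (simp add: exp_of_nat_mult[symmetric] mult.commute)
        also have "\<dots> \<le> exp (c / 2 - c * \<eta> * real n / 2)"
          using mult_left_mono[OF N0r(2), of "c / 2"] c by (simp add: algebra_simps)
        finally show ?thesis .
      qed
      have 3: "2 ^ t \<le> exp (c * \<eta> * real n / 8)"
      proof -
        have "0 \<le> c * \<eta> * real n / 8" using c \<eta>0 by simp
        then have "real t \<le> c * \<eta> * real n / 8" unfolding t_def by linarith
        then show ?thesis using two_power_le_exp[of t] by (meson exp_le_cancel_iff order_trans)
      qed
      have "(real n / real (n - s)) ^ (2 * s) * (1 - c / 2) ^ N0 * 2 ^ t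
        \<le> exp (c * \<eta> * real n / 8) * exp (c / 2 - c * \<eta> * real n / 2) * exp (c * \<eta> * real n / 8)"
        using 1 2 3 c by (intro mult_mono) auto
      also have "\<dots> = exp (c / 2) * exp (- \<kappa> * real n)"
        by (simp add: exp_add[symmetric] \<kappa>_def field_simps)
      also have "exp (c / 2) \<le> 2"
      proof -
        have "exp (c / 2) \<le> exp (1 / 2)" using c by simp
        then show ?thesis using exp_half_le2 by linarith
      qed
      finally show ?thesis by simp
    qed
    have "measure_pmf.prob (Pi_pmf (A \<times> B) False (\<lambda>_. bernoulli_pmf p))
        {f. \<not> biclique_tiled h (E \<union> {e. f e}) A B}
      \<le> 4 ^ n * exp (- 2 * (c' ^ (h\<^sup>2) / (2 * real h ^ (2 * h)))\<^sup>2 * real m) ^ K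
        + real n ^ (2 * h) * ((real n / real (n - s)) ^ (2 * s) * (1 - d ^ (4 * h\<^sup>2) / 2) ^ N0 * 2 ^ t)"
      using d deg by (intro prob_untiled_le[OF fin card nL n_pos h N t _ d(2) _ _ _ sn m(1) mN c' p' p(2)])
        (auto simp: s_def w_def)
    also have "\<dots> \<le> exp (- real n) + real n ^ (2 * h) * (2 * exp (- \<kappa> * real n))"
      using near far by (intro add_mono mult_left_mono) (auto simp: D_def c_def)
    finally show "measure_pmf.prob (Pi_pmf (A \<times> B) False (\<lambda>_. bernoulli_pmf p))
        {f. \<not> biclique_tiled h (E \<union> {e. f e}) A B}
      \<le> exp (- real n) + 2 * real n ^ (2 * h) * exp (- \<kappa> * real n)" by (simp add: mult_ac)
  qed
qed

section \<open>Translation to digraphs\<close>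

lemma min_degree_le:
  assumes "pair_graph G" "x \<in> pverts G"
  shows "min_degree (with_proj G) \<le> card {y. (x, y) \<in> parcs G}"
proof -
  interpret pair_graph G by fact
  have "{e \<in> parcs G. fst e = x} = Pair x ` {y. (x, y) \<in> parcs G}" by force
  then have "out_degree (with_proj G) x = card {y. (x, y) \<in> parcs G}"
    by (simp add: out_degree_def out_arcs_def card_image inj_on_def)
  moreover have "min_degree (with_proj G) \<le> out_degree (with_proj G) x"
    unfolding min_degree_def using assms(2) finite_verts by (intro Min_le) auto
  ultimately show ?thesis by simp
qed

lemma min_degree_le_sides:
  assumes G: "balanced_bipartite n A B G"
  shows "a \<in> A \<Longrightarrow> min_degree (with_proj G) \<le> card {b\<in>B. (a, b) \<in> parcs G}"
    and "b \<in> B \<Longrightarrow> min_degree (with_proj G) \<le> card {a\<in>A. (a, b) \<in> parcs G}"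
proof -
  interpret pair_graph G using G by (simp add: balanced_bipartite_def)
  have sub: "parcs G \<subseteq> A \<times> B \<union> B \<times> A" and AB: "A \<inter> B = {}" and V: "pverts G = A \<union> B"
    using G by (auto simp: balanced_bipartite_def)
  show "min_degree (with_proj G) \<le> card {b\<in>B. (a, b) \<in> parcs G}" if "a \<in> A"
  proof -
    have "{y. (a, y) \<in> parcs G} = {b\<in>B. (a, b) \<in> parcs G}" using sub AB that by auto
    then show ?thesis using min_degree_le[OF pair_graph_axioms, of a] that V by simp
  qed
  show "min_degree (with_proj G) \<le> card {a\<in>A. (a, b) \<in> parcs G}" if "b \<in> B"
  proof -
    have "{y. (b, y) \<in> parcs G} = {a\<in>A. (a, b) \<in> parcs G}"
      using sub AB that arcs_symmetric by fastforce
    then show ?thesis using min_degree_le[OF pair_graph_axioms, of b] that V by simp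
  qed
qed

text \<open>An index of the tiling becomes the complete bipartite digraph on its two sides.
  Bijectivity of the enumerations gives sides of size \<open>h\<close>, disjointness and the
  covering of all vertices.\<close>

lemma perfect_tiling_if_biclique_tiled:
  assumes G: "balanced_bipartite n A B G"
    and tiled: "biclique_tiled h (parcs G \<union> {e. f e}) A B"
  shows "\<exists>T. perfect_tiling (complete_bipartite_digraph h h)
    (Digraph_Component.union (with_proj G) (with_proj (bipartite_graph_of A B {e. f e}))) T"
proof -
  interpret pair_graph G using G by (simp add: balanced_bipartite_def)
  have sub: "parcs G \<subseteq> A \<times> B \<union> B \<times> A" and AB: "A \<inter> B = {}" and V: "pverts G = A \<union> B"
    using G by (auto simp: balanced_bipartite_def)
  let ?U = "Digraph_Component.union (with_proj G) (with_proj (bipartite_graph_of A B {e. f e}))"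
  obtain R :: "(nat \<times> nat) set" and u v where u: "bij_betw u (R \<times> {..<h}) A" and v: "bij_betw v (R \<times> {..<h}) B"
    and uv: "\<forall>\<rho>\<in>R. \<forall>i<h. \<forall>j<h. (u (\<rho>, i), v (\<rho>, j)) \<in> parcs G \<union> {e. f e}"
    using tiled unfolding biclique_tiled_def by blast
  define P where "P = (\<lambda>\<rho>. u ` ({\<rho>} \<times> {..<h}))"
  define Q where "Q = (\<lambda>\<rho>. v ` ({\<rho>} \<times> {..<h}))"
  define tile where "tile = (\<lambda>\<rho>. \<lparr>pverts = P \<rho> \<union> Q \<rho>, parcs = P \<rho> \<times> Q \<rho> \<union> Q \<rho> \<times> P \<rho>\<rparr>)"
  have PA: "P \<rho> \<subseteq> A" and QB: "Q \<rho> \<subseteq> B" if "\<rho> \<in> R" for \<rho>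
    using that u v by (auto simp: P_def Q_def bij_betw_def)
  have cards: "card (P \<rho>) = h" "card (Q \<rho>) = h" if "\<rho> \<in> R" for \<rho>
  proof -
    have "inj_on u ({\<rho>} \<times> {..<h})" "inj_on v ({\<rho>} \<times> {..<h})"
      using that u v by (auto simp: bij_betw_def intro: inj_on_subset)
    then show "card (P \<rho>) = h" "card (Q \<rho>) = h"
      by (simp_all add: P_def Q_def card_image card_cartesian_product)
  qed
  have disj: "P \<rho> \<inter> P \<rho>' = {}" "Q \<rho> \<inter> Q \<rho>' = {}" if "\<rho> \<in> R" "\<rho>' \<in> R" "\<rho> \<noteq> \<rho>'" for \<rho> \<rho>'
    using that u v by (auto simp: P_def Q_def bij_betw_def dest!: inj_onD)
  have PQ: "P \<rho> \<times> Q \<rho> \<subseteq> parcs G \<union> {e. f e}" if "\<rho> \<in> R" for \<rho>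
    using that uv by (auto simp: P_def Q_def)
  have UA: "(\<Union>\<rho>\<in>R. P \<rho>) = A" "(\<Union>\<rho>\<in>R. Q \<rho>) = B"
  proof -
    have "(\<Union>\<rho>\<in>R. P \<rho>) = u ` (R \<times> {..<h})" "(\<Union>\<rho>\<in>R. Q \<rho>) = v ` (R \<times> {..<h})"
      by (auto simp: P_def Q_def)
    then show "(\<Union>\<rho>\<in>R. P \<rho>) = A" "(\<Union>\<rho>\<in>R. Q \<rho>) = B" using u v by (simp_all add: bij_betw_def)
  qed
  have wfU: "wf_digraph ?U"
    using sub V by unfold_locales
      (auto simp: Digraph_Component.union_def bipartite_graph_of_def)
  have tile: "subgraph (with_proj (tile \<rho>)) ?U" "complete_bipartite_digraph h h (with_proj (tile \<rho>))"
    if \<rho>: "\<rho> \<in> R" for \<rho>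
  proof -
    have fin: "finite (P \<rho> \<union> Q \<rho>)" by (simp add: P_def Q_def)
    have "P \<rho> \<inter> Q \<rho> = {}" using PA[OF \<rho>] QB[OF \<rho>] AB by blast
    then show K: "complete_bipartite_digraph h h (with_proj (tile \<rho>))"
      using fin cards[OF \<rho>] unfolding complete_bipartite_digraph_pair_def tile_def by auto
    have wf: "wf_digraph (with_proj (tile \<rho>))"
      by unfold_locales (auto simp: tile_def)
    \<comment> \<open>The arcs from \<open>A\<close> to \<open>B\<close> are given. The reverse ones
      come from the symmetry of \<open>G\<close> and from the converse relation in
      \<open>bipartite_graph_of\<close>.\<close>
    have "P \<rho> \<times> Q \<rho> \<subseteq> arcs ?U" "Q \<rho> \<times> P \<rho> \<subseteq> arcs ?U"
      using PQ[OF \<rho>] PA[OF \<rho>] QB[OF \<rho>] arcs_symmetric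
      by (fastforce simp: Digraph_Component.union_def bipartite_graph_of_def)+
    then show "subgraph (with_proj (tile \<rho>)) ?U"
      using PA[OF \<rho>] QB[OF \<rho>] V wfU wf
      by (auto simp: subgraph_def compatible_def tile_def Digraph_Component.union_def)
  qed
  have "perfect_tiling (complete_bipartite_digraph h h) ?U ((\<lambda>\<rho>. with_proj (tile \<rho>)) ` R)"
    unfolding perfect_tiling_def tiling_def
  proof (intro conjI ballI)
    show "disjoint_family_on verts ((\<lambda>\<rho>. with_proj (tile \<rho>)) ` R)"
    proof (unfold disjoint_family_on_def, intro ballI impI)
      fix F F' assume F: "F \<in> (\<lambda>\<rho>. with_proj (tile \<rho>)) ` R" "F' \<in> (\<lambda>\<rho>. with_proj (tile \<rho>)) ` R" "F \<noteq> F'"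
      then obtain \<rho> \<rho>' where \<rho>: "\<rho> \<in> R" "\<rho>' \<in> R" "F = with_proj (tile \<rho>)" "F' = with_proj (tile \<rho>')" "\<rho> \<noteq> \<rho>'"
        by auto
      then show "verts F \<inter> verts F' = {}"
        using disj[of \<rho> \<rho>'] PA[of \<rho>] PA[of \<rho>'] QB[of \<rho>] QB[of \<rho>'] AB by (simp add: tile_def) blast
    qed
    show "(\<Union>F\<in>(\<lambda>\<rho>. with_proj (tile \<rho>)) ` R. verts F) = verts ?U"
      using UA V by (auto simp: tile_def Digraph_Component.union_def bipartite_graph_of_def)
  qed (use tile in auto)
  then show ?thesis by blast
qed

lemma tendsto_power_exp_zero:
  assumes "0 < \<kappa>"
  shows "((\<lambda>n. real n ^ k * exp (- \<kappa> * real n)) \<longlongrightarrow> 0) at_top"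
  using assms by real_asymp

theorem theorem1p3:
  fixes \<alpha> :: real and h :: nat
  assumes "\<alpha> > 0" and "h \<ge> 1"
  shows "\<exists>C::real. C > 0 \<and> ( \<forall>(G :: nat \<Rightarrow> 'a pair_pre_digraph) (A :: nat \<Rightarrow> 'a set) (B :: nat \<Rightarrow> 'a set)
           (p :: nat \<Rightarrow> real).
           (\<forall>n>0. h dvd n \<longrightarrow>
              balanced_bipartite n (A n) (B n) (G n) \<and>
              real (min_degree (with_proj (G n))) \<ge> \<alpha> * real n) \<longrightarrow>
           (\<forall>n>0. h dvd n \<longrightarrow> 0 \<le> p n \<and> p n \<le> 1) \<longrightarrow>
           (\<forall>\<^sub>F n in multiples_at_top h.
              p n \<ge> C * real n powr (- ((2 * real h - 1) / (real h)\<^sup>2))) \<longrightarrow>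
           ((\<lambda>n. measure_pmf.prob (random_bipartite (A n) (B n) (p n))
                {R. \<exists>T. perfect_tiling (complete_bipartite_digraph h h)
                          (Digraph_Component.union (with_proj (G n)) (with_proj R)) T})
             \<longlongrightarrow> 1) (multiples_at_top h))"
proof -
  \<comment> \<open>Capping the degree constant keeps the success probability
    \<open>d^(4h^2)\<close> at most 1.\<close>
  define d where "d = min \<alpha> 1"
  have d: "0 < d" "d \<le> 1" "d \<le> \<alpha>" using assms(1) by (auto simp: d_def)
  obtain C \<kappa> n0 where C: "0 < C" and \<kappa>: "0 < \<kappa>"
    and asym: "\<forall>n\<ge>n0. \<forall>(A :: 'a set) (B :: 'a set) E p. h dvd n \<longrightarrow>
      finite A \<longrightarrow> finite B \<longrightarrow> card A = n \<longrightarrow> card B = n \<longrightarrow>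
      (\<forall>a\<in>A. d * real n \<le> real (card {b\<in>B. (a, b) \<in> E})) \<longrightarrow>
      (\<forall>b\<in>B. d * real n \<le> real (card {a\<in>A. (a, b) \<in> E})) \<longrightarrow>
      C * real n powr (- ((2 * real h - 1) / (real h)\<^sup>2)) \<le> p \<longrightarrow> p \<le> 1 \<longrightarrow>
      measure_pmf.prob (Pi_pmf (A \<times> B) False (\<lambda>_. bernoulli_pmf p))
        {f. \<not> biclique_tiled h (E \<union> {e. f e}) A B}
      \<le> exp (- real n) + 2 * real n ^ (2 * h) * exp (- \<kappa> * real n)"
    by (rule prob_untiled_asymptotic[OF d(1,2) assms(2), where 'a = 'a and 'b = 'a])
  show ?thesis
  proof (intro exI[of _ C] conjI allI impI C)
    fix G :: "nat \<Rightarrow> 'a pair_pre_digraph" and A B :: "nat \<Rightarrow> 'a set" and p :: "nat \<Rightarrow> real"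
    assume G: "\<forall>n>0. h dvd n \<longrightarrow> balanced_bipartite n (A n) (B n) (G n) \<and>
              real (min_degree (with_proj (G n))) \<ge> \<alpha> * real n"
      and p: "\<forall>n>0. h dvd n \<longrightarrow> 0 \<le> p n \<and> p n \<le> 1"
      and pC: "\<forall>\<^sub>F n in multiples_at_top h. p n \<ge> C * real n powr (- ((2 * real h - 1) / (real h)\<^sup>2))"
    let ?prob = "\<lambda>n. measure_pmf.prob (random_bipartite (A n) (B n) (p n))
                {R. \<exists>T. perfect_tiling (complete_bipartite_digraph h h)
                          (Digraph_Component.union (with_proj (G n)) (with_proj R)) T}"
    let ?lower = "\<lambda>n. 1 - (exp (- real n) + 2 * real n ^ (2 * h) * exp (- \<kappa> * real n))"
    have lower: "?lower n \<le> ?prob n"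
      if n: "n0 \<le> n" "0 < n" "h dvd n" and pn: "p n \<ge> C * real n powr (- ((2 * real h - 1) / (real h)\<^sup>2))" for n
    proof -
      let ?\<mu> = "Pi_pmf (A n \<times> B n) False (\<lambda>_. bernoulli_pmf (p n))"
      have bal: "balanced_bipartite n (A n) (B n) (G n)" and deg: "real (min_degree (with_proj (G n))) \<ge> \<alpha> * real n"
        using G n by auto
      \<comment> \<open>Finiteness follows from a positive cardinality, hence from
        \<open>0 < n\<close>.\<close>
      have fin: "finite (A n)" "finite (B n)" and card: "card (A n) = n" "card (B n) = n"
        using bal n(2) by (auto simp: balanced_bipartite_def intro: card_ge_0_finite)
      have dn: "d * real n \<le> real (min_degree (with_proj (G n)))"
        using deg mult_right_mono[OF d(3), of "real n"] by simp
      have "measure_pmf.prob ?\<mu> {f. \<not> biclique_tiled h (parcs (G n) \<union> {e. f e}) (A n) (B n)}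
        \<le> exp (- real n) + 2 * real n ^ (2 * h) * exp (- \<kappa> * real n)"
      proof (rule asym[rule_format, OF n(1,3) fin card _ _ pn])
        show "d * real n \<le> real (card {b\<in>B n. (a, b) \<in> parcs (G n)})" if "a \<in> A n" for a
          using dn of_nat_mono[OF min_degree_le_sides(1)[OF bal that]] by (rule order_trans)
        show "d * real n \<le> real (card {a\<in>A n. (a, b) \<in> parcs (G n)})" if "b \<in> B n" for b
          using dn of_nat_mono[OF min_degree_le_sides(2)[OF bal that]] by (rule order_trans)
      qed (use p n in auto)
      then have "?lower n \<le> 1 - measure_pmf.prob ?\<mu> {f. \<not> biclique_tiled h (parcs (G n) \<union> {e. f e}) (A n) (B n)}"
        by simp
      also have "\<dots> = measure_pmf.prob ?\<mu> (- {f. \<not> biclique_tiled h (parcs (G n) \<union> {e. f e}) (A n) (B n)})"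
        using measure_pmf.prob_compl[of "{f. \<not> biclique_tiled h (parcs (G n) \<union> {e. f e}) (A n) (B n)}" ?\<mu>]
        by (simp add: Compl_eq_Diff_UNIV)
      also have "\<dots> \<le> ?prob n"
        unfolding random_bipartite_def measure_map_pmf
        by (intro measure_pmf.finite_measure_mono) (auto intro!: perfect_tiling_if_biclique_tiled[OF bal])
      finally show ?thesis .
    qed
    \<comment> \<open>The error bound tends to 0 along all \<open>n\<close>, so also along this
      finer filter; only the comparison with the probability needs divisibility.\<close>
    have top: "multiples_at_top h \<le> at_top" by (simp add: multiples_at_top_def)
    have "(?lower \<longlongrightarrow> 1 - (0 + 2 * 0)) at_top"
    proof (intro tendsto_diff tendsto_add tendsto_const)
      show "((\<lambda>n. exp (- real n)) \<longlongrightarrow> 0) at_top" by real_asymp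
      have "((\<lambda>n. 2 * (real n ^ (2 * h) * exp (- \<kappa> * real n))) \<longlongrightarrow> 2 * 0) at_top"
        by (intro tendsto_intros tendsto_power_exp_zero \<kappa>)
      then show "((\<lambda>n. 2 * real n ^ (2 * h) * exp (- \<kappa> * real n)) \<longlongrightarrow> 2 * 0) at_top"
        by (simp add: mult_ac)
    qed
    then have lim: "(?lower \<longlongrightarrow> 1) (multiples_at_top h)"
      using top by (auto intro: tendsto_mono)
    have ev: "\<forall>\<^sub>F n in multiples_at_top h. n0 \<le> n \<and> 0 < n \<and> h dvd n"
    proof -
      have "\<forall>\<^sub>F n in multiples_at_top h. n0 \<le> n \<and> 0 < n"
        using top eventually_conj[OF eventually_ge_at_top eventually_gt_at_top] by (rule filter_leD)
      moreover have "\<forall>\<^sub>F n in multiples_at_top h. h dvd n"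
        by (simp add: multiples_at_top_def eventually_inf_principal)
      ultimately show ?thesis by eventually_elim auto
    qed
    show "(?prob \<longlongrightarrow> 1) (multiples_at_top h)"
    proof (rule tendsto_sandwich[OF _ _ lim tendsto_const])
      show "\<forall>\<^sub>F n in multiples_at_top h. ?lower n \<le> ?prob n"
        using ev pC by eventually_elim (use lower in auto)
    qed simp
  qed
qed

end
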